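(* The set $\mathrm{DL\text{-}S}^0$ of valid formulas of $\mathcal L^0_{\mathrm{DL\text{-}S}}(\mathit{Atm},\mathit{Agt})$ and the set $\mathrm{DL\text{-}S}$ of valid formulas of $\mathcal L_{\mathrm{DL\text{-}S}}(\mathit{Atm},\mathit{Agt})$ are both decidable. Moreover, the satisfiability problem for formulas of $\mathcal L^0_{\mathrm{DL\text{-}S}}(\mathit{Atm},\mathit{Agt})$ is in NP.
   Context: $\mathit{Atm}$ is a countable set of atomic propositions and $\mathit{Agt}$ a finite set of agents. Formulas are given by $\varphi ::= p \mid \mathsf h_i \mid \neg\varphi \mid \varphi\wedge\psi \mid [\alpha]\varphi$ with $p\in\mathit{Atm}$, $i\in\mathit{Agt}$, where: in $\mathcal L_{\mathrm{DL\text{-}S}}(\mathit{Atm},\mathit{Agt})$ the programs are $\alpha ::= \Uparrow \mid \Downarrow \mid \Rightarrow \mid \Leftarrow \mid \alpha;\alpha' \mid \alpha\cup\alpha' \mid ?\varphi$ (no iteration); in $\mathcal L^0_{\mathrm{DL\text{-}S}}(\mathit{Atm},\mathit{Agt})$ the programs are only $\alpha ::= \Uparrow \mid \Downarrow \mid \Rightarrow \mid \Leftarrow$. A spatial model is a pair $M=(\mathcal P,\mathcal V)$ with $\mathcal P:\mathit{Agt}\to\mathbb Z\times\mathbb Z$ and $\mathcal V:\mathbb Z\times\mathbb Z\to 2^{\mathit{Atm}}$. Relations $R_\alpha$ on $\mathbb Z\times\mathbb Z$ and truth are defined by parallel induction: $(x,y)R_\Uparrow(x,y+1)$, $(x,y)R_\Downarrow(x,y-1)$,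 $(x,y)R_\Rightarrow(x+1,y)$, $(x,y)R_\Leftarrow(x-1,y)$ (and no other pairs); $R_{\alpha_1;\alpha_2}=R_{\alpha_1}\circ R_{\alpha_2}$ (first $R_{\alpha_1}$, then $R_{\alpha_2}$); $R_{\alpha_1\cup\alpha_2}=R_{\alpha_1}\cup R_{\alpha_2}$; $R_{?\varphi}=\{((x,y),(x,y)): M,(x,y)\models\varphi\}$. Truth: $M,(x,y)\models p$ iff $p\in\mathcal V(x,y)$; $M,(x,y)\models \mathsf h_i$ iff $\mathcal P(i)=(x,y)$; Boolean connectives as usual; $M,(x,y)\models[\alpha]\varphi$ iff $M,(x',y')\models\varphi$ for all $(x',y')$ with $(x,y)R_\alpha(x',y')$. A formula is valid if true in every spatial model at every position, and satisfiable if its negation is not valid. *)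

theory Defs
  imports
    "HOL-Library.FuncSet"
    "HOL-Library.Countable_Set"
    "HOL-Computational_Algebra.Polynomial"
begin

section \<open>Dynamic logic of space without iteration\<close>

type_synonym pos = "int \<times> int"

datatype ('p, 'i) form =
    Atom 'p
  | Here 'i
  | Neg "('p, 'i) form"
  | Conj "('p, 'i) form" "('p, 'i) form"
  | Box "('p, 'i) prog" "('p, 'i) form"
and ('p, 'i) prog =
    GoUp
  | GoDown
  | GoRight
  | GoLeft
  | Seq "('p, 'i) prog" "('p, 'i) prog"
  | Choice "('p, 'i) prog" "('p, 'i) prog"
  | Test "('p, 'i) form"

primrec form_over :: "'p set \<Rightarrow> 'i set \<Rightarrow> ('p, 'i) form \<Rightarrow> bool"
  and prog_over :: "'p set \<Rightarrow> 'i set \<Rightarrow> ('p, 'i) prog \<Rightarrow> bool" where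
  "form_over Atm Agt (Atom p) \<longleftrightarrow> p \<in> Atm"
| "form_over Atm Agt (Here i) \<longleftrightarrow> i \<in> Agt"
| "form_over Atm Agt (Neg \<phi>) \<longleftrightarrow> form_over Atm Agt \<phi>"
| "form_over Atm Agt (Conj \<phi> \<psi>) \<longleftrightarrow> form_over Atm Agt \<phi> \<and> form_over Atm Agt \<psi>"
| "form_over Atm Agt (Box \<alpha> \<phi>) \<longleftrightarrow> prog_over Atm Agt \<alpha> \<and> form_over Atm Agt \<phi>"
| "prog_over Atm Agt GoUp \<longleftrightarrow> True"
| "prog_over Atm Agt GoDown \<longleftrightarrow> True"
| "prog_over Atm Agt GoRight \<longleftrightarrow> True"
| "prog_over Atm Agt GoLeft \<longleftrightarrow> True"
| "prog_over Atm Agt (Seq \<alpha> \<beta>) \<longleftrightarrow> prog_over Atm Agt \<alpha> \<and> prog_over Atm Agt \<beta>"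
| "prog_over Atm Agt (Choice \<alpha> \<beta>) \<longleftrightarrow> prog_over Atm Agt \<alpha> \<and> prog_over Atm Agt \<beta>"
| "prog_over Atm Agt (Test \<phi>) \<longleftrightarrow> form_over Atm Agt \<phi>"

primrec only_moves :: "('p, 'i) form \<Rightarrow> bool" where
  "only_moves (Atom p) \<longleftrightarrow> True"
| "only_moves (Here i) \<longleftrightarrow> True"
| "only_moves (Neg \<phi>) \<longleftrightarrow> only_moves \<phi>"
| "only_moves (Conj \<phi> \<psi>) \<longleftrightarrow> only_moves \<phi> \<and> only_moves \<psi>"
| "only_moves (Box \<alpha> \<phi>) \<longleftrightarrow> \<alpha> \<in> {GoUp, GoDown, GoRight, GoLeft} \<and> only_moves \<phi>"

definition lang_DLS :: "'p set \<Rightarrow> 'i set \<Rightarrow> ('p, 'i) form set" where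
  "lang_DLS Atm Agt = {\<phi>. form_over Atm Agt \<phi>}"

definition lang_DLS0 :: "'p set \<Rightarrow> 'i set \<Rightarrow> ('p, 'i) form set" where
  "lang_DLS0 Atm Agt = {\<phi> \<in> lang_DLS Atm Agt. only_moves \<phi>}"

type_synonym ('p, 'i) model = "('i \<Rightarrow> pos) \<times> (pos \<Rightarrow> 'p set)"

definition spatial_models :: "'p set \<Rightarrow> 'i set \<Rightarrow> ('p, 'i) model set" where
  "spatial_models Atm Agt = (Agt \<rightarrow>\<^sub>E UNIV) \<times> (UNIV \<rightarrow> Pow Atm)"

primrec sat :: "('p, 'i) model \<Rightarrow> ('p, 'i) form \<Rightarrow> pos \<Rightarrow> bool"
  and rel :: "('p, 'i) model \<Rightarrow> ('p, 'i) prog \<Rightarrow> (pos \<times> pos) set" where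
  "sat M (Atom p) s \<longleftrightarrow> p \<in> snd M s"
| "sat M (Here i) s \<longleftrightarrow> fst M i = s"
| "sat M (Neg \<phi>) s \<longleftrightarrow> \<not> sat M \<phi> s"
| "sat M (Conj \<phi> \<psi>) s \<longleftrightarrow> sat M \<phi> s \<and> sat M \<psi> s"
| "sat M (Box \<alpha> \<phi>) s \<longleftrightarrow> (\<forall>t. (s, t) \<in> rel M \<alpha> \<longrightarrow> sat M \<phi> t)"
| "rel M GoUp = {((x, y), (x, y + 1)) | x y. True}"
| "rel M GoDown = {((x, y), (x, y - 1)) | x y. True}"
| "rel M GoRight = {((x, y), (x + 1, y)) | x y. True}"
| "rel M GoLeft = {((x, y), (x - 1, y)) | x y. True}"
| "rel M (Seq \<alpha> \<beta>) = rel M \<alpha> O rel M \<beta>"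
| "rel M (Choice \<alpha> \<beta>) = rel M \<alpha> \<union> rel M \<beta>"
| "rel M (Test \<phi>) = {(s, s) | s. sat M \<phi> s}"

definition valid :: "'p set \<Rightarrow> 'i set \<Rightarrow> ('p, 'i) form \<Rightarrow> bool" where
  "valid Atm Agt \<phi> \<longleftrightarrow> (\<forall>M \<in> spatial_models Atm Agt. \<forall>s. sat M \<phi> s)"

definition satisfiable :: "'p set \<Rightarrow> 'i set \<Rightarrow> ('p, 'i) form \<Rightarrow> bool" where
  "satisfiable Atm Agt \<phi> \<longleftrightarrow> \<not> valid Atm Agt (Neg \<phi>)"

definition DLS :: "'p set \<Rightarrow> 'i set \<Rightarrow> ('p, 'i) form set" where
  "DLS Atm Agt = {\<phi> \<in> lang_DLS Atm Agt. valid Atm Agt \<phi>}"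

definition DLS0 :: "'p set \<Rightarrow> 'i set \<Rightarrow> ('p, 'i) form set" where
  "DLS0 Atm Agt = {\<phi> \<in> lang_DLS0 Atm Agt. valid Atm Agt \<phi>}"

definition SAT_DLS0 :: "'p set \<Rightarrow> 'i set \<Rightarrow> ('p, 'i) form set" where
  "SAT_DLS0 Atm Agt = {\<phi> \<in> lang_DLS0 Atm Agt. satisfiable Atm Agt \<phi>}"


section \<open>Deterministic multi-tape Turing machines\<close>

type_synonym word = "nat list"

datatype move = MoveLeft | Stay | MoveRight

text \<open>
  States and tape symbols are initial segments of the naturals. State 0 is initial, state 1 is the
  accepting and state 2 the rejecting halting state; symbol 0 is the blank. Tapes are infinite in
  both directions. The transition function maps the current state and the list of scanned symbols
  (one per tape) to the next state and, for each tape, the symbol written and the head movement.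
\<close>

record tm =
  num_tapes :: nat
  num_symbols :: nat
  num_states :: nat
  delta :: "nat \<Rightarrow> nat list \<Rightarrow> nat \<times> (nat \<times> move) list"

definition wf_tm :: "tm \<Rightarrow> bool" where
  "wf_tm M \<longleftrightarrow>
     num_tapes M \<ge> 1 \<and> num_symbols M \<ge> 1 \<and> num_states M \<ge> 3 \<and>
     (\<forall>q < num_states M. \<forall>syms \<in> lists {..<num_symbols M}. length syms = num_tapes M \<longrightarrow>
        (case delta M q syms of (q', acts) \<Rightarrow>
           q' < num_states M \<and> length acts = num_tapes M \<and>
           (\<forall>(a, m) \<in> set acts. a < num_symbols M)))"

type_synonym tape = "(int \<Rightarrow> nat) \<times> int"
type_synonym config = "nat \<times> tape list"

definition read_tape :: "tape \<Rightarrow> nat" where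
  "read_tape t = fst t (snd t)"

fun act_tape :: "nat \<times> move \<Rightarrow> tape \<Rightarrow> tape" where
  "act_tape (a, m) (c, h) =
     (c(h := a), case m of MoveLeft \<Rightarrow> h - 1 | Stay \<Rightarrow> h | MoveRight \<Rightarrow> h + 1)"

fun step :: "tm \<Rightarrow> config \<Rightarrow> config" where
  "step M (q, ts) =
     (if q \<in> {1, 2} then (q, ts)
      else case delta M q (map read_tape ts) of (q', acts) \<Rightarrow> (q', map2 act_tape acts ts))"

definition word_tape :: "word \<Rightarrow> tape" where
  "word_tape w = ((\<lambda>z. if 0 \<le> z \<and> z < int (length w) then w ! nat z else 0), 0)"

text \<open>The input words are placed on the first tapes, all remaining tapes being blank.\<close>

definition init_config :: "tm \<Rightarrow> word list \<Rightarrow> config" where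
  "init_config M ws =
     (0, map (\<lambda>i. word_tape (if i < length ws then ws ! i else [])) [0..<num_tapes M])"

definition state_after :: "tm \<Rightarrow> word list \<Rightarrow> nat \<Rightarrow> nat" where
  "state_after M ws t = fst ((step M ^^ t) (init_config M ws))"

definition halts_within :: "tm \<Rightarrow> word list \<Rightarrow> nat \<Rightarrow> bool" where
  "halts_within M ws t \<longleftrightarrow> state_after M ws t \<in> {1, 2}"

definition accepts :: "tm \<Rightarrow> word list \<Rightarrow> bool" where
  "accepts M ws \<longleftrightarrow> (\<exists>t. state_after M ws t = 1)"

definition decidable_lang :: "nat set \<Rightarrow> word set \<Rightarrow> bool" where
  "decidable_lang \<Sigma> L \<longleftrightarrow>
     L \<subseteq> lists \<Sigma> \<and>
     (\<exists>M. wf_tm M \<and> \<Sigma> \<subseteq> {1..<num_symbols M} \<and>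
        (\<forall>w \<in> lists \<Sigma>. (\<exists>t. halts_within M [w] t) \<and> (accepts M [w] \<longleftrightarrow> w \<in> L)))"

text \<open>
  Membership in NP via polynomial-time verifiers. The verifier finds the instance on its first
  tape and the certificate, a word over the two-letter alphabet {1, 2}, on its second tape.
  The time bound is a polynomial in the length of the instance alone.
\<close>

definition NP_lang :: "nat set \<Rightarrow> word set \<Rightarrow> bool" where
  "NP_lang \<Sigma> L \<longleftrightarrow>
     L \<subseteq> lists \<Sigma> \<and>
     (\<exists>M (p :: nat poly). wf_tm M \<and> num_tapes M \<ge> 2 \<and> \<Sigma> \<union> {1, 2} \<subseteq> {1..<num_symbols M} \<and>
        (\<forall>w \<in> lists \<Sigma>.
           (\<forall>u \<in> lists {1, 2}. length u \<le> poly p (length w) \<longrightarrow>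
              halts_within M [w, u] (poly p (length w))) \<and>
           (w \<in> L \<longleftrightarrow>
              (\<exists>u \<in> lists {1, 2}. length u \<le> poly p (length w) \<and> accepts M [w, u]))))"


section \<open>Formulas as words\<close>

text \<open>
  Formulas are written in prefix notation over the finite alphabet {1..14}. The symbols 1 and 2
  are the binary digits zero and one; the numbers of atoms and agents are written in binary, most
  significant digit first. Since every other symbol is not a digit, no end marker is needed.
\<close>

definition alphabet :: "nat set" where
  "alphabet = {1..14}"

fun binary :: "nat \<Rightarrow> word" where
  "binary n = (if n < 2 then [n + 1] else binary (n div 2) @ [n mod 2 + 1])"

declare binary.simps [simp del]

primrec form_word :: "('p \<Rightarrow> nat) \<Rightarrow> ('i \<Rightarrow> nat) \<Rightarrow> ('p, 'i) form \<Rightarrow> word"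
  and prog_word :: "('p \<Rightarrow> nat) \<Rightarrow> ('i \<Rightarrow> nat) \<Rightarrow> ('p, 'i) prog \<Rightarrow> word" where
  "form_word a g (Atom p) = 3 # binary (a p)"
| "form_word a g (Here i) = 4 # binary (g i)"
| "form_word a g (Neg \<phi>) = 5 # form_word a g \<phi>"
| "form_word a g (Conj \<phi> \<psi>) = 6 # form_word a g \<phi> @ form_word a g \<psi>"
| "form_word a g (Box \<alpha> \<phi>) = 7 # prog_word a g \<alpha> @ form_word a g \<phi>"
| "prog_word a g GoUp = [8]"
| "prog_word a g GoDown = [9]"
| "prog_word a g GoRight = [10]"
| "prog_word a g GoLeft = [11]"
| "prog_word a g (Seq \<alpha> \<beta>) = 12 # prog_word a g \<alpha> @ prog_word a g \<beta>"
| "prog_word a g (Choice \<alpha> \<beta>) = 13 # prog_word a g \<alpha> @ prog_word a g \<beta>"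
| "prog_word a g (Test \<phi>) = 14 # form_word a g \<phi>"

text \<open>
  Atoms and agents are numbered by the library enumeration \<^const>\<open>to_nat_on\<close>, a bijection from a
  countable set onto the naturals or, if the set is finite, onto an initial segment of them.
\<close>

definition encode :: "'p set \<Rightarrow> 'i set \<Rightarrow> ('p, 'i) form \<Rightarrow> word" where
  "encode Atm Agt = form_word (to_nat_on Atm) (to_nat_on Agt)"

lemma binary_digits: "set (binary n) \<subseteq> {1, 2}"
  by (induction n rule: binary.induct) (subst binary.simps, auto)

lemma binary_not_Nil: "binary n \<noteq> []"
  by (subst binary.simps) auto

lemma binary_eq_imp: "binary m = binary n \<Longrightarrow> m = n"
proof (induction m arbitrary: n rule: binary.induct)
  case (1 m)
  show ?case
  proof (cases "m < 2 \<or> n < 2")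
    case True
    with "1.prems" show ?thesis
      by (auto simp: binary.simps[of m] binary.simps[of n] binary_not_Nil binary_not_Nil[symmetric] split: if_splits)
  next
    case False
    with "1.prems" have "binary (m div 2) = binary (n div 2)" "m mod 2 = n mod 2"
      by (auto simp: binary.simps[of m] binary.simps[of n])
    with "1.IH" False have "m div 2 = n div 2" "m mod 2 = n mod 2"
      by auto
    then show ?thesis
      by (metis div_mult_mod_eq)
  qed
qed

definition no_digit_first :: "word \<Rightarrow> bool" where
  "no_digit_first r \<longleftrightarrow> r = [] \<or> hd r \<notin> {1, 2}"

lemma no_digit_first_simps [simp]:
  "no_digit_first []"
  "no_digit_first (form_word a g \<phi> @ r)"
  "no_digit_first (prog_word a g \<alpha> @ r)"
  by (simp add: no_digit_first_def, (cases \<phi>; simp add: no_digit_first_def),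
      (cases \<alpha>; simp add: no_digit_first_def))

lemma binary_append_eq:
  assumes "binary m @ r = binary n @ r'" "no_digit_first r" "no_digit_first r'"
  shows "m = n \<and> r = r'"
proof -
  have tw: "takeWhile (\<lambda>x. x \<in> {1, 2}) (binary k @ q) = binary k" if "no_digit_first q" for k q
    using that binary_digits[of k]
    by (cases q) (auto simp: no_digit_first_def takeWhile_append)
  have "binary m = binary n"
    using assms tw by metis
  with assms(1) show ?thesis
    using binary_eq_imp by auto
qed

lemma word_append_eq:
  fixes \<phi> :: "('p, 'i) form" and \<alpha> :: "('p, 'i) prog"
  assumes inj: "inj_on a Atm" "inj_on g Agt"
  shows "form_over Atm Agt \<phi> \<Longrightarrow> form_over Atm Agt \<psi> \<Longrightarrow> no_digit_first r \<Longrightarrow> no_digit_first r' \<Longrightarrow>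
           form_word a g \<phi> @ r = form_word a g \<psi> @ r' \<Longrightarrow> \<phi> = \<psi> \<and> r = r'"
    and "prog_over Atm Agt \<alpha> \<Longrightarrow> prog_over Atm Agt \<beta> \<Longrightarrow> no_digit_first r \<Longrightarrow> no_digit_first r' \<Longrightarrow>
           prog_word a g \<alpha> @ r = prog_word a g \<beta> @ r' \<Longrightarrow> \<alpha> = \<beta> \<and> r = r'"
proof (induction \<phi> and \<alpha> arbitrary: \<psi> r r' and \<beta> r r')
  case (Atom p)
  obtain x where eq: "\<psi> = Atom x"
    using Atom.prems by (cases \<psi>) auto
  have 1: "a p = a x \<and> r = r'"
    by (rule binary_append_eq) (use Atom.prems eq in simp_all)
  with eq Atom.prems inj show ?case
    by (simp add: inj_on_eq_iff)
next
  case (Here i)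
  obtain x where eq: "\<psi> = Here x"
    using Here.prems by (cases \<psi>) auto
  have 1: "g i = g x \<and> r = r'"
    by (rule binary_append_eq) (use Here.prems eq in simp_all)
  with eq Here.prems inj show ?case
    by (simp add: inj_on_eq_iff)
next
  case (Neg \<phi>)
  obtain x where eq: "\<psi> = Neg x"
    using Neg.prems by (cases \<psi>) auto
  have "\<phi> = x \<and> r = r'"
    by (rule Neg.IH) (use Neg.prems eq in auto)
  with eq show ?case by simp
next
  case (Conj \<phi>1 \<phi>2)
  obtain x y where eq: "\<psi> = Conj x y"
    using Conj.prems by (cases \<psi>) auto
  have 1: "\<phi>1 = x \<and> form_word a g \<phi>2 @ r = form_word a g y @ r'"
    by (rule Conj.IH(1)) (use Conj.prems eq in auto)
  have "\<phi>2 = y \<and> r = r'"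
    by (rule Conj.IH(2)) (use Conj.prems eq 1 in auto)
  with 1 eq show ?case by simp
next
  case (Box \<alpha> \<phi>)
  obtain x y where eq: "\<psi> = Box x y"
    using Box.prems by (cases \<psi>) auto
  have 1: "\<alpha> = x \<and> form_word a g \<phi> @ r = form_word a g y @ r'"
    by (rule Box.IH(1)) (use Box.prems eq in auto)
  have "\<phi> = y \<and> r = r'"
    by (rule Box.IH(2)) (use Box.prems eq 1 in auto)
  with 1 eq show ?case by simp
next
  case GoUp
  then show ?case by (cases \<beta>) auto
next
  case GoDown
  then show ?case by (cases \<beta>) auto
next
  case GoRight
  then show ?case by (cases \<beta>) auto
next
  case GoLeft
  then show ?case by (cases \<beta>) auto
next
  case (Seq \<alpha>1 \<alpha>2)
  obtain x y where eq: "\<beta> = Seq x y"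
    using Seq.prems by (cases \<beta>) auto
  have 1: "\<alpha>1 = x \<and> prog_word a g \<alpha>2 @ r = prog_word a g y @ r'"
    by (rule Seq.IH(1)) (use Seq.prems eq in auto)
  have "\<alpha>2 = y \<and> r = r'"
    by (rule Seq.IH(2)) (use Seq.prems eq 1 in auto)
  with 1 eq show ?case by simp
next
  case (Choice \<alpha>1 \<alpha>2)
  obtain x y where eq: "\<beta> = Choice x y"
    using Choice.prems by (cases \<beta>) auto
  have 1: "\<alpha>1 = x \<and> prog_word a g \<alpha>2 @ r = prog_word a g y @ r'"
    by (rule Choice.IH(1)) (use Choice.prems eq in auto)
  have "\<alpha>2 = y \<and> r = r'"
    by (rule Choice.IH(2)) (use Choice.prems eq 1 in auto)
  with 1 eq show ?case by simp
next
  case (Test \<phi>)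
  obtain x where eq: "\<beta> = Test x"
    using Test.prems by (cases \<beta>) auto
  have "\<phi> = x \<and> r = r'"
    by (rule Test.IH) (use Test.prems eq in auto)
  with eq show ?case by simp
qed

lemma inj_on_encode:
  assumes "countable Atm" "countable Agt"
  shows "inj_on (encode Atm Agt) (lang_DLS Atm Agt)"
  using word_append_eq(1)[of "to_nat_on Atm" Atm "to_nat_on Agt" Agt _ _ "[]" "[]"] assms
  by (auto simp: inj_on_def lang_DLS_def encode_def)

end

theory Submission
  imports Defs
begin

text \<open>
  A formula whose programs are single moves is a Boolean combination of statements about an atom or
  an agent at a position that is determined by the enclosing moves. Hence it is satisfiable iff one
  can choose, for every conjunction that has to be false, a false conjunct such that the resulting
  literals do not conflict: a consistent set of literals has a model, in which the agents without a
  required position stand far away. The choices are a certificate of linear length, and computing the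
  literals and comparing them pairwise takes polynomial time. In a formula of the full language the
  composite programs can be eliminated beforehand, since \<open>[\<alpha>;\<beta>]\<phi>\<close>, \<open>[\<alpha>\<union>\<beta>]\<phi>\<close> and \<open>[?\<psi>]\<phi>\<close> are
  equivalent to \<open>[\<alpha>][\<beta>]\<phi>\<close>, \<open>[\<alpha>]\<phi> \<and> [\<beta>]\<phi>\<close> and \<open>\<not>(\<psi> \<and> \<not>\<phi>)\<close>; validity is then decided by trying all
  certificates for the negation. The machines are obtained from while programs on stacks, where a
  stack is a tape with the head on its top element.
\<close>

section \<open>While programs on stacks\<close>

text \<open>Every specification carries a number N that bounds each loop at each entry. For the
  verifier N is a quadratic polynomial in the length of the input, which yields a polynomial running
  time; for the decider some N merely has to exist, so that exponential growth during elimination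
  and search is acceptable. Machines have no recursion, hence every traversal of a formula becomes a
  loop over a word in prefix notation with a stack of pending symbols, and the inductions over
  formulas speak of a word followed by an arbitrary rest. Positions can be kept in unary because a
  formula cannot move further than its length. The input is an arbitrary word, so the machines must
  also recognise well-formed formulas, including the binary numbers that name atoms or agents. This
  is possible with finitely many tape symbols because the admissible numbers are all naturals or a
  finite initial segment, and either set of numerals is recognised by a finite automaton.\<close>

type_synonym state = "nat list list"

text \<open>\<open>Push\<close> pushes a blank, and \<open>Put\<close> replaces the top of a stack by a function of the tops of all
  stacks; both take one machine step.\<close>

datatype com =
    Skip
  | Push nat
  | Pop nat
  | Put nat "nat list \<Rightarrow> nat"
  | Then com com  (infixr ";;" 60)
  | Cond "nat list \<Rightarrow> bool" com com
  | While "nat list \<Rightarrow> bool" com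

text \<open>The default 0 is the blank symbol of the machine, so a loop recognises the bottom of a
  stack by scanning 0. This is why the specifications of loops that empty a stack demand that 0 does
  not occur in it.\<close>

definition peek :: "nat list \<Rightarrow> nat" where
  "peek xs = (if xs = [] then 0 else hd xs)"

lemma peek_simps [simp]: "peek [] = 0" "peek (x # xs) = x"
  by (simp_all add: peek_def)

text \<open>The weakest precondition \<open>wp N\<close> also requires every loop to stop after at most \<open>N\<close> iterations
  each time it is entered, so that the running time is bounded by a polynomial in \<open>N\<close>.\<close>

primrec wp :: "nat \<Rightarrow> com \<Rightarrow> (state \<Rightarrow> bool) \<Rightarrow> state \<Rightarrow> bool" where
  "wp N Skip Q s = Q s"
| "wp N (Push k) Q s = Q (s[k := 0 # s ! k])"
| "wp N (Pop k) Q s = Q (s[k := tl (s ! k)])"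
| "wp N (Put k f) Q s = Q (s[k := f (map peek s) # tl (s ! k)])"
| "wp N (c ;; d) Q s = wp N c (wp N d Q) s"
| "wp N (Cond b c d) Q s = (if b (map peek s) then wp N c Q s else wp N d Q s)"
| "wp N (While b c) Q s =
     ((\<lambda>R s. if b (map peek s) then wp N c R s else Q s) ^^ Suc N) (\<lambda>_. False) s"

text \<open>Separates the number \<open>n\<close> of unfoldings, on which inductions run, from the
  bound \<open>N\<close> passed to inner loops. The last unfolding can only evaluate the test, so at
  most \<open>N\<close> iterations correspond to \<open>Suc N\<close> unfoldings in
  \<open>wp_While\<close>.\<close>

definition loop :: "nat \<Rightarrow> nat \<Rightarrow> (nat list \<Rightarrow> bool) \<Rightarrow> com \<Rightarrow> (state \<Rightarrow> bool) \<Rightarrow> state \<Rightarrow> bool" where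
  "loop N n b c Q = ((\<lambda>R s. if b (map peek s) then wp N c R s else Q s) ^^ n) (\<lambda>_. False)"

lemma loop_0 [simp]: "loop N 0 b c Q s \<longleftrightarrow> False"
  by (simp add: loop_def)

lemma loop_Suc:
  "loop N (Suc n) b c Q s \<longleftrightarrow> (if b (map peek s) then wp N c (loop N n b c Q) s else Q s)"
  by (simp add: loop_def)

lemma wp_While: "wp N (While b c) Q s \<longleftrightarrow> loop N (Suc N) b c Q s"
  by (simp add: loop_def)

declare wp.simps(7) [simp del]

lemma wp_mono: "wp N c Q s \<Longrightarrow> (\<And>s. Q s \<Longrightarrow> Q' s) \<Longrightarrow> wp N c Q' s"
proof (induction c arbitrary: Q Q' s)
  case (While b c)
  have "loop N n b c Q s \<Longrightarrow> loop N n b c Q' s" for n s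
    by (induction n arbitrary: s) (auto simp: loop_Suc While.prems(2) intro: While.IH split: if_splits)
  with While.prems(1) show ?case
    by (simp add: wp_While)
next
  case (Then c d)
  show ?case
    using Then.IH(1)[OF Then.prems(1)[simplified]] Then.IH(2) Then.prems(2) by fastforce
next
  case (Cond b c d)
  then show ?case by (auto split: if_splits)
qed auto

lemma loop_mono_fuel: "loop N n b c Q s \<Longrightarrow> n \<le> m \<Longrightarrow> loop N m b c Q s"
proof (induction n arbitrary: s m)
  case (Suc n)
  then obtain m' where "m = Suc m'" "n \<le> m'"
    by (cases m) auto
  with Suc show ?case
    by (auto simp: loop_Suc intro: wp_mono split: if_splits)
qed simp

lemma loop_invariant:
  assumes "I s" "m s < n"
    and "\<And>s. I s \<Longrightarrow> b (map peek s) \<Longrightarrow> wp N c (\<lambda>s'. I s' \<and> m s' < m s) s"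
    and "\<And>s. I s \<Longrightarrow> \<not> b (map peek s) \<Longrightarrow> Q s"
  shows "loop N n b c Q s"
  using assms(1,2)
proof (induction n arbitrary: s)
  case (Suc n)
  show ?case
  proof (cases "b (map peek s)")
    case True
    have "wp N c (loop N n b c Q) s"
      by (rule wp_mono[OF assms(3)[OF Suc.prems(1) True]]) (use Suc in auto)
    with True show ?thesis by (simp add: loop_Suc)
  qed (use Suc.prems assms(4) in \<open>simp add: loop_Suc\<close>)
qed simp

text \<open>The commands still to be executed form an explicit list, since this list becomes the
  control state of the Turing machine and each step here becomes one machine step.\<close>

fun cstep :: "com list \<times> state \<Rightarrow> com list \<times> state" where
  "cstep ([], s) = ([], s)"
| "cstep (Skip # cs, s) = (cs, s)"
| "cstep (Push k # cs, s) = (cs, s[k := 0 # s ! k])"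
| "cstep (Pop k # cs, s) = (cs, s[k := tl (s ! k)])"
| "cstep (Put k f # cs, s) = (cs, s[k := f (map peek s) # tl (s ! k)])"
| "cstep ((c ;; d) # cs, s) = (c # d # cs, s)"
| "cstep (Cond b c d # cs, s) = ((if b (map peek s) then c else d) # cs, s)"
| "cstep (While b c # cs, s) = ((if b (map peek s) then c # While b c # cs else cs), s)"

text \<open>To be evaluated at the loop bound \<open>N\<close>. A conditional adds both branches
  because a maximum of polynomials need not be a polynomial; \<open>[:1, 1:]\<close> stands for
  \<open>N + 1\<close>, the number of unfoldings of a loop.\<close>

primrec time_poly :: "com \<Rightarrow> nat poly" where
  "time_poly Skip = 1"
| "time_poly (Push k) = 1"
| "time_poly (Pop k) = 1"
| "time_poly (Put k f) = 1"
| "time_poly (c ;; d) = 1 + time_poly c + time_poly d"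
| "time_poly (Cond b c d) = 1 + time_poly c + time_poly d"
| "time_poly (While b c) = [:1, 1:] * (1 + time_poly c)"

lemma cstep_trans:
  assumes "(cstep ^^ t) x = y" "(cstep ^^ t') y = z"
  shows "(cstep ^^ (t + t')) x = z"
  using assms by (simp add: add.commute[of t] funpow_add)

lemma wp_cstep:
  "wp N c Q s \<Longrightarrow> \<exists>t s'. t \<le> poly (time_poly c) N \<and> (cstep ^^ t) (c # cs, s) = (cs, s') \<and> Q s'"
proof (induction c arbitrary: Q s cs)
  case (Then c d)
  from Then.IH(1)[OF Then.prems[simplified]] obtain t1 s1 where
    1: "t1 \<le> poly (time_poly c) N" "(cstep ^^ t1) (c # d # cs, s) = (d # cs, s1)" "wp N d Q s1"
    by blast
  from Then.IH(2)[OF 1(3)] obtain t2 s2 where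
    2: "t2 \<le> poly (time_poly d) N" "(cstep ^^ t2) (d # cs, s1) = (cs, s2)" "Q s2"
    by blast
  have "(cstep ^^ Suc (t1 + t2)) ((c ;; d) # cs, s) = (cs, s2)"
    using cstep_trans[OF 1(2) 2(2)] by (simp add: funpow_swap1)
  with 1 2 show ?case
    by (intro exI[of _ "Suc (t1 + t2)"]) auto
next
  case (Cond b c d)
  have "\<exists>t s'. t \<le> poly (time_poly c) N + poly (time_poly d) N \<and>
      (cstep ^^ t) ((if b (map peek s) then c else d) # cs, s) = (cs, s') \<and> Q s'"
  proof (cases "b (map peek s)")
    case True
    with Cond.prems have "wp N c Q s" by simp
    from Cond.IH(1)[OF this, of cs] True show ?thesis
      by (auto intro: trans_le_add1)
  next
    case False
    with Cond.prems have "wp N d Q s" by simp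
    from Cond.IH(2)[OF this, of cs] False show ?thesis
      by (auto intro: trans_le_add2)
  qed
  then obtain t s' where
    "t \<le> poly (time_poly c) N + poly (time_poly d) N"
    "(cstep ^^ t) ((if b (map peek s) then c else d) # cs, s) = (cs, s')" "Q s'"
    by blast
  then show ?case
    by (intro exI[of _ "Suc t"]) (auto simp: funpow_swap1)
next
  case (While b c)
  have "\<exists>t s'. t \<le> n * (1 + poly (time_poly c) N) \<and> (cstep ^^ t) (While b c # cs, s) = (cs, s') \<and> Q s'"
    if "loop N n b c Q s" for n s
    using that
  proof (induction n arbitrary: s)
    case (Suc n)
    show ?case
    proof (cases "b (map peek s)")
      case True
      with Suc.prems have "wp N c (loop N n b c Q) s"
        by (simp add: loop_Suc)
      from While.IH[OF this, of "While b c # cs"] obtain t1 s1 where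
        1: "t1 \<le> poly (time_poly c) N"
          "(cstep ^^ t1) (c # While b c # cs, s) = (While b c # cs, s1)" "loop N n b c Q s1"
        by blast
      from Suc.IH[OF 1(3)] obtain t2 s2 where
        2: "t2 \<le> n * (1 + poly (time_poly c) N)"
          "(cstep ^^ t2) (While b c # cs, s1) = (cs, s2)" "Q s2"
        by blast
      have "(cstep ^^ Suc (t1 + t2)) (While b c # cs, s) = (cs, s2)"
        using cstep_trans[OF 1(2) 2(2)] True by (simp add: funpow_swap1)
      with 1 2 show ?thesis
        by (intro exI[of _ "Suc (t1 + t2)"]) auto
    next
      case False
      with Suc.prems show ?thesis
        by (intro exI[of _ 1] exI[of _ s]) (simp add: loop_Suc)
    qed
  qed simp
  from this[of "Suc N" s] While.prems show ?case
    by (simp add: wp_While algebra_simps)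
qed (auto intro!: exI[of _ 1])

text \<open>Over-approximates the continuations met while \<open>c\<close> runs in front of
  \<open>cs\<close>. The set is finite because each iteration of a loop returns to the same
  continuation \<open>While b c # cs\<close>; it can therefore serve as a state set.\<close>

fun conts :: "com \<Rightarrow> com list \<Rightarrow> com list set" where
  "conts (c ;; d) cs = insert ((c ;; d) # cs) (conts c (d # cs) \<union> conts d cs)"
| "conts (Cond b c d) cs = insert (Cond b c d # cs) (conts c cs \<union> conts d cs)"
| "conts (While b c) cs = insert (While b c # cs) (conts c (While b c # cs))"
| "conts c cs = {c # cs}"

lemma finite_conts: "finite (conts c cs)"
  by (induction c cs rule: conts.induct) auto

lemma Cons_in_conts: "c # cs \<in> conts c cs"
  by (cases c) auto

lemma conts_cstep:
  "x \<in> conts c cs \<Longrightarrow> fst (cstep (x, s)) \<in> insert cs (conts c cs)"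
proof (induction c cs arbitrary: x rule: conts.induct)
  case (1 c d cs)
  from "1.prems" consider "x = (c ;; d) # cs" | "x \<in> conts c (d # cs)" | "x \<in> conts d cs" by auto
  then show ?case
  proof cases
    case 2
    from "1.IH"(1)[OF this] show ?thesis using Cons_in_conts[of d cs] by auto
  next
    case 3
    from "1.IH"(2)[OF this] show ?thesis by auto
  qed (auto simp: Cons_in_conts)
next
  case (2 b c d cs)
  then show ?case by (auto simp: Cons_in_conts)
next
  case (3 b c cs)
  from "3.prems" consider "x = While b c # cs" | "x \<in> conts c (While b c # cs)" by auto
  then show ?case
    by cases (use "3.IH" in \<open>auto simp: Cons_in_conts\<close>)
qed auto

section \<open>Compilation to Turing machines\<close>

primrec wf_com :: "nat \<Rightarrow> nat \<Rightarrow> com \<Rightarrow> bool" where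
  "wf_com K S Skip \<longleftrightarrow> True"
| "wf_com K S (Push k) \<longleftrightarrow> k < K"
| "wf_com K S (Pop k) \<longleftrightarrow> k < K"
| "wf_com K S (Put k f) \<longleftrightarrow> k < K \<and> (\<forall>t \<in> lists {..<S}. length t = K \<longrightarrow> f t < S)"
| "wf_com K S (c ;; d) \<longleftrightarrow> wf_com K S c \<and> wf_com K S d"
| "wf_com K S (Cond b c d) \<longleftrightarrow> wf_com K S c \<and> wf_com K S d"
| "wf_com K S (While b c) \<longleftrightarrow> wf_com K S c"

lemma wf_conts:
  "wf_com K S c \<Longrightarrow> list_all (wf_com K S) cs \<Longrightarrow> x \<in> conts c cs \<Longrightarrow> list_all (wf_com K S) x"
  by (induction c cs arbitrary: x rule: conts.induct) auto

definition idle :: "nat list \<Rightarrow> (nat \<times> move) list" where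
  "idle t = map (\<lambda>a. (a, Stay)) t"

text \<open>\<open>Pop\<close> erases the cell that it leaves, so that a later \<open>Push\<close>,
  which only moves the head to the left, finds a blank there.\<close>

fun com_acts :: "com list \<Rightarrow> nat list \<Rightarrow> (nat \<times> move) list" where
  "com_acts (Push k # cs) t = (idle t)[k := (t ! k, MoveLeft)]"
| "com_acts (Pop k # cs) t = (idle t)[k := (0, MoveRight)]"
| "com_acts (Put k f # cs) t = (idle t)[k := (f t, Stay)]"
| "com_acts cs t = idle t"

text \<open>The control flow of \<^const>\<open>cstep\<close> depends only on the scanned symbols.\<close>

definition com_next :: "com list \<Rightarrow> nat list \<Rightarrow> com list" where
  "com_next cs t = fst (cstep (cs, map (\<lambda>a. [a]) t))"

lemma fst_cstep: "fst (cstep (cs, s)) = com_next cs (map peek s)"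
proof -
  have [simp]: "map (peek \<circ> ((\<lambda>a. [a]) \<circ> peek)) s = map peek s"
    by simp
  show ?thesis
    by (cases "(cs, s)" rule: cstep.cases) (auto simp: com_next_def)
qed

text \<open>A stack lies to the right of the head with its top under the head, so that the input words
  are stacks; everything to the left of the head is blank, which is what \<^const>\<open>Push\<close> relies on.\<close>

definition stack_tape :: "nat list \<Rightarrow> tape \<Rightarrow> bool" where
  "stack_tape xs tp \<longleftrightarrow> (\<forall>z < snd tp. fst tp z = 0) \<and>
     (\<forall>j. fst tp (snd tp + int j) = (if j < length xs then xs ! j else 0))"

lemma read_stack_tape: "stack_tape xs tp \<Longrightarrow> read_tape tp = peek xs"
  by (cases xs) (auto simp: stack_tape_def read_tape_def dest: spec[of _ 0])

lemma stack_tape_word: "stack_tape w (word_tape w)"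
  by (auto simp: stack_tape_def word_tape_def)

lemma stack_tape_push:
  assumes "stack_tape xs tp" "a = peek xs"
  shows "stack_tape (0 # xs) (act_tape (a, MoveLeft) tp)"
proof -
  obtain c h where tp: "tp = (c, h)" by fastforce
  have c: "c(h := peek xs) = c"
    using read_stack_tape[OF assms(1)] by (auto simp: tp read_tape_def)
  have "c (h - 1 + int j) = (if j < length (0 # xs) then (0 # xs) ! j else 0)" for j
    using assms(1) by (cases j) (auto simp: stack_tape_def tp)
  with assms c show ?thesis
    by (simp add: tp stack_tape_def)
qed

lemma stack_tape_pop:
  assumes "stack_tape xs tp"
  shows "stack_tape (tl xs) (act_tape (0, MoveRight) tp)"
proof -
  obtain c h where tp: "tp = (c, h)" by fastforce
  have "c (h + 1 + int j) = (if j < length (tl xs) then tl xs ! j else 0)" for j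
  proof -
    have "c (h + int (Suc j)) = (if Suc j < length xs then xs ! Suc j else 0)"
      using assms by (simp add: tp stack_tape_def del: of_nat_Suc)
    then show ?thesis
      by (auto simp: nth_tl add_ac)
  qed
  with assms show ?thesis
    by (auto simp: tp stack_tape_def)
qed

lemma stack_tape_put:
  assumes "stack_tape xs tp"
  shows "stack_tape (a # tl xs) (act_tape (a, Stay) tp)"
proof -
  obtain c h where tp: "tp = (c, h)" by fastforce
  have "(c(h := a)) (h + int j) = (if j < length (a # tl xs) then (a # tl xs) ! j else 0)" for j
    using assms by (cases j) (auto simp: stack_tape_def tp nth_tl simp del: of_nat_Suc)
  with assms show ?thesis
    by (auto simp: tp stack_tape_def)
qed

lemma stack_tape_idle:
  assumes "stack_tape xs tp" "a = peek xs"
  shows "stack_tape xs (act_tape (a, Stay) tp)"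
proof -
  obtain c h where tp: "tp = (c, h)" by fastforce
  have "c(h := peek xs) = c"
    using read_stack_tape[OF assms(1)] by (auto simp: tp read_tape_def)
  with assms show ?thesis
    by (simp add: tp)
qed

definition tapes_rep :: "state \<Rightarrow> tape list \<Rightarrow> bool" where
  "tapes_rep s ts \<longleftrightarrow> list_all2 stack_tape s ts"

lemma map_read_tapes: "tapes_rep s ts \<Longrightarrow> map read_tape ts = map peek s"
  unfolding tapes_rep_def by (induction rule: list_all2_induct) (auto simp: read_stack_tape)

lemma tapes_rep_idle: "tapes_rep s ts \<Longrightarrow> tapes_rep s (map2 act_tape (idle (map peek s)) ts)"
  unfolding tapes_rep_def
  by (induction rule: list_all2_induct) (auto simp: idle_def stack_tape_idle)

lemma tapes_rep_update:
  assumes "tapes_rep s ts" "k < length s" "stack_tape xs (act_tape a (ts ! k))"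
  shows "tapes_rep (s[k := xs]) (map2 act_tape ((idle (map peek s))[k := a]) ts)"
proof -
  have len: "length ts = length s"
    using assms(1) by (simp add: tapes_rep_def list_all2_lengthD)
  have "map2 act_tape ((idle (map peek s))[k := a]) ts =
      (map2 act_tape (idle (map peek s)) ts)[k := act_tape a (ts ! k)]"
    using assms(2) len by (intro nth_equalityI) (auto simp: idle_def nth_list_update)
  with tapes_rep_idle[OF assms(1)] assms(3) show ?thesis
    by (simp add: tapes_rep_def list_all2_update_cong)
qed

lemma tapes_rep_cstep:
  assumes rep: "tapes_rep s ts" and wf: "list_all (wf_com (length s) S) cs"
  shows "tapes_rep (snd (cstep (cs, s))) (map2 act_tape (com_acts cs (map peek s)) ts)"
proof -
  have st: "stack_tape (s ! k) (ts ! k)" if "k < length s" for k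
    using rep that by (auto simp: tapes_rep_def list_all2_conv_all_nth)
  show ?thesis
    using wf
    by (cases "(cs, s)" rule: cstep.cases)
      (auto intro!: tapes_rep_idle[OF rep] tapes_rep_update[OF rep]
         stack_tape_push stack_tape_pop stack_tape_put st)
qed

lemma length_cstep: "length (snd (cstep x)) = length (snd x)"
  by (cases x rule: cstep.cases) auto

lemma com_acts_wf:
  assumes "list_all (wf_com K S) cs" "t \<in> lists {..<S}" "length t = K" "0 < S"
  shows "length (com_acts cs t) = K \<and> (\<forall>(a, m) \<in> set (com_acts cs t). a < S)"
proof -
  have "(\<forall>(a, m) \<in> set (idle t). a < S)" "length (idle t) = K"
    using assms by (auto simp: idle_def)
  moreover have "t ! k < S" if "k < K" for k
    using assms(2,3) that by (auto simp: in_lists_conv_set)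
  ultimately show ?thesis
    using assms
    by (cases "(cs, t)" rule: com_acts.cases) (auto dest!: set_update_subset_insert[THEN subsetD])
qed

text \<open>The machine model reserves 0 for the initial state and 1 and 2 for halting, so the
  initial continuation gets 0 and all others are numbered from 3.\<close>

lemma ex_state_numbering:
  assumes "finite A" "x \<in> A"
  shows "\<exists>g n. inj_on g A \<and> g x = (0::nat) \<and> g ` (A - {x}) \<subseteq> {3..<n} \<and> 3 \<le> n"
proof -
  from assms obtain h :: "'a \<Rightarrow> nat" and m where h: "h ` A = {i. i < m}" "inj_on h A"
    using finite_imp_inj_to_nat_seg by blast
  define g where "g y = (if y = x then 0 else h y + 3)" for y
  have "inj_on g A" "g x = 0" "g ` (A - {x}) \<subseteq> {3..<m + 3}"
    using h by (auto simp: g_def inj_on_def)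
  then show ?thesis
    by (intro exI[of _ g] exI[of _ "m + 3"]) simp
qed

text \<open>The control states are the reachable continuations, the empty one included. In the state
  of the empty continuation the machine turns the top of stack \<open>r\<close> into acceptance or
  rejection, which costs the additional step in \<open>Suc\<close>.\<close>

theorem compile_com:
  assumes wf: "wf_com K S c" and "1 \<le> K" "1 \<le> S"
  shows "\<exists>M. wf_tm M \<and> num_tapes M = K \<and> num_symbols M = S \<and>
    (\<forall>ws N B. length ws \<le> K \<longrightarrow>
       wp N c (\<lambda>s. peek (s ! r) = 1 \<longleftrightarrow> B) (ws @ replicate (K - length ws) []) \<longrightarrow> r < K \<longrightarrow>
       (\<exists>t \<le> Suc (poly (time_poly c) N). state_after M ws t = (if B then 1 else 2)))"
proof -
  define A where "A = insert [] (conts c [])"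
  have finA: "finite A" and cA: "[c] \<in> A"
    by (auto simp: A_def finite_conts Cons_in_conts)
  from ex_state_numbering[OF this] obtain g :: "com list \<Rightarrow> nat" and n where
    g: "inj_on g A" "g [c] = 0" "g ` (A - {[c]}) \<subseteq> {3..<n}" "3 \<le> n"
    by blast
  have g_less: "g cs < n" "g cs \<notin> {1, 2}" if "cs \<in> A" for cs
    using g that by (cases "cs = [c]"; force)+
  have wfA: "list_all (wf_com K S) cs" if "cs \<in> A" for cs
    using wf_conts[OF wf, of "[]"] that by (auto simp: A_def)
  have next_A: "com_next cs t \<in> A" if "cs \<in> A" for cs t
    using conts_cstep[of cs c "[]" "map (\<lambda>a. [a]) t"] that
    by (auto simp: A_def com_next_def)
  \<comment> \<open>Numbers that do not belong to a continuation, among them 1 and 2, simply repeat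
    themselves; \<open>wf_tm\<close> requires a transition for them too.\<close>
  define dlt where "dlt q t =
    (if q \<in> g ` A
     then let cs = inv_into A g q in
       ((if cs = [] then if t ! r = 1 then 1 else 2 else g (com_next cs t)), com_acts cs t)
     else (q, idle t))" for q t
  define M where "M = \<lparr>num_tapes = K, num_symbols = S, num_states = n, delta = dlt\<rparr>"
  have dlt: "dlt (g cs) t =
      ((if cs = [] then if t ! r = 1 then 1 else 2 else g (com_next cs t)), com_acts cs t)"
    if "cs \<in> A" for cs t
    using that g(1) by (simp add: dlt_def Let_def)
  have wfM: "wf_tm M"
  proof -
    have "case dlt q t of (q', acts) \<Rightarrow>
        q' < n \<and> length acts = K \<and> (\<forall>(a, m) \<in> set acts. a < S)"
      if q: "q < n" and t: "t \<in> lists {..<S}" "length t = K" for q t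
    proof (cases "q \<in> g ` A")
      case True
      then obtain cs where cs: "cs \<in> A" "q = g cs" by blast
      show ?thesis
        using com_acts_wf[OF wfA[OF cs(1)] t] assms(3) g(4) g_less(1)[OF next_A[OF cs(1)]]
        by (auto simp: cs dlt)
    next
      case False
      with q t show ?thesis by (auto simp: dlt_def idle_def)
    qed
    with assms(2,3) g(4) show ?thesis
      by (simp add: wf_tm_def M_def)
  qed
  have sim_step: "\<exists>ts'. step M (g cs, ts) = (g (fst (cstep (cs, s))), ts') \<and>
      tapes_rep (snd (cstep (cs, s))) ts'"
    if "cs \<in> A" "cs \<noteq> []" "tapes_rep s ts" "length s = K" for cs s ts
  proof -
    have "list_all (wf_com (length s) S) cs"
      using wfA that by simp
    from tapes_rep_cstep[OF that(3) this] g_less[OF that(1)] that show ?thesis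
      by (auto simp: M_def dlt map_read_tapes fst_cstep)
  qed
  \<comment> \<open>Fewer machine steps may be taken because \<open>cstep\<close> idles once the
    continuation is empty, whereas the machine would then move on to a halting state.\<close>
  have sim: "\<exists>ts' t'. t' \<le> t \<and> (step M ^^ t') (g cs, ts) = (g (fst ((cstep ^^ t) (cs, s))), ts') \<and>
      tapes_rep (snd ((cstep ^^ t) (cs, s))) ts' \<and> length (snd ((cstep ^^ t) (cs, s))) = K"
    if "cs \<in> A" "tapes_rep s ts" "length s = K" for cs s ts t
    using that
  proof (induction t arbitrary: cs s ts)
    case (Suc t)
    show ?case
    proof (cases "cs = []")
      case True
      have "(cstep ^^ k) ([], s) = ([], s)" for k
        by (induction k) auto
      from this[of "Suc t"] True Suc.prems show ?thesis
        by (auto intro!: exI[of _ 0])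
    next
      case False
      from sim_step[OF Suc.prems(1) False Suc.prems(2,3)] obtain ts1 where
        1: "step M (g cs, ts) = (g (fst (cstep (cs, s))), ts1)" "tapes_rep (snd (cstep (cs, s))) ts1"
        by blast
      obtain cs' s' where cs': "cstep (cs, s) = (cs', s')" by fastforce
      have "cs' \<in> A" "length s' = K"
        using next_A[OF Suc.prems(1)] fst_cstep[of cs s] length_cstep[of "(cs, s)"] Suc.prems(3) cs'
        by auto
      from Suc.IH[OF this(1) _ this(2), of ts1] 1 cs' obtain ts' t' where
        "t' \<le> t" "(step M ^^ t') (g cs', ts1) = (g (fst ((cstep ^^ t) (cs', s'))), ts')"
        "tapes_rep (snd ((cstep ^^ t) (cs', s'))) ts'" "length (snd ((cstep ^^ t) (cs', s'))) = K"
        by auto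
      with 1 cs' show ?thesis
        by (intro exI[of _ ts'] exI[of _ "Suc t'"]) (simp add: funpow_swap1 del: step.simps)
    qed
  qed (auto intro!: exI[of _ 0])
  have "\<exists>t \<le> Suc (poly (time_poly c) N). state_after M ws t = (if B then 1 else 2)"
    if ws: "length ws \<le> K" and r: "r < K"
      and w: "wp N c (\<lambda>s. peek (s ! r) = 1 \<longleftrightarrow> B) (ws @ replicate (K - length ws) [])" for ws N B
  proof -
    let ?s = "ws @ replicate (K - length ws) []"
    define ts where "ts = map (\<lambda>i. word_tape (if i < length ws then ws ! i else [])) [0..<K]"
    have "stack_tape (?s ! i) (ts ! i)" if "i < K" for i
      using that ws stack_tape_word by (auto simp: ts_def nth_append)
    with ws have init: "init_config M ws = (0, ts)" "tapes_rep ?s ts"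
      by (auto simp: init_config_def M_def tapes_rep_def list_all2_conv_all_nth ts_def)
    from wp_cstep[OF w, of "[]"] obtain t s' where
      t: "t \<le> poly (time_poly c) N" "(cstep ^^ t) ([c], ?s) = ([], s')" "peek (s' ! r) = 1 \<longleftrightarrow> B"
      by blast
    from sim[OF cA init(2), of t] t(2) ws g(2) obtain ts' t' where
      t': "t' \<le> t" "(step M ^^ t') (0, ts) = (g [], ts')" "tapes_rep s' ts'" "length s' = K"
      by auto
    have "[] \<in> A" by (simp add: A_def)
    from dlt[OF this] g_less[OF this] t(3) t' r
    have "fst (step M (g [], ts')) = (if B then 1 else 2)"
      by (simp add: M_def map_read_tapes)
    with t' init have "state_after M ws (Suc t') = (if B then 1 else 2)"
      by (simp add: state_after_def del: step.simps)
    with t t' show ?thesis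
      by (intro exI[of _ "Suc t'"]) auto
  qed
  with wfM show ?thesis
    by (intro exI[of _ M]) (simp add: M_def)
qed

section \<open>Halting runs and their answers\<close>

lemma step_halted: "fst x \<in> {1, 2} \<Longrightarrow> (step M ^^ t) x = x"
proof (induction t)
  case (Suc t)
  then show ?case by (cases x) auto
qed simp

lemma state_after_stable:
  assumes "state_after M ws t \<in> {1, 2}" "t \<le> t'"
  shows "state_after M ws t' = state_after M ws t"
proof -
  have "(step M ^^ t') x = (step M ^^ (t' - t)) ((step M ^^ t) x)" for x
    using assms(2) by (metis add.commute comp_apply funpow_add le_add_diff_inverse)
  with assms(1) show ?thesis
    by (simp add: state_after_def step_halted del: step.simps)
qed

text \<open>Halting configurations are fixed points of \<open>step\<close>, so no run shows both
  halting states.\<close>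

lemma accepts_iff:
  assumes "state_after M ws t = (if B then 1 else 2)"
  shows "accepts M ws \<longleftrightarrow> B"
proof
  assume "accepts M ws"
  then obtain t' where t': "state_after M ws t' = 1"
    by (auto simp: accepts_def)
  show B
  proof (rule ccontr)
    assume "\<not> B"
    with assms have t: "state_after M ws t = 2" by simp
    from state_after_stable[of M ws t "max t t'"] state_after_stable[of M ws t' "max t t'"] t t'
    show False by simp
  qed
qed (use assms in \<open>auto simp: accepts_def\<close>)

section \<open>Operations on whole stacks\<close>

lemma wp_conj: "wp N c Q s \<Longrightarrow> wp N c Q' s \<Longrightarrow> wp N c (\<lambda>s. Q s \<and> Q' s) s"
proof (induction c arbitrary: Q Q' s)
  case (While b c)
  have "loop N n b c Q s \<Longrightarrow> loop N n b c Q' s \<Longrightarrow> loop N n b c (\<lambda>s. Q s \<and> Q' s) s" for n s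
  proof (induction n arbitrary: s)
    case (Suc n)
    show ?case
    proof (cases "b (map peek s)")
      case True
      with Suc.prems have "wp N c (\<lambda>s. loop N n b c Q s \<and> loop N n b c Q' s) s"
        by (auto simp: loop_Suc intro: While.IH)
      with True show ?thesis
        by (auto simp: loop_Suc intro: wp_mono Suc.IH)
    qed (use Suc.prems in \<open>simp add: loop_Suc\<close>)
  qed simp
  with While.prems show ?case
    by (simp add: wp_While)
next
  case (Then c d)
  show ?case
    using Then.IH(1)[OF Then.prems[simplified]] Then.IH(2) by (auto intro: wp_mono)
qed (auto split: if_splits)

lemma wp_const: "wp N c (\<lambda>_. P) s \<Longrightarrow> P"
proof (induction c arbitrary: s)
  case (While b c)
  have "loop N n b c (\<lambda>_. P) s \<Longrightarrow> P" for n s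
  proof (induction n arbitrary: s)
    case (Suc n)
    from Suc.prems have "wp N c (loop N n b c (\<lambda>_. P)) s \<or> P"
      by (auto simp: loop_Suc split: if_splits)
    with wp_mono[of N c _ s "\<lambda>_. P"] Suc.IH While.IH show ?case
      by blast
  qed simp
  with While.prems show ?case
    by (auto simp: wp_While)
next
  case (Then c d)
  from wp_mono[OF Then.prems[simplified], of "\<lambda>_. P"] Then.IH show ?case by blast
qed (auto split: if_splits)

text \<open>Programs are deterministic: \<open>wp_conj\<close> brings both postconditions to the
  single final state, and \<open>wp_const\<close> extracts the resulting fact, since an exhausted
  loop never satisfies \<open>wp\<close>. The equivalences obtained in this way let the simplifier
  execute programs symbolically.\<close>

lemma wp_eqI:
  assumes "wp N c (\<lambda>x. x = s') s"
  shows "wp N c Q s \<longleftrightarrow> Q s'"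
proof
  assume "wp N c Q s"
  from wp_mono[OF wp_conj[OF assms this], of "\<lambda>_. Q s'"] show "Q s'"
    by (auto intro: wp_const)
qed (auto intro: wp_mono[OF assms])

text \<open>Serves symbolic execution on states written out as explicit lists.\<close>

lemma list_update_Cons_numeral [simp]:
  "(x # xs)[numeral v := y] = x # xs[pred_numeral v := y]"
  by (simp add: numeral_eq_Suc)

text \<open>Because \<open>Push\<close> comes first, \<open>f\<close> sees a blank on top of stack
  \<open>k\<close>; the symbol to be written has to come from another stack.\<close>

definition put_sym :: "nat \<Rightarrow> (nat list \<Rightarrow> nat) \<Rightarrow> com" where
  "put_sym k f = (Push k ;; Put k f)"

definition shift :: "nat \<Rightarrow> nat \<Rightarrow> com" where
  "shift i j = (Push j ;; Put j (\<lambda>t. t ! i) ;; Pop i)"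

definition move_stack :: "nat \<Rightarrow> nat \<Rightarrow> com" where
  "move_stack i j = While (\<lambda>t. t ! i \<noteq> 0) (shift i j)"

definition clear_stack :: "nat \<Rightarrow> com" where
  "clear_stack i = While (\<lambda>t. t ! i \<noteq> 0) (Pop i)"

text \<open>Used when stack \<open>k\<close> holds a word in reverse: transferring it restores the
  order and lays down a second copy at the same time.\<close>

definition copy_back :: "nat \<Rightarrow> nat \<Rightarrow> nat \<Rightarrow> com" where
  "copy_back k i j = While (\<lambda>t. t ! k \<noteq> 0)
     (put_sym i (\<lambda>t. t ! k) ;; put_sym j (\<lambda>t. t ! k) ;; Pop k)"

lemma wp_put_sym:
  "k < length s \<Longrightarrow> wp N (put_sym k f) Q s \<longleftrightarrow> Q (s[k := f ((map peek s)[k := 0]) # s ! k])"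
  by (simp add: put_sym_def map_update)

lemma wp_shift:
  "i \<noteq> j \<Longrightarrow> i < length s \<Longrightarrow> j < length s \<Longrightarrow>
    wp N (shift i j) Q s \<longleftrightarrow> Q (s[j := peek (s ! i) # s ! j, i := tl (s ! i)])"
  by (simp add: shift_def)

lemma wp_move_stack:
  assumes "i \<noteq> j" "i < length s" "j < length s" "0 \<notin> set (s ! i)" "length (s ! i) \<le> N"
  shows "wp N (move_stack i j) Q s \<longleftrightarrow> Q (s[i := [], j := rev (s ! i) @ s ! j])"
proof -
  have "loop N (Suc n) (\<lambda>t. t ! i \<noteq> 0) (shift i j) Q s"
    if "Q (s[i := [], j := rev xs @ s ! j])" "s ! i = xs" "0 \<notin> set xs" "length xs \<le> n"
      "i < length s" "j < length s"
    for xs s n Q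
    using that
  proof (induction xs arbitrary: s n)
    case Nil
    then show ?case
      by (simp add: loop_Suc) (metis list_update_id)
  next
    case (Cons x xs)
    then obtain m where n: "n = Suc m" by (cases n) auto
    let ?s = "s[j := x # s ! j, i := xs]"
    have "?s[i := [], j := rev xs @ ?s ! j] = s[i := [], j := rev (x # xs) @ s ! j]"
      using assms(1) Cons.prems by (intro nth_equalityI) (auto simp: nth_list_update)
    with Cons.prems n assms(1) have "loop N (Suc m) (\<lambda>t. t ! i \<noteq> 0) (shift i j) Q ?s"
      by (intro Cons.IH) auto
    with Cons.prems n \<open>i \<noteq> j\<close> show ?case
      by (simp add: loop_Suc[of _ "Suc m"] wp_shift)
  qed
  note * = this
  show ?thesis
    unfolding move_stack_def by (intro wp_eqI, unfold wp_While, rule *) (use assms in auto)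
qed

lemma wp_clear_stack:
  assumes "i < length s" "0 \<notin> set (s ! i)" "length (s ! i) \<le> N"
  shows "wp N (clear_stack i) Q s \<longleftrightarrow> Q (s[i := []])"
proof -
  have "loop N (Suc n) (\<lambda>t. t ! i \<noteq> 0) (Pop i) Q s"
    if "Q (s[i := []])" "s ! i = xs" "0 \<notin> set xs" "length xs \<le> n" "i < length s" for xs s n Q
    using that
  proof (induction xs arbitrary: s n)
    case Nil
    then show ?case
      by (simp add: loop_Suc) (metis list_update_id)
  next
    case (Cons x xs)
    then obtain m where n: "n = Suc m" by (cases n) auto
    have "loop N (Suc m) (\<lambda>t. t ! i \<noteq> 0) (Pop i) Q (s[i := xs])"
      by (rule Cons.IH) (use Cons.prems n in simp_all)
    with Cons.prems n show ?case
      by (simp add: loop_Suc[of _ "Suc m"])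
  qed
  note * = this
  show ?thesis
    unfolding clear_stack_def by (intro wp_eqI, unfold wp_While, rule *) (use assms in auto)
qed

lemma wp_copy_back:
  assumes "distinct [i, j, k]" "i < length s" "j < length s" "k < length s"
    "0 \<notin> set (s ! k)" "length (s ! k) \<le> N"
  shows "wp N (copy_back k i j) Q s \<longleftrightarrow>
    Q (s[k := [], i := rev (s ! k) @ s ! i, j := rev (s ! k) @ s ! j])"
proof -
  let ?c = "put_sym i (\<lambda>t. t ! k) ;; put_sym j (\<lambda>t. t ! k) ;; Pop k"
  have "loop N (Suc n) (\<lambda>t. t ! k \<noteq> 0) ?c Q s"
    if "Q (s[k := [], i := rev xs @ s ! i, j := rev xs @ s ! j])" "s ! k = xs" "0 \<notin> set xs"
      "length xs \<le> n" "i < length s" "j < length s" "k < length s" for xs s n Q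
    using that
  proof (induction xs arbitrary: s n)
    case Nil
    then show ?case
      by (simp add: loop_Suc) (metis list_update_id)
  next
    case (Cons x xs)
    then obtain m where n: "n = Suc m" by (cases n) auto
    let ?s = "s[i := x # s ! i, j := x # s ! j, k := xs]"
    have "?s[k := [], i := rev xs @ ?s ! i, j := rev xs @ ?s ! j] =
        s[k := [], i := rev (x # xs) @ s ! i, j := rev (x # xs) @ s ! j]"
      using assms(1) Cons.prems by (intro nth_equalityI) (auto simp: nth_list_update)
    with Cons.prems n assms(1) have "loop N (Suc m) (\<lambda>t. t ! k \<noteq> 0) ?c Q ?s"
      by (intro Cons.IH) auto
    with Cons.prems n assms(1) show ?case
      by (simp add: loop_Suc[of _ "Suc m"] wp_put_sym)
  qed
  note * = this
  show ?thesis
    unfolding copy_back_def by (intro wp_eqI, unfold wp_While, rule *) (use assms in auto)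
qed

lemmas wp_macros = wp_put_sym wp_shift wp_move_stack wp_clear_stack wp_copy_back

lemma nth_less_symbols [simp]: "t \<in> lists {..<S} \<Longrightarrow> i < length t \<Longrightarrow> t ! i < S"
  by (auto simp: in_lists_conv_set)

lemma wf_macros [simp]:
  "wf_com K S (put_sym k f) \<longleftrightarrow> wf_com K S (Put k f)"
  "wf_com K S (shift i j) \<longleftrightarrow> i < K \<and> j < K"
  "wf_com K S (move_stack i j) \<longleftrightarrow> i < K \<and> j < K"
  "wf_com K S (clear_stack i) \<longleftrightarrow> i < K"
  "wf_com K S (copy_back k i j) \<longleftrightarrow> k < K \<and> i < K \<and> j < K"
  by (auto simp: put_sym_def shift_def move_stack_def clear_stack_def copy_back_def)

section \<open>Literals forced by a formula\<close>

text \<open>A literal \<open>(b, s, k, n)\<close> gives the truth value \<open>b\<close> at position \<open>s\<close> of atom number \<open>n\<close> (tag \<open>k = 3\<close>)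
  or of the presence of agent number \<open>n\<close> (tag \<open>k = 4\<close>).\<close>

type_synonym literal = "bool \<times> pos \<times> nat \<times> nat"

text \<open>Besides complementary literals, an agent required at two positions is contradictory,
  whereas its absence from several positions is not.\<close>

fun conflict :: "literal \<Rightarrow> literal \<Rightarrow> bool" where
  "conflict (b, s, k) (b', s', k') \<longleftrightarrow>
     k = k' \<and> (s = s' \<and> b \<noteq> b' \<or> s \<noteq> s' \<and> fst k = 4 \<and> b \<and> b')"

fun consistent :: "literal list \<Rightarrow> bool" where
  "consistent [] \<longleftrightarrow> True"
| "consistent (l # ls) \<longleftrightarrow> (\<forall>l' \<in> set ls. \<not> conflict l l') \<and> consistent ls"

text \<open>The recursive definition follows the program, which compares each new literal with those
  already stored. Since \<open>conflict\<close> is symmetric and irreflexive, order and repetition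
  do not matter.\<close>

lemma consistent_iff: "consistent ls \<longleftrightarrow> (\<forall>l \<in> set ls. \<forall>l' \<in> set ls. \<not> conflict l l')"
proof -
  have "conflict l l' \<longleftrightarrow> conflict l' l" "\<not> conflict l l" for l l'
    by (cases l; cases l'; auto)+
  then show ?thesis
    by (induction ls) auto
qed

fun dir :: "('p, 'i) prog \<Rightarrow> pos \<Rightarrow> pos" where
  "dir GoUp (x, y) = (x, y + 1)"
| "dir GoDown (x, y) = (x, y - 1)"
| "dir GoRight (x, y) = (x + 1, y)"
| "dir GoLeft (x, y) = (x - 1, y)"
| "dir _ s = s"

text \<open>A sign is a required truth value, or \<^const>\<open>None\<close> if nothing is required. A conjunction that
  has to be false is resolved by the next letter of the certificate, which names a false conjunct.\<close>

fun conj_signs :: "bool option \<Rightarrow> word \<Rightarrow> bool option \<times> bool option \<times> word" where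
  "conj_signs (Some False) u =
     (if peek u = 1 then (Some False, None, tl u) else (None, Some False, tl u))"
| "conj_signs \<sigma> u = (\<sigma>, \<sigma>, u)"

text \<open>The conjunct that is not named for a false conjunction is still traversed, with sign
  \<open>None\<close>, so that the word can be processed from left to right without skipping. It
  contributes no literal and uses up no certificate.\<close>

primrec literals :: "('p \<Rightarrow> nat) \<Rightarrow> ('i \<Rightarrow> nat) \<Rightarrow> ('p, 'i) form \<Rightarrow> bool option \<Rightarrow> pos \<Rightarrow> word \<Rightarrow>
    literal list \<times> word" where
  "literals a g (Atom p) \<sigma> s u = ((case \<sigma> of None \<Rightarrow> [] | Some b \<Rightarrow> [(b, s, 3, a p)]), u)"
| "literals a g (Here i) \<sigma> s u = ((case \<sigma> of None \<Rightarrow> [] | Some b \<Rightarrow> [(b, s, 4, g i)]), u)"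
| "literals a g (Neg \<phi>) \<sigma> s u = literals a g \<phi> (map_option Not \<sigma>) s u"
| "literals a g (Conj \<phi> \<psi>) \<sigma> s u =
     (let (\<sigma>1, \<sigma>2, u0) = conj_signs \<sigma> u; (l1, u1) = literals a g \<phi> \<sigma>1 s u0;
          (l2, u2) = literals a g \<psi> \<sigma>2 s u1
      in (l1 @ l2, u2))"
| "literals a g (Box \<alpha> \<phi>) \<sigma> s u = literals a g \<phi> \<sigma> (dir \<alpha> s) u"

section \<open>Truth of the literals in a model\<close>

fun literal_true :: "'p set \<Rightarrow> 'i set \<Rightarrow> ('p \<Rightarrow> nat) \<Rightarrow> ('i \<Rightarrow> nat) \<Rightarrow> ('p, 'i) model \<Rightarrow> literal \<Rightarrow> bool" where
  "literal_true Atm Agt a g M (b, s, k, n) \<longleftrightarrow>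
     k = 3 \<and> (\<exists>p \<in> Atm. a p = n \<and> (p \<in> snd M s) = b) \<or>
     k = 4 \<and> (\<exists>i \<in> Agt. g i = n \<and> (fst M i = s) = b)"

text \<open>A trivial predicate for programs suffices because the recursion of
  \<open>literals\<close> never enters a program.\<close>

lemma form_induct [case_names Atom Here Neg Conj Box]:
  assumes "\<And>p. P (Atom p)" "\<And>i. P (Here i)" "\<And>\<phi>. P \<phi> \<Longrightarrow> P (Neg \<phi>)"
    "\<And>\<phi> \<psi>. P \<phi> \<Longrightarrow> P \<psi> \<Longrightarrow> P (Conj \<phi> \<psi>)" "\<And>\<alpha> \<phi>. P \<phi> \<Longrightarrow> P (Box \<alpha> \<phi>)"
  shows "P \<phi>"
  by (rule form.induct[where ?P2.0 = "\<lambda>_. True"]) (use assms in auto)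

lemma sat_Box_move:
  "\<alpha> \<in> {GoUp, GoDown, GoRight, GoLeft} \<Longrightarrow> sat M (Box \<alpha> \<phi>) s \<longleftrightarrow> sat M \<phi> (dir \<alpha> s)"
  by (cases s) auto

lemma literals_None: "literals a g \<phi> None s u = ([], u)"
  by (induction \<phi> arbitrary: s u rule: form_induct) simp_all

context
  fixes Atm :: "'p set" and Agt :: "'i set" and a :: "'p \<Rightarrow> nat" and g :: "'i \<Rightarrow> nat"
  assumes inj: "inj_on a Atm" "inj_on g Agt"
begin

text \<open>Every certificate is sound: whichever conjunct it names, the literals of that conjunct
  already make the conjunction false.\<close>

lemma literals_sound:
  "form_over Atm Agt \<phi> \<Longrightarrow> only_moves \<phi> \<Longrightarrow>
    (\<forall>l \<in> set (fst (literals a g \<phi> (Some b) s u)). literal_true Atm Agt a g M l) \<Longrightarrow>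
    sat M \<phi> s = b"
proof (induction \<phi> arbitrary: b s u rule: form_induct)
  case (Conj \<phi> \<psi>)
  have cc: "\<forall>l \<in> set (fst (literals a g \<phi> \<sigma>1 s u0)) \<union>
      set (fst (literals a g \<psi> \<sigma>2 s (snd (literals a g \<phi> \<sigma>1 s u0)))). literal_true Atm Agt a g M l"
    if "conj_signs (Some b) u = (\<sigma>1, \<sigma>2, u0)" for \<sigma>1 \<sigma>2 u0
    using Conj.prems(3) that by (auto simp: split_beta)
  show ?case
  proof (cases b)
    case True
    with cc[of "Some True" "Some True" u] Conj.prems(1,2) Conj.IH(1)[of True s u]
      Conj.IH(2)[of True s "snd (literals a g \<phi> (Some True) s u)"]
    show ?thesis by auto
  next
    case False
    then show ?thesis
      using cc[of "Some False" None "tl u"] cc[of None "Some False" "tl u"] Conj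
        Conj.IH(1)[of False] Conj.IH(2)[of False]
      by (cases "peek u = 1") (auto simp: literals_None)
  qed
next
  case (Box \<alpha> \<phi>)
  then show ?case
    using sat_Box_move[of \<alpha> M \<phi> s] by (auto simp del: sat.simps)
qed (use inj in \<open>auto simp: inj_on_eq_iff\<close>)

text \<open>One letter per conjunction that has to be false is enough. The arbitrary rest
  \<open>r\<close> allows the certificates of two conjuncts to be concatenated, and later a short
  certificate to be padded.\<close>

lemma literals_complete:
  "form_over Atm Agt \<phi> \<Longrightarrow> only_moves \<phi> \<Longrightarrow> sat M \<phi> s = b \<Longrightarrow>
    \<exists>u \<in> lists {1, 2}. length u \<le> length (form_word a g \<phi>) \<and>
      (\<forall>r. snd (literals a g \<phi> (Some b) s (u @ r)) = r \<and>
        (\<forall>l \<in> set (fst (literals a g \<phi> (Some b) s (u @ r))). literal_true Atm Agt a g M l))"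
proof (induction \<phi> arbitrary: b s rule: form_induct)
  case (Atom p)
  then show ?case by (intro bexI[of _ "[]"]) auto
next
  case (Here i)
  then show ?case by (intro bexI[of _ "[]"]) auto
next
  case (Neg \<phi>)
  from Neg.IH[of s "\<not> b"] Neg.prems obtain u where
    "u \<in> lists {1, 2}" "length u \<le> length (form_word a g \<phi>)"
    "\<forall>r. snd (literals a g \<phi> (Some (\<not> b)) s (u @ r)) = r \<and>
        (\<forall>l \<in> set (fst (literals a g \<phi> (Some (\<not> b)) s (u @ r))). literal_true Atm Agt a g M l)"
    by auto
  then show ?case by (intro bexI[of _ u]) auto
next
  case (Box \<alpha> \<phi>)
  from Box.prems have "sat M \<phi> (dir \<alpha> s) = b"
    using sat_Box_move[of \<alpha> M \<phi> s] by (auto simp del: sat.simps)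
  with Box.IH[of "dir \<alpha> s" b] Box.prems obtain u where
    "u \<in> lists {1, 2}" "length u \<le> length (form_word a g \<phi>)"
    "\<forall>r. snd (literals a g \<phi> (Some b) (dir \<alpha> s) (u @ r)) = r \<and>
        (\<forall>l \<in> set (fst (literals a g \<phi> (Some b) (dir \<alpha> s) (u @ r))). literal_true Atm Agt a g M l)"
    by auto
  then show ?case by (intro bexI[of _ u]) auto
next
  case (Conj \<phi> \<psi>)
  have over: "form_over Atm Agt \<phi>" "form_over Atm Agt \<psi>" "only_moves \<phi>" "only_moves \<psi>"
    using Conj.prems by auto
  consider "b" "sat M \<phi> s = True" "sat M \<psi> s = True" | "\<not> b" "sat M \<phi> s = False"
    | "\<not> b" "sat M \<psi> s = False"
    using Conj.prems by auto
  then show ?case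
  proof cases
    case 1
    from Conj.IH(1)[OF over(1,3) 1(2)] obtain u where u: "u \<in> lists {1, 2}"
      "length u \<le> length (form_word a g \<phi>)"
      "\<And>r. snd (literals a g \<phi> (Some True) s (u @ r)) = r"
      "\<And>l r. l \<in> set (fst (literals a g \<phi> (Some True) s (u @ r))) \<Longrightarrow> literal_true Atm Agt a g M l"
      by blast
    from Conj.IH(2)[OF over(2,4) 1(3)] obtain v where v: "v \<in> lists {1, 2}"
      "length v \<le> length (form_word a g \<psi>)"
      "\<And>r. snd (literals a g \<psi> (Some True) s (v @ r)) = r"
      "\<And>l r. l \<in> set (fst (literals a g \<psi> (Some True) s (v @ r))) \<Longrightarrow> literal_true Atm Agt a g M l"
      by blast
    have "u @ v \<in> lists {1, 2}" using u(1) v(1) by auto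
    then show ?thesis
      by (rule bexI[rotated]) (use 1 u v in \<open>auto simp: split_beta\<close>)
  next
    case 2
    from Conj.IH(1)[OF over(1,3) 2(2)] obtain u where u: "u \<in> lists {1, 2}"
      "length u \<le> length (form_word a g \<phi>)"
      "\<And>r. snd (literals a g \<phi> (Some False) s (u @ r)) = r"
      "\<And>l r. l \<in> set (fst (literals a g \<phi> (Some False) s (u @ r))) \<Longrightarrow> literal_true Atm Agt a g M l"
      by blast
    have "1 # u \<in> lists {1, 2}" using u(1) by auto
    then show ?thesis
      by (rule bexI[rotated]) (use 2 u in \<open>auto simp: split_beta literals_None\<close>)
  next
    case 3
    from Conj.IH(2)[OF over(2,4) 3(2)] obtain u where u: "u \<in> lists {1, 2}"
      "length u \<le> length (form_word a g \<psi>)"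
      "\<And>r. snd (literals a g \<psi> (Some False) s (u @ r)) = r"
      "\<And>l r. l \<in> set (fst (literals a g \<psi> (Some False) s (u @ r))) \<Longrightarrow> literal_true Atm Agt a g M l"
      by blast
    have "2 # u \<in> lists {1, 2}" using u(1) by auto
    then show ?thesis
      by (rule bexI[rotated]) (use 3 u in \<open>auto simp: split_beta literals_None\<close>)
  qed
qed

lemma consistent_if_true:
  "(\<forall>l \<in> set ls. literal_true Atm Agt a g M l) \<Longrightarrow> consistent ls"
  unfolding consistent_iff
proof (intro ballI notI)
  fix l l'
  assume ls: "\<forall>l \<in> set ls. literal_true Atm Agt a g M l" "l \<in> set ls" "l' \<in> set ls" "conflict l l'"
  obtain b s k n b' s' k' n' where l: "l = (b, s, k, n)" "l' = (b', s', k', n')"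
    by (cases l; cases l') auto
  from ls have "literal_true Atm Agt a g M l" "literal_true Atm Agt a g M l'" by auto
  with ls(4) inj show False
    unfolding l by (auto simp: inj_on_eq_iff)
qed

lemma literals_keys:
  "form_over Atm Agt \<phi> \<Longrightarrow>
    snd ` snd ` set (fst (literals a g \<phi> \<sigma> s u)) \<subseteq> Pair 3 ` a ` Atm \<union> Pair 4 ` g ` Agt"
proof (induction \<phi> arbitrary: \<sigma> s u rule: form_induct)
  case (Conj \<phi> \<psi>)
  obtain \<sigma>1 \<sigma>2 u0 where 0: "conj_signs \<sigma> u = (\<sigma>1, \<sigma>2, u0)"
    by (cases "conj_signs \<sigma> u") auto
  show ?case
    using Conj.IH(1)[of \<sigma>1 s u0] Conj.IH(2)[of \<sigma>2 s "snd (literals a g \<phi> \<sigma>1 s u0)"] Conj.prems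
    by (simp add: 0 split_beta image_Un)
qed (auto split: option.splits)

lemma true_if_consistent:
  assumes cons: "consistent ls" and keys: "snd ` snd ` set ls \<subseteq> Pair 3 ` a ` Atm \<union> Pair 4 ` g ` Agt"
  shows "\<exists>M \<in> spatial_models Atm Agt. \<forall>l \<in> set ls. literal_true Atm Agt a g M l"
proof -
  have "finite ((fst \<circ> snd) ` set ls)" by simp
  then obtain z :: pos where z: "z \<notin> (fst \<circ> snd) ` set ls"
    using ex_new_if_finite[of "(fst \<circ> snd) ` set ls"] by (auto simp: finite_prod infinite_UNIV_int)
  define P where "P = restrict (\<lambda>i. if \<exists>s. (True, s, 4, g i) \<in> set ls
    then SOME s. (True, s, 4, g i) \<in> set ls else z) Agt"
  define V where "V s = {p \<in> Atm. (True, s, 3, a p) \<in> set ls}" for s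
  have noc: "\<not> conflict l l'" if "l \<in> set ls" "l' \<in> set ls" for l l'
    using cons that by (auto simp: consistent_iff)
  have P_eq: "P i = s" if "(True, s, 4, g i) \<in> set ls" "i \<in> Agt" for s i
  proof -
    have "(True, SOME s. (True, s, 4, g i) \<in> set ls, 4, g i) \<in> set ls"
      using that(1) by (rule someI)
    with noc[OF that(1) this] have "(SOME s. (True, s, 4, g i) \<in> set ls) = s"
      by auto
    moreover have "\<exists>s. (True, s, 4, g i) \<in> set ls"
      using that by blast
    ultimately show ?thesis
      using that by (simp add: P_def del: split_paired_Ex)
  qed
  have "literal_true Atm Agt a g (P, V) l" if "l \<in> set ls" for l
  proof -
    obtain b s k n where l: "l = (b, s, k, n)" by (cases l) auto
    have "(k, n) \<in> snd ` snd ` set ls" using that l by force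
    with keys have "(k, n) \<in> Pair 3 ` a ` Atm \<union> Pair 4 ` g ` Agt" by blast
    then consider p where "k = 3" "p \<in> Atm" "n = a p" | i where "k = 4" "i \<in> Agt" "n = g i"
      by auto
    then show ?thesis
    proof cases
      case 1
      have "(True, s, 3, a p) \<in> set ls \<longleftrightarrow> b"
        using noc[OF that, of "(True, s, 3, a p)"] that l 1 by (cases b) auto
      with 1 l show ?thesis by (auto simp: V_def)
    next
      case 2
      have "P i = s \<longleftrightarrow> b"
      proof (cases "\<exists>s'. (True, s', 4, g i) \<in> set ls")
        case True
        then obtain s' where s': "(True, s', 4, g i) \<in> set ls" by blast
        from noc[OF that s'] P_eq[OF s' 2(2)] l 2 show ?thesis by (cases b) auto
      next
        case False
        with 2 have "P i = z" by (simp add: P_def)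
        moreover have "z \<noteq> s" using z that l by force
        moreover have "\<not> b" using False that l 2 by (cases b; cases s) auto
        ultimately show ?thesis by simp
      qed
      with 2 l show ?thesis by auto
    qed
  qed
  moreover have "(P, V) \<in> spatial_models Atm Agt"
    by (auto simp: spatial_models_def P_def V_def)
  ultimately show ?thesis by blast
qed

end

section \<open>Independence of the starting position\<close>

definition translate :: "pos \<Rightarrow> literal \<Rightarrow> literal" where
  "translate d = (\<lambda>(b, s, k). (b, (fst s + fst d, snd s + snd d), k))"

text \<open>A model may satisfy the formula anywhere, while the machine starts at the origin.
  Changing the start translates all literals, and \<open>conflict\<close> only tests positions for
  equality.\<close>

lemma literals_translate:
  fixes s :: pos
  shows "only_moves \<phi> \<Longrightarrow>
    literals a g \<phi> \<sigma> (fst s + fst d, snd s + snd d) u =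
      apfst (map (translate d)) (literals a g \<phi> \<sigma> s u)"
proof (induction \<phi> arbitrary: \<sigma> s u rule: form_induct)
  case (Box \<alpha> \<phi>)
  have "dir \<alpha> (fst s + fst d, snd s + snd d) = (fst (dir \<alpha> s) + fst d, snd (dir \<alpha> s) + snd d)"
    using Box.prems by (cases s) auto
  with Box.IH[of \<sigma> "dir \<alpha> s" u] Box.prems show ?case by simp
next
  case (Conj \<phi> \<psi>)
  obtain \<sigma>1 \<sigma>2 u0 where 0: "conj_signs \<sigma> u = (\<sigma>1, \<sigma>2, u0)"
    by (cases "conj_signs \<sigma> u") auto
  obtain l1 u1 where 1: "literals a g \<phi> \<sigma>1 s u0 = (l1, u1)" by fastforce
  obtain l2 u2 where 2: "literals a g \<psi> \<sigma>2 s u1 = (l2, u2)" by fastforce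
  show ?case
    using Conj.IH(1)[of \<sigma>1 s u0] Conj.IH(2)[of \<sigma>2 s u1] Conj.prems 0 1 2 by simp
next
  case (Neg \<phi>)
  from Neg.IH[of "map_option Not \<sigma>" s u] Neg.prems show ?case by simp
next
  case (Atom p)
  show ?case by (cases \<sigma>) (simp_all add: translate_def)
next
  case (Here i)
  show ?case by (cases \<sigma>) (simp_all add: translate_def)
qed

lemma consistent_translate: "consistent (map (translate d) ls) \<longleftrightarrow> consistent ls"
proof -
  have "conflict (translate d l) (translate d l') \<longleftrightarrow> conflict l l'" for l l'
    by (cases l; cases l'; cases "fst (snd l)"; cases "fst (snd l')") (auto simp: translate_def)
  then show ?thesis by (simp add: consistent_iff)
qed

theorem satisfiable_iff_literals:
  assumes inj: "inj_on a Atm" "inj_on g Agt" and "form_over Atm Agt \<phi>" "only_moves \<phi>"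
  shows "(\<exists>u \<in> lists {1, 2}. consistent (fst (literals a g \<phi> (Some True) (0, 0) u)))
      \<Longrightarrow> satisfiable Atm Agt \<phi>"
    and "satisfiable Atm Agt \<phi> \<Longrightarrow>
      \<exists>u \<in> lists {1, 2}. length u \<le> length (form_word a g \<phi>) \<and>
        (\<forall>r. consistent (fst (literals a g \<phi> (Some True) (0, 0) (u @ r))))"
proof -
  have sat: "satisfiable Atm Agt \<phi> \<longleftrightarrow> (\<exists>M \<in> spatial_models Atm Agt. \<exists>s. sat M \<phi> s)"
    by (auto simp: satisfiable_def valid_def)
  show "satisfiable Atm Agt \<phi>"
    if "\<exists>u \<in> lists {1, 2}. consistent (fst (literals a g \<phi> (Some True) (0, 0) u))"
  proof -
    from that obtain u where u: "consistent (fst (literals a g \<phi> (Some True) (0, 0) u))" by blast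
    from true_if_consistent[OF inj u literals_keys[OF inj assms(3)]] obtain M where
      M: "M \<in> spatial_models Atm Agt"
        "\<forall>l \<in> set (fst (literals a g \<phi> (Some True) (0, 0) u)). literal_true Atm Agt a g M l"
      by blast
    from literals_sound[OF inj assms(3,4) M(2)] M(1) show ?thesis
      unfolding sat by auto
  qed
  show "\<exists>u \<in> lists {1, 2}. length u \<le> length (form_word a g \<phi>) \<and>
        (\<forall>r. consistent (fst (literals a g \<phi> (Some True) (0, 0) (u @ r))))"
    if "satisfiable Atm Agt \<phi>"
  proof -
    from that obtain M s where "sat M \<phi> s = True" unfolding sat by auto
    from literals_complete[OF inj assms(3,4) this] obtain u where
      u: "u \<in> lists {1, 2}" "length u \<le> length (form_word a g \<phi>)"
      "\<And>r. \<forall>l \<in> set (fst (literals a g \<phi> (Some True) s (u @ r))). literal_true Atm Agt a g M l"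
      by blast
    have "consistent (fst (literals a g \<phi> (Some True) (0, 0) (u @ r)))" for r
    proof -
      have "fst (literals a g \<phi> (Some True) s (u @ r)) =
          map (translate s) (fst (literals a g \<phi> (Some True) (0, 0) (u @ r)))"
        using literals_translate[OF assms(4), of a g "Some True" "(0, 0)" s "u @ r"] by simp
      with consistent_if_true[OF inj u(3)[of r]] show ?thesis
        by (simp only: consistent_translate)
    qed
    with u show ?thesis by blast
  qed
qed

section \<open>The tableau program\<close>

text \<open>
  Stack 0 holds the formula, 1 the certificate, 2 the pending signs and moves, 3 and 4 the current
  position in unary, 5 and 6 the key and the sign of the current literal, 7 the literals found so far,
  8 those already compared with the current one, 10 and 11 the results of comparing positions and
  keys, 12 the sign of the other literal, 13 is nonempty after a conflict, 9 and 14 are auxiliary.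
\<close>

definition flag :: "bool \<Rightarrow> nat list" where
  "flag b = (if b then [] else [1])"

lemma flag_simps [simp]: "tl (flag b) = []" "peek (flag b) = 0 \<longleftrightarrow> b" "flag True = []"
  "peek (flag b) = 1 \<longleftrightarrow> \<not> b" "flag b = [] \<longleftrightarrow> b" "[1] = flag b \<longleftrightarrow> \<not> b" "[Suc 0] = flag b \<longleftrightarrow> \<not> b"
  by (auto simp: flag_def)

text \<open>The letter carries the sign and zero is the empty word, so every integer has exactly one
  representation. Positions are then compared as words, and a move pushes or pops a single
  letter.\<close>

definition unary :: "int \<Rightarrow> nat list" where
  "unary x = replicate (nat \<bar>x\<bar>) (if x \<ge> 0 then 1 else 2)"

lemma unary_int: "unary (int n) = replicate n 1" "unary (- int n) = replicate n 2"
  by (auto simp: unary_def)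

lemma unary_succ: "(if peek (unary x) = 2 then tl (unary x) else 1 # unary x) = unary (x + 1)"
proof (cases "x \<ge> 0")
  case True
  then obtain n where x: "x = int n" using nonneg_int_cases by blast
  then have "unary (x + 1) = unary (int (Suc n))" by (simp add: add.commute)
  with x show ?thesis by (cases n) (simp_all only: unary_int, simp_all)
next
  case False
  then obtain n where x: "x = - int (Suc n)" using negD by fastforce
  then have "unary (x + 1) = unary (- int n)" by simp
  with x show ?thesis by (simp_all only: unary_int, simp_all)
qed

lemma unary_pred: "(if peek (unary x) = 1 then tl (unary x) else 2 # unary x) = unary (x - 1)"
proof (cases "x > 0")
  case True
  then have "x = int (Suc (nat x - 1))" by simp
  then obtain n where x: "x = int (Suc n)" by blast
  then have "unary (x - 1) = unary (int n)" by simp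
  with x show ?thesis by (simp_all only: unary_int, simp_all)
next
  case False
  then have "x = - int (nat (- x))" by simp
  then obtain n where x: "x = - int n" by blast
  then have "x - 1 = - int (Suc n)" by simp
  then have "unary (x - 1) = unary (- int (Suc n))" by (rule arg_cong)
  with x show ?thesis by (cases n) (simp_all only: unary_int, simp_all)
qed

lemma set_unary: "set (unary x) \<subseteq> {1, 2}"
  by (auto simp: unary_def)

lemma length_unary: "length (unary x) = nat \<bar>x\<bar>"
  by (simp add: unary_def)

lemma unary_inject [simp]: "unary x = unary y \<longleftrightarrow> x = y"
proof
  assume eq: "unary x = unary y"
  then have "nat \<bar>x\<bar> = nat \<bar>y\<bar>" by (metis length_unary)
  moreover have "x \<ge> 0 \<longleftrightarrow> y \<ge> 0" if "x \<noteq> 0"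
    using arg_cong[OF eq, of set] that by (auto simp: unary_def set_replicate_conv_if split: if_splits)
  ultimately show "x = y" by (cases "x = 0") auto
qed simp

definition bump :: "nat \<Rightarrow> nat \<Rightarrow> nat \<Rightarrow> com" where
  "bump k a b = Cond (\<lambda>t. t ! k = a) (Pop k) (put_sym k (\<lambda>_. b))"

definition steer :: "nat \<Rightarrow> com" where
  "steer k = Cond (\<lambda>t. t ! k = 8) (bump 4 2 1) (Cond (\<lambda>t. t ! k = 9) (bump 4 1 2)
    (Cond (\<lambda>t. t ! k = 10) (bump 3 2 1) (bump 3 1 2)))"

fun steered :: "nat \<Rightarrow> pos \<Rightarrow> pos" where
  "steered c (x, y) = (if c = 8 then (x, y + 1) else if c = 9 then (x, y - 1)
     else if c = 10 then (x + 1, y) else (x - 1, y))"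

definition opposite :: "nat \<Rightarrow> nat" where
  "opposite c = (if c = 8 then 9 else if c = 9 then 8 else if c = 10 then 11 else 10)"

lemma steered_opposite: "c \<in> {8..11} \<Longrightarrow> steered (opposite c) (steered c s) = s"
  by (cases s) (auto simp: opposite_def)

lemma wp_bump:
  "wp N (bump 3 2 1) Q (w # u # p # unary x # zs) \<longleftrightarrow> Q (w # u # p # unary (x + 1) # zs)"
  "wp N (bump 3 1 2) Q (w # u # p # unary x # zs) \<longleftrightarrow> Q (w # u # p # unary (x - 1) # zs)"
  "wp N (bump 4 2 1) Q (w # u # p # y # unary x # zs) \<longleftrightarrow> Q (w # u # p # y # unary (x + 1) # zs)"
  "wp N (bump 4 1 2) Q (w # u # p # y # unary x # zs) \<longleftrightarrow> Q (w # u # p # y # unary (x - 1) # zs)"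
  using unary_succ[of x] unary_pred[of x]
  by (simp_all add: bump_def wp_put_sym split: if_splits)

lemma wp_steer:
  "wp N (steer 0) Q (w # u # p # unary (fst s) # unary (snd s) # zs) \<longleftrightarrow>
    Q (w # u # p # unary (fst (steered (peek w) s)) # unary (snd (steered (peek w) s)) # zs)"
  "wp N (steer 2) Q (w # u # p # unary (fst s) # unary (snd s) # zs) \<longleftrightarrow>
    Q (w # u # p # unary (fst (steered (peek p) s)) # unary (snd (steered (peek p) s)) # zs)"
  by (cases s; simp add: steer_def wp_bump[simplified])+

text \<open>The separator 5 terminates the three parts of a literal on the literal stack.\<close>

definition key :: "nat \<times> nat \<Rightarrow> nat list" where
  "key k = fst k # rev (binary (snd k))"

fun sign :: "bool option \<Rightarrow> nat" where
  "sign (Some True) = 1"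
| "sign (Some False) = 2"
| "sign None = 3"

definition literal_word :: "literal \<Rightarrow> nat list" where
  "literal_word l = (case l of (b, s, k) \<Rightarrow>
     sign (Some b) # unary (fst s) @ 5 # unary (snd s) @ 5 # key k @ [5])"

lemma key_inject: "key k = key k' \<longleftrightarrow> k = k'"
  by (cases k; cases k') (auto simp: key_def dest: binary_eq_imp)

text \<open>Stack \<open>e\<close> is set if stack \<open>i\<close> differs from the part of a literal on top of stack 7, which is
  moved to stack 8.\<close>

definition compare_body :: "nat \<Rightarrow> nat \<Rightarrow> com" where
  "compare_body i e =
     (Cond (\<lambda>t. t ! 7 \<noteq> t ! i) (Put e (\<lambda>_. 1)) Skip ;;
      Cond (\<lambda>t. t ! i \<noteq> 0) (shift i 9) Skip ;; shift 7 8)"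

text \<open>Symbols of stack \<open>i\<close> left over at the separator reveal a difference in
  length; those already used wait on stack 9 and are put back.\<close>

definition compare :: "nat \<Rightarrow> nat \<Rightarrow> com" where
  "compare i e = (While (\<lambda>t. t ! 7 \<noteq> 5) (compare_body i e) ;;
     Cond (\<lambda>t. t ! i \<noteq> 0) (Put e (\<lambda>_. 1)) Skip ;; shift 7 8 ;; move_stack 9 i)"

text \<open>A normal form for the five stacks that \<open>compare\<close> touches: since
  \<open>i\<close> and \<open>e\<close> are variables, nested updates cannot be sorted by evaluating
  their indices.\<close>

definition upd5 :: "state \<Rightarrow> nat \<Rightarrow> nat \<Rightarrow> nat list \<Rightarrow> nat list \<Rightarrow> nat list \<Rightarrow> nat list \<Rightarrow> nat list \<Rightarrow> state" where
  "upd5 s i e A B C D E = s[7 := A, 8 := B, i := C, 9 := D, e := E]"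

lemma upd5_eqI:
  assumes "i < length x" "e < length x" "9 < length x" "distinct [i, e, 7, 8, 9]"
    and "length y = length x" "y ! 7 = A" "y ! 8 = B" "y ! i = C" "y ! 9 = D" "y ! e = E"
      "\<And>k. k \<notin> {i, e, 7, 8, 9} \<Longrightarrow> y ! k = x ! k"
  shows "y = upd5 x i e A B C D E"
proof (rule nth_equalityI)
  fix k
  consider "k = i" | "k = e" | "k = 7" | "k = 8" | "k = 9" | "k \<notin> {i, e, 7, 8, 9}" by blast
  then show "y ! k = upd5 x i e A B C D E ! k"
    by cases (use assms in \<open>auto simp: upd5_def\<close>)
qed (simp add: upd5_def assms)

lemma upd5_simps:
  assumes "i < length s" "e < length s" "9 < length s" "distinct [i, e, 7, 8, 9]"
  shows "length (upd5 s i e A B C D E) = length s"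
    and "upd5 s i e A B C D E ! 7 = A" "upd5 s i e A B C D E ! 8 = B" "upd5 s i e A B C D E ! i = C"
      "upd5 s i e A B C D E ! 9 = D" "upd5 s i e A B C D E ! e = E"
    and "upd5 (upd5 s i e A B C D E) i e A' B' C' D' E' = upd5 s i e A' B' C' D' E'"
    and "upd5 s i e (s ! 7) (s ! 8) (s ! i) (s ! 9) (s ! e) = s"
proof -
  show nth: "length (upd5 s i e A B C D E) = length s" "upd5 s i e A B C D E ! 7 = A"
    "upd5 s i e A B C D E ! 8 = B" "upd5 s i e A B C D E ! i = C" "upd5 s i e A B C D E ! 9 = D"
    "upd5 s i e A B C D E ! e = E" for A B C D E
    using assms by (simp_all add: upd5_def)
  have other: "upd5 s i e A B C D E ! k = s ! k" if "k \<notin> {i, e, 7, 8, 9}" for s k A B C D E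
    using that by (auto simp: upd5_def)
  show "upd5 (upd5 s i e A B C D E) i e A' B' C' D' E' = upd5 s i e A' B' C' D' E'"
    by (rule upd5_eqI[symmetric]) (simp_all only: nth other assms not_False_eq_True)
  show "upd5 s i e (s ! 7) (s ! 8) (s ! i) (s ! 9) (s ! e) = s"
    by (rule upd5_eqI[symmetric]) (use assms in auto)
qed

lemma wp_compare:
  assumes "i < length s" "e < length s" "9 < length s" "distinct [i, e, 7, 8, 9]"
    "s ! 7 = seg @ 5 # L" "s ! 9 = []" "s ! e = flag ok"
    "0 \<notin> set seg" "5 \<notin> set seg" "0 \<notin> set (s ! i)" "length seg \<le> N" "length (s ! i) \<le> N"
  shows "wp N (compare i e) Q s \<longleftrightarrow>
    Q (upd5 s i e L (5 # rev seg @ s ! 8) (s ! i) [] (flag (ok \<and> s ! i = seg)))"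
proof -
  \<comment> \<open>State at the end of the loop: the used part of stack \<open>i\<close> lies
    reversed on stack 9, and the flag tells whether it agrees with \<open>seg\<close>. As
    \<open>take\<close> stops at the end of a short stack, a premature end counts as a
    mismatch.\<close>
  let ?after = "\<lambda>seg s ok. upd5 s i e (5 # L) (rev seg @ s ! 8) (drop (length seg) (s ! i))
     (rev (take (length seg) (s ! i)) @ s ! 9) (flag (ok \<and> take (length seg) (s ! i) = seg))"
  note neq = assms(4)
  have loop: "loop N (Suc n) (\<lambda>t. t ! 7 \<noteq> 5) (compare_body i e) Q s"
    if "Q (?after seg s ok)" "i < length s" "e < length s" "9 < length s" "s ! 7 = seg @ 5 # L"
      "s ! e = flag ok" "0 \<notin> set seg" "5 \<notin> set seg" "0 \<notin> set (s ! i)" "length seg \<le> n"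
    for seg s ok n Q
    using that
  proof (induction seg arbitrary: s ok n)
    case Nil
    have "?after [] s ok = s"
      using upd5_simps(8)[OF Nil.prems(2-4) neq] Nil.prems(5,6) by simp
    with Nil.prems show ?case
      by (simp add: loop_Suc)
  next
    case (Cons c seg)
    note u = upd5_simps[OF Cons.prems(2-4) neq]
    obtain m where n: "n = Suc m" using Cons.prems(10) by (cases n) auto
    define s1 where "s1 = upd5 s i e (seg @ 5 # L) (c # s ! 8) (tl (s ! i))
      ((if s ! i = [] then [] else [peek (s ! i)]) @ s ! 9) (flag (ok \<and> peek (s ! i) = c))"
    have "?after seg s1 (ok \<and> peek (s ! i) = c) = ?after (c # seg) s ok"
      using Cons.prems(7) by (cases "s ! i") (auto simp: s1_def u)
    moreover have "0 \<notin> set (tl (s ! i))"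
      using Cons.prems(9) by (cases "s ! i") auto
    ultimately have "loop N (Suc m) (\<lambda>t. t ! 7 \<noteq> 5) (compare_body i e) Q s1"
      using Cons.prems n by (intro Cons.IH[of s1 "ok \<and> peek (s ! i) = c"]) (auto simp: s1_def u)
    moreover have "wp N (compare_body i e) R s \<longleftrightarrow> R s1" for R
    proof -
      have "wp N (compare_body i e) (\<lambda>x. x = s1) s"
      proof (cases "s ! i")
        case Nil
        with neq Cons.prems show ?thesis
          unfolding compare_body_def s1_def
          by (simp add: wp_shift) (rule upd5_eqI; auto simp: flag_def)
      next
        case (Cons d ds)
        note si = this
        show ?thesis
        proof (cases "d = c")
          case True
          with si neq Cons.prems(2-9) show ?thesis
            unfolding compare_body_def s1_def
            by (simp add: wp_shift) (rule upd5_eqI; auto simp: flag_def)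
        next
          case False
          with si neq Cons.prems(2-9) show ?thesis
            unfolding compare_body_def s1_def
            by (simp add: wp_shift) (rule upd5_eqI; auto simp: flag_def)
        qed
      qed
      then show ?thesis by (rule wp_eqI)
    qed
    ultimately show ?case
      using Cons.prems n by (simp add: loop_Suc[of _ "Suc m"])
  qed
  note u = upd5_simps[OF assms(1-4)]
  define s1 where "s1 = ?after seg s ok"
  define s2 where "s2 = upd5 s i e L (5 # rev seg @ s ! 8) (s ! i) [] (flag (ok \<and> s ! i = seg))"
  have eq: "take (length seg) (s ! i) = seg \<and> drop (length seg) (s ! i) = [] \<longleftrightarrow> s ! i = seg"
    by (metis append_take_drop_id append_Nil2 drop_all order_refl take_all)
  have tl0: "0 \<notin> set (take n (s ! i))" "0 \<notin> set (drop n (s ! i))" for n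
    using assms(10) by (auto dest: in_set_takeD in_set_dropD)
  have len: "length s1 = length s" by (simp add: s1_def u)
  have peek0: "peek (drop (length seg) (s ! i)) = 0 \<longleftrightarrow> drop (length seg) (s ! i) = []"
    using tl0(2)[of "length seg"] by (cases "drop (length seg) (s ! i)") auto
  have "wp N (Cond (\<lambda>t. t ! i \<noteq> 0) (Put e (\<lambda>_. 1)) Skip ;; shift 7 8 ;; move_stack 9 i)
      (\<lambda>x. x = s2) s1"
  proof -
    have "wp N (Cond (\<lambda>t. t ! i \<noteq> 0) (Put e (\<lambda>_. 1)) Skip) R s1 \<longleftrightarrow>
        R (s1[e := flag (ok \<and> s ! i = seg)])" for R
    proof (cases "drop (length seg) (s ! i) = []")
      case True
      with eq have "take (length seg) (s ! i) = seg \<longleftrightarrow> s ! i = seg" by blast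
      then have "s1 ! e = flag (ok \<and> s ! i = seg)"
        by (simp only: s1_def u)
      then have "s1[e := flag (ok \<and> s ! i = seg)] = s1"
        using list_update_id[of s1 e] by simp
      with True show ?thesis
        using assms(1) by (simp add: len s1_def u)
    next
      case False
      then have "flag (ok \<and> s ! i = seg) = [1]"
        using eq by (auto simp: flag_def)
      with False peek0 show ?thesis
        using assms(1) by (simp add: len) (simp add: s1_def u)
    qed
    moreover have "wp N (shift 7 8 ;; move_stack 9 i) (\<lambda>x. x = s2) (s1[e := flag (ok \<and> s ! i = seg)])"
    proof -
      let ?s = "upd5 s i e L (5 # rev seg @ s ! 8) (drop (length seg) (s ! i))
          (rev (take (length seg) (s ! i))) (flag (ok \<and> s ! i = seg))"
      have "wp N (shift 7 8) R (s1[e := flag (ok \<and> s ! i = seg)]) \<longleftrightarrow> R ?s" for R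
      proof -
        have "s1[e := flag (ok \<and> s ! i = seg), 8 := 5 # rev seg @ s ! 8, 7 := L] = ?s"
          by (rule upd5_eqI) (use assms(1-4,6) in \<open>auto simp: s1_def u, auto simp: upd5_def\<close>)
        moreover have "7 < length s" "8 < length s" "e \<noteq> 7" "e \<noteq> 8"
          using assms(3,4) by auto
        ultimately show ?thesis
          using assms(1-4) by (simp add: wp_shift len) (simp add: s1_def u)
      qed
      moreover have "?s[9 := [], i := rev (?s ! 9) @ ?s ! i] = s2"
        unfolding s2_def by (rule upd5_eqI) (use assms(1-4,6) in \<open>auto simp: u, auto simp: upd5_def\<close>)
      moreover have "length (take (length seg) (s ! i)) \<le> N" using assms(12) by simp
      moreover have "i \<noteq> 9" "9 \<noteq> i" using assms(4) by auto
      ultimately show ?thesis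
        using assms(1-3) tl0 by (simp add: wp_move_stack u)
    qed
    ultimately show ?thesis by simp
  qed
  then have "wp N (compare i e) (\<lambda>x. x = s2) s"
    unfolding compare_def wp.simps(5) wp_While s1_def
    by (intro loop) (use assms in auto)
  then show ?thesis unfolding s2_def by (rule wp_eqI)
qed

lemma wp_compare_parts:
  assumes "0 \<notin> set seg" "5 \<notin> set seg" "length seg \<le> N"
  shows "0 \<notin> set x \<Longrightarrow> length x \<le> N \<Longrightarrow>
      wp N (compare 3 10) Q (w # u # p # x # y # d # sg # (seg @ 5 # L) # K # [] # flag ok # zs) \<longleftrightarrow>
      Q (w # u # p # x # y # d # sg # L # (5 # rev seg @ K) # [] # flag (ok \<and> x = seg) # zs)"
    and "0 \<notin> set y \<Longrightarrow> length y \<le> N \<Longrightarrow>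
      wp N (compare 4 10) Q (w # u # p # x # y # d # sg # (seg @ 5 # L) # K # [] # flag ok # zs) \<longleftrightarrow>
      Q (w # u # p # x # y # d # sg # L # (5 # rev seg @ K) # [] # flag (ok \<and> y = seg) # zs)"
    and "0 \<notin> set d \<Longrightarrow> length d \<le> N \<Longrightarrow>
      wp N (compare 5 11) Q (w # u # p # x # y # d # sg # (seg @ 5 # L) # K # [] # e # flag ok # zs) \<longleftrightarrow>
      Q (w # u # p # x # y # d # sg # L # (5 # rev seg @ K) # [] # e # flag (ok \<and> d = seg) # zs)"
  using assms by (subst wp_compare[where seg = seg and L = L and ok = ok]; simp add: upd5_def)+

section \<open>Comparing and storing literals\<close>

definition literal_ok :: "nat \<Rightarrow> literal \<Rightarrow> bool" where
  "literal_ok n l = (case l of (b, s, k) \<Rightarrow> nat \<bar>fst s\<bar> \<le> n \<and> nat \<bar>snd s\<bar> \<le> n \<and>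
     length (binary (snd k)) \<le> n \<and> fst k \<in> {3, 4})"

lemma zero_notin_unary [simp]: "0 \<notin> set (unary x)" "5 \<notin> set (unary x)"
  using set_unary[of x] by auto

lemma notin_binary [simp]: "0 \<notin> set (binary n)" "5 \<notin> set (binary n)"
  using binary_digits[of n] by auto

lemma notin_key [simp]: "fst k \<in> {3, 4} \<Longrightarrow> 0 \<notin> set (key k)" "fst k \<in> {3, 4} \<Longrightarrow> 5 \<notin> set (key k)"
  by (auto simp: key_def)

lemma length_key: "length (key k) = Suc (length (binary (snd k)))"
  by (simp add: key_def)

lemma peek_key [simp]: "peek (key k) = fst k"
  by (simp add: key_def)

lemma sign_inject [simp]: "sign \<sigma> = sign \<tau> \<longleftrightarrow> \<sigma> = \<tau>"
  by (cases \<sigma> rule: sign.cases; cases \<tau> rule: sign.cases) auto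

lemma sign_eq [simp]:
  "sign \<sigma> \<noteq> 0" "0 < sign \<sigma>" "sign \<sigma> < 8" "\<not> 8 \<le> sign \<sigma>" "sign \<sigma> = Suc 0 \<longleftrightarrow> \<sigma> = Some True" "sign \<sigma> = 2 \<longleftrightarrow> \<sigma> = Some False"
  "sign \<sigma> = 3 \<longleftrightarrow> \<sigma> = None"
  by (cases \<sigma> rule: sign.cases; simp)+

definition check_literal :: com where
  "check_literal = (put_sym 12 (\<lambda>t. t ! 7) ;; shift 7 8 ;;
     compare 3 10 ;; compare 4 10 ;; compare 5 11 ;;
     Cond (\<lambda>t. t ! 11 = 0 \<and> (t ! 10 = 0 \<and> t ! 6 \<noteq> t ! 12 \<or>
         t ! 10 \<noteq> 0 \<and> t ! 5 = 4 \<and> t ! 6 = 1 \<and> t ! 12 = 1))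
       (Put 13 (\<lambda>_. 1)) Skip ;;
     Pop 10 ;; Pop 11 ;; Pop 12)"

lemma wp_check_literal:
  assumes "literal_ok n (b, s, k)" "literal_ok n l" "Suc n \<le> N"
  shows "wp N check_literal Q (w # u # p # unary (fst s) # unary (snd s) # key k # [sign (Some b)] #
      (literal_word l @ L) # K # [] # [] # [] # [] # flag ok # zs) \<longleftrightarrow>
    Q (w # u # p # unary (fst s) # unary (snd s) # key k # [sign (Some b)] #
      L # (rev (literal_word l) @ K) # [] # [] # [] # [] # flag (ok \<and> \<not> conflict (b, s, k) l) # zs)"
proof -
  obtain b' s' k' where l: "l = (b', s', k')" by (cases l) auto
  have k: "fst k \<in> {3, 4}" "fst k' \<in> {3, 4}" and
    len: "length (key k) \<le> N" "length (key k') \<le> N" "length (unary (fst s)) \<le> N"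
      "length (unary (snd s)) \<le> N" "length (unary (fst s')) \<le> N" "length (unary (snd s')) \<le> N"
    using assms by (auto simp: literal_ok_def l length_key length_unary)
  have fl: "tl (flag ok) = []" "1 # [] = flag False" by (auto simp: flag_def)
  note cmp = wp_compare_parts[where ok = True, simplified]
  define ex where "ex \<longleftrightarrow> fst s = fst s'"
  define ey where "ey \<longleftrightarrow> snd s = snd s'"
  have "wp N check_literal Q (w # u # p # unary (fst s) # unary (snd s) # key k # [sign (Some b)] #
      (literal_word l @ L) # K # [] # [] # [] # [] # flag ok # zs) \<longleftrightarrow>
    wp N (Cond (\<lambda>t. t ! 11 = 0 \<and> (t ! 10 = 0 \<and> t ! 6 \<noteq> t ! 12 \<or>
         t ! 10 \<noteq> 0 \<and> t ! 5 = 4 \<and> t ! 6 = 1 \<and> t ! 12 = 1))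
       (Put 13 (\<lambda>_. 1)) Skip ;; Pop 10 ;; Pop 11 ;; Pop 12) Q
     (w # u # p # unary (fst s) # unary (snd s) # key k # [sign (Some b)] #
      L # (rev (literal_word l) @ K) # [] # flag (ex \<and> ey) # flag (k = k') # [sign (Some b')] #
      flag ok # zs)"
    using len k
    by (simp add: check_literal_def literal_word_def l wp_macros cmp wp_compare_parts key_inject
        ex_def ey_def)
  also have "\<dots> \<longleftrightarrow>  Q (w # u # p # unary (fst s) # unary (snd s) # key k # [sign (Some b)] #
      L # (rev (literal_word l) @ K) # [] # [] # [] # [] # flag (ok \<and> \<not> conflict (b, s, k) l) # zs)"
    by (cases s; cases s'; cases "k = k'"; cases "ex \<and> ey")
      (auto simp: l flag_def ex_def ey_def)
  finally show ?thesis .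
qed

definition check_literals :: com where
  "check_literals = (While (\<lambda>t. t ! 7 \<noteq> 0) check_literal ;; move_stack 8 7)"

lemma literal_word_Cons: "literal_word l = sign (Some (fst l)) # tl (literal_word l)"
  by (cases l) (simp add: literal_word_def)

lemma zero_notin_literal_word: "literal_ok n l \<Longrightarrow> 0 \<notin> set (literal_word l)"
  by (cases l) (auto simp: literal_word_def literal_ok_def)

lemma wp_check_literals:
  assumes "literal_ok n (b, s, k)" "\<forall>l \<in> set ls. literal_ok n l" "Suc n \<le> N"
    "length ls \<le> N" "length (concat (map literal_word ls)) \<le> N"
  shows "wp N check_literals Q (w # u # p # unary (fst s) # unary (snd s) # key k # [sign (Some b)] #
      concat (map literal_word ls) # [] # [] # [] # [] # [] # flag ok # zs) \<longleftrightarrow>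
    Q (w # u # p # unary (fst s) # unary (snd s) # key k # [sign (Some b)] #
      concat (map literal_word ls) # [] # [] # [] # [] # [] #
      flag (ok \<and> (\<forall>l \<in> set ls. \<not> conflict (b, s, k) l)) # zs)"
proof -
  have "loop N (Suc m) (\<lambda>t. t ! 7 \<noteq> 0) check_literal Q
     (w # u # p # unary (fst s) # unary (snd s) # key k # [sign (Some b)] #
      concat (map literal_word ls) # K # [] # [] # [] # [] # flag ok # zs)"
    if "Q (w # u # p # unary (fst s) # unary (snd s) # key k # [sign (Some b)] #
      [] # (rev (concat (map literal_word ls)) @ K) # [] # [] # [] # [] #
      flag (ok \<and> (\<forall>l \<in> set ls. \<not> conflict (b, s, k) l)) # zs)"
     "\<forall>l \<in> set ls. literal_ok n l" "length ls \<le> m" for ls K ok m Q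
    using that
  proof (induction ls arbitrary: K ok m)
    case Nil
    then show ?case by (simp add: loop_Suc)
  next
    case (Cons l ls)
    then obtain m' where m: "m = Suc m'" by (cases m) auto
    have "peek (literal_word l @ concat (map literal_word ls)) \<noteq> 0"
      by (subst literal_word_Cons) simp
    with Cons m show ?case
      by (simp add: loop_Suc[of _ "Suc m'"] wp_check_literal[OF assms(1) _ assms(3)] conj_assoc)
  qed
  note * = this
  have z: "0 \<notin> set (concat (map literal_word ls))"
    using assms(2) zero_notin_literal_word by auto
  show ?thesis
    by (rule wp_eqI, unfold check_literals_def wp.simps(5) wp_While, rule *)
      (use assms z in \<open>simp_all add: wp_macros\<close>)
qed

text \<open>The parts are pushed in reverse order because the first symbol of
  \<open>literal_word\<close> lies on top. Each is copied through stack 9, which leaves the original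
  in place.\<close>

definition add_literal :: com where
  "add_literal = (check_literals ;;
     put_sym 7 (\<lambda>_. 5) ;; move_stack 5 9 ;; copy_back 9 5 7 ;;
     put_sym 7 (\<lambda>_. 5) ;; move_stack 4 9 ;; copy_back 9 4 7 ;;
     put_sym 7 (\<lambda>_. 5) ;; move_stack 3 9 ;; copy_back 9 3 7 ;;
     put_sym 7 (\<lambda>t. t ! 6))"

lemma wp_add_literal:
  assumes "literal_ok n (b, s, k)" "\<forall>l \<in> set ls. literal_ok n l" "Suc n \<le> N"
    "length ls \<le> N" "length (concat (map literal_word ls)) \<le> N"
  shows "wp N add_literal Q (w # u # p # unary (fst s) # unary (snd s) # key k # [sign (Some b)] #
      concat (map literal_word ls) # [] # [] # [] # [] # [] # flag (consistent ls) # zs) \<longleftrightarrow>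
    Q (w # u # p # unary (fst s) # unary (snd s) # key k # [sign (Some b)] #
      concat (map literal_word ((b, s, k) # ls)) # [] # [] # [] # [] # [] #
      flag (consistent ((b, s, k) # ls)) # zs)"
proof -
  have k: "fst k \<in> {3, 4}" and
    len: "length (key k) \<le> N" "length (unary (fst s)) \<le> N" "length (unary (snd s)) \<le> N"
    using assms by (auto simp: literal_ok_def length_key length_unary)
  then show ?thesis
    using wp_check_literals[OF assms]
    by (simp add: add_literal_def wp_macros literal_word_def conj_commute)
qed

definition digits_loop :: "nat \<Rightarrow> com" where
  "digits_loop j = While (\<lambda>t. t ! 0 = 1 \<or> t ! 0 = 2) (shift 0 j)"

lemma no_digit_peek: "no_digit_first r \<Longrightarrow> peek r \<noteq> 1 \<and> peek r \<noteq> 2"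
  by (cases r) (auto simp: no_digit_first_def)

lemma wp_digits_loop:
  assumes "no_digit_first r" "set ds \<subseteq> {1, 2}" "length ds \<le> N"
  shows "wp N (digits_loop 5) Q ((ds @ r) # u # p # x # y # d # zs) \<longleftrightarrow>
    Q (r # u # p # x # y # (rev ds @ d) # zs)"
proof -
  have "loop N (Suc m) (\<lambda>t. t ! 0 = 1 \<or> t ! 0 = 2) (shift 0 5) Q ((ds @ r) # u # p # x # y # d # zs)"
    if "Q (r # u # p # x # y # (rev ds @ d) # zs)" "set ds \<subseteq> {1, 2}" "length ds \<le> m" for ds d m Q
    using that
  proof (induction ds arbitrary: d m)
    case Nil
    then show ?case using no_digit_peek[OF assms(1)] by (simp add: loop_Suc)
  next
    case (Cons c ds)
    then obtain m' where m: "m = Suc m'" by (cases m) auto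
    with Cons show ?case
      by (auto simp: loop_Suc[of _ "Suc m'"] wp_macros)
  qed
  note * = this
  show ?thesis
    by (rule wp_eqI, unfold digits_loop_def wp_While, rule *) (use assms in simp_all)
qed

text \<open>The tag waits on stack 14 while the digits are moved, so that it ends up on top of the
  key.\<close>

definition tableau_leaf :: com where
  "tableau_leaf = (shift 0 14 ;; digits_loop 5 ;; shift 14 5 ;; shift 2 6 ;;
     Cond (\<lambda>t. t ! 6 = 3) Skip add_literal ;; Pop 6 ;; clear_stack 5)"

text \<open>The pending stack holds the signs of the formulas still to be read, interspersed with the
  moves that lead back to the position of the next one.\<close>

definition tableau_body :: com where
  "tableau_body =
     Cond (\<lambda>t. t ! 2 \<ge> 8) (steer 2 ;; Pop 2)
     (Cond (\<lambda>t. t ! 0 = 5)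
       (Pop 0 ;; Put 2 (\<lambda>t. if t ! 2 = 1 then 2 else if t ! 2 = 2 then 1 else 3))
     (Cond (\<lambda>t. t ! 0 = 6)
       (Pop 0 ;;
        Cond (\<lambda>t. t ! 2 = 2)
          (Cond (\<lambda>t. t ! 1 = 1)
            (Put 2 (\<lambda>_. 3) ;; put_sym 2 (\<lambda>_. 2)) (put_sym 2 (\<lambda>_. 3)) ;; Pop 1)
          (put_sym 6 (\<lambda>t. t ! 2) ;; put_sym 2 (\<lambda>t. t ! 6) ;; Pop 6))
     (Cond (\<lambda>t. t ! 0 = 7)
       (Pop 0 ;; shift 2 6 ;; put_sym 2 (\<lambda>t. opposite (t ! 0)) ;; shift 6 2 ;; steer 0 ;; Pop 0)
     tableau_leaf)))"

definition tableau_state :: "word \<Rightarrow> word \<Rightarrow> nat list \<Rightarrow> pos \<Rightarrow> literal list \<Rightarrow> state \<Rightarrow> state" where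
  "tableau_state w u p s ls zs = w # u # p # unary (fst s) # unary (snd s) # [] # [] #
     concat (map literal_word ls) # [] # [] # [] # [] # [] # flag (consistent ls) # [] # zs"

definition literals_bounded :: "nat \<Rightarrow> nat \<Rightarrow> literal list \<Rightarrow> bool" where
  "literals_bounded N n ls \<longleftrightarrow> (\<forall>l \<in> set ls. literal_ok n l) \<and> length ls \<le> N \<and>
     length (concat (map literal_word ls)) \<le> N"

lemma wp_tableau_leaf:
  assumes "literal_ok n (True, s, k)" "literals_bounded N n ls" "Suc n \<le> N" "no_digit_first r"
  shows "wp N tableau_body Q
      (tableau_state ((fst k # binary (snd k)) @ r) u (sign \<sigma> # p) s ls zs) \<longleftrightarrow>
    Q (tableau_state r u p s ((case \<sigma> of None \<Rightarrow> [] | Some b \<Rightarrow> [(b, s, k)]) @ ls) zs)"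
proof -
  have k: "fst k \<in> {3, 4}" "length (binary (snd k)) \<le> n"
    using assms(1) by (auto simp: literal_ok_def)
  have tb: "wp N tableau_body Q (tableau_state ((fst k # binary (snd k)) @ r) u (sign \<sigma> # p) s ls zs) \<longleftrightarrow>
    wp N (Cond (\<lambda>t. t ! 6 = 3) Skip add_literal ;; Pop 6 ;; clear_stack 5) Q
     (r # u # p # unary (fst s) # unary (snd s) # key k # [sign \<sigma>] # 
     concat (map literal_word ls) # [] # [] # [] # [] # [] # flag (consistent ls) # [] # zs)"
  proof -
    have "wp N tableau_body Q (tableau_state ((fst k # binary (snd k)) @ r) u (sign \<sigma> # p) s ls zs) \<longleftrightarrow>
      wp N tableau_leaf Q (tableau_state ((fst k # binary (snd k)) @ r) u (sign \<sigma> # p) s ls zs)"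
      using k(1) by (elim insertE emptyE) (simp_all add: tableau_body_def tableau_state_def)
    moreover have "wp N (shift 0 14 ;; digits_loop 5 ;; shift 14 5 ;; shift 2 6 ;; C) Q
        (tableau_state ((fst k # binary (snd k)) @ r) u (sign \<sigma> # p) s ls zs) \<longleftrightarrow>
      wp N C Q (r # u # p # unary (fst s) # unary (snd s) # key k # [sign \<sigma>] # 
        concat (map literal_word ls) # [] # [] # [] # [] # [] # flag (consistent ls) # [] # zs)" for C
      using k assms(3-4) binary_digits[of "snd k"]
      by (simp add: tableau_state_def wp_macros wp_digits_loop key_def)
    ultimately show ?thesis
      by (simp only: tableau_leaf_def)
  qed
  have len: "length (key k) \<le> N" using assms(3) k by (simp add: length_key)
  show ?thesis
  proof (cases \<sigma>)
    case None
    then show ?thesis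
      unfolding tb using len k(1) by (simp add: wp_macros tableau_state_def)
  next
    case (Some b')
    have "literal_ok n (b', s, k)"
      using assms(1) by (auto simp: literal_ok_def)
    then show ?thesis
      unfolding tb using len k(1) assms(2,3) Some
      by (simp add: wp_macros tableau_state_def wp_add_literal literals_bounded_def del: sign.simps)
  qed
qed

lemma wp_tableau_body:
  shows "c \<in> {8..11} \<Longrightarrow> wp N tableau_body Q (tableau_state w u (c # p) s ls zs) \<longleftrightarrow>
      Q (tableau_state w u p (steered c s) ls zs)"
    and "wp N tableau_body Q (tableau_state (5 # w) u (sign \<sigma> # p) s ls zs) \<longleftrightarrow>
      Q (tableau_state w u (sign (map_option Not \<sigma>) # p) s ls zs)"
    and "conj_signs \<sigma> u = (\<sigma>1, \<sigma>2, u') \<Longrightarrow>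
      wp N tableau_body Q (tableau_state (6 # w) u (sign \<sigma> # p) s ls zs) \<longleftrightarrow>
      Q (tableau_state w u' (sign \<sigma>1 # sign \<sigma>2 # p) s ls zs)"
    and "c \<in> {8..11} \<Longrightarrow> wp N tableau_body Q (tableau_state (7 # c # w) u (sign \<sigma> # p) s ls zs) \<longleftrightarrow>
      Q (tableau_state w u (sign \<sigma> # opposite c # p) (steered c s) ls zs)"
proof goal_cases
  case 1
  then show ?case by (simp add: tableau_body_def tableau_state_def wp_steer)
next
  case 2
  show ?case by (cases \<sigma> rule: sign.cases) (simp_all add: tableau_body_def tableau_state_def)
next
  case 3
  then show ?case
    by (cases \<sigma> rule: sign.cases; cases "peek u = 1")
      (auto simp: tableau_body_def tableau_state_def wp_macros)
next
  case 4
  then show ?case by (simp add: tableau_body_def tableau_state_def wp_steer wp_macros)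
qed

text \<open>Every move and every literal is paid for by a symbol of the formula, so its length
  bounds the number of literals and the growth of the coordinates; \<open>n\<close> also covers the
  starting position.\<close>

lemma literals_bounds:
  "only_moves \<phi> \<Longrightarrow> nat \<bar>fst s\<bar> + length (form_word a g \<phi>) \<le> n \<Longrightarrow>
    nat \<bar>snd s\<bar> + length (form_word a g \<phi>) \<le> n \<Longrightarrow> literals a g \<phi> \<sigma> s u = (new, u') \<Longrightarrow>
    (\<forall>l \<in> set new. literal_ok n l) \<and> length new \<le> length (form_word a g \<phi>)"
proof (induction \<phi> arbitrary: \<sigma> s u new u' rule: form_induct)
  case (Conj \<phi> \<psi>)
  obtain \<sigma>1 \<sigma>2 u0 where 0: "conj_signs \<sigma> u = (\<sigma>1, \<sigma>2, u0)"
    by (cases "conj_signs \<sigma> u") auto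
  obtain l1 u1 where 1: "literals a g \<phi> \<sigma>1 s u0 = (l1, u1)" by fastforce
  obtain l2 u2 where 2: "literals a g \<psi> \<sigma>2 s u1 = (l2, u2)" by fastforce
  from Conj.IH(1)[OF _ _ _ 1] Conj.IH(2)[OF _ _ _ 2] Conj.prems 0 1 2 show ?case
    by auto
next
  case (Box \<alpha> \<phi>)
  have "nat \<bar>fst (dir \<alpha> s)\<bar> \<le> Suc (nat \<bar>fst s\<bar>)" "nat \<bar>snd (dir \<alpha> s)\<bar> \<le> Suc (nat \<bar>snd s\<bar>)"
    using Box.prems(1) by (cases s; auto)+
  with Box.IH[of "dir \<alpha> s" \<sigma> u new u'] Box.prems show ?case by auto
next
  case (Neg \<phi>)
  from Neg.IH[of s "map_option Not \<sigma>" u new u'] Neg.prems show ?case by auto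
qed (auto simp: literal_ok_def split: option.splits)

text \<open>At most \<open>n\<close> symbols for each coordinate and for the digits, plus the sign,
  the tag and three separators.\<close>

lemma length_literal_words:
  "\<forall>l \<in> set ls. literal_ok n l \<Longrightarrow> length (concat (map literal_word ls)) \<le> length ls * (3 * n + 5)"
proof (induction ls)
  case (Cons l ls)
  then have "length (literal_word l) \<le> 3 * n + 5"
    by (cases l) (auto simp: literal_word_def literal_ok_def length_unary length_key)
  with Cons show ?case by simp
qed simp

definition tableau_loop :: "nat \<Rightarrow> nat \<Rightarrow> (state \<Rightarrow> bool) \<Rightarrow> state \<Rightarrow> bool" where
  "tableau_loop N k = loop N k (\<lambda>t. t ! 2 \<noteq> 0) tableau_body"

lemma tableau_loop_step:
  "peek p \<noteq> 0 \<Longrightarrow> wp N tableau_body (tableau_loop N k Q) (tableau_state w u p s ls zs) \<Longrightarrow> Suc k \<le> m \<Longrightarrow>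
    tableau_loop N m Q (tableau_state w u p s ls zs)"
  unfolding tableau_loop_def
  by (rule loop_mono_fuel[of _ "Suc k"]) (auto simp: loop_Suc tableau_state_def)

definition move_code :: "('p, 'i) prog \<Rightarrow> nat" where
  "move_code \<alpha> = hd (prog_word (\<lambda>_. 0) (\<lambda>_. 0) \<alpha>)"

lemma move_code:
  assumes "\<alpha> \<in> {GoUp, GoDown, GoRight, GoLeft}"
  shows "prog_word a g \<alpha> = [move_code \<alpha>]" "move_code \<alpha> \<in> {8..11}" "steered (move_code \<alpha>) s = dir \<alpha> s"
  using assms by (cases s; auto simp: move_code_def)+

text \<open>The arbitrary rest \<open>r\<close>, pending stack \<open>p\<close> and postcondition
  allow two conjuncts to be processed one after the other. Twice the length bounds the iterations:
  each one that reads input consumes a symbol, and each modality causes one more for undoing its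
  move. The product keeps the whole literal stack within \<open>N\<close>.\<close>

lemma tableau_loop_form:
  assumes N: "Suc n \<le> N"
  shows "only_moves \<phi> \<Longrightarrow> no_digit_first r \<Longrightarrow> nat \<bar>fst s\<bar> + length (form_word a g \<phi>) \<le> n \<Longrightarrow>
    nat \<bar>snd s\<bar> + length (form_word a g \<phi>) \<le> n \<Longrightarrow> \<forall>l \<in> set ls. literal_ok n l \<Longrightarrow>
    (length ls + length (form_word a g \<phi>)) * (3 * n + 5) \<le> N \<Longrightarrow>
    literals a g \<phi> \<sigma> s u = (new, u') \<Longrightarrow>
    tableau_loop N k Q (tableau_state r u' p s (rev new @ ls) zs) \<Longrightarrow>
    tableau_loop N (2 * length (form_word a g \<phi>) + k) Q
      (tableau_state (form_word a g \<phi> @ r) u (sign \<sigma> # p) s ls zs)"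
proof (induction \<phi> arbitrary: r \<sigma> s u new u' k p ls rule: form_induct)
  case (Atom x)
  have "length ls * (3 * n + 5) \<le> N" using Atom.prems(6) by (simp add: algebra_simps)
  moreover have "length ls \<le> length ls * (3 * n + 5)" by (simp add: algebra_simps)
  ultimately have "literals_bounded N n ls"
    using Atom.prems(5) length_literal_words[of ls n]
    unfolding literals_bounded_def by linarith
  with Atom.prems N show ?case
    by (intro tableau_loop_step[where k = k])
      (auto simp: wp_tableau_leaf[where k = "(3, a x)" and n = n, simplified] literal_ok_def split: option.splits)
next
  case (Here x)
  have "length ls * (3 * n + 5) \<le> N" using Here.prems(6) by (simp add: algebra_simps)
  moreover have "length ls \<le> length ls * (3 * n + 5)" by (simp add: algebra_simps)
  ultimately have "literals_bounded N n ls"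
    using Here.prems(5) length_literal_words[of ls n]
    unfolding literals_bounded_def by linarith
  with Here.prems N show ?case
    by (intro tableau_loop_step[where k = k])
      (auto simp: wp_tableau_leaf[where k = "(4, g x)" and n = n, simplified] literal_ok_def split: option.splits)
next
  case (Neg \<phi>)
  have "tableau_loop N (2 * length (form_word a g \<phi>) + k) Q
      (tableau_state (form_word a g \<phi> @ r) u (sign (map_option Not \<sigma>) # p) s ls zs)"
    by (rule Neg.IH[where new = new and u' = u']) (use Neg.prems in \<open>auto intro: le_trans[rotated]\<close>)
  then show ?case
    by (intro tableau_loop_step[where k = "2 * length (form_word a g \<phi>) + k"])
      (auto simp: wp_tableau_body simp del: sign.simps)
next
  case (Conj \<phi> \<psi>)
  obtain \<sigma>1 \<sigma>2 u0 where 0: "conj_signs \<sigma> u = (\<sigma>1, \<sigma>2, u0)"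
    by (cases "conj_signs \<sigma> u") auto
  obtain l1 u1 where 1: "literals a g \<phi> \<sigma>1 s u0 = (l1, u1)" by fastforce
  obtain l2 u2 where 2: "literals a g \<psi> \<sigma>2 s u1 = (l2, u2)" by fastforce
  have bnd: "(\<forall>l \<in> set l1. literal_ok n l) \<and> length l1 \<le> length (form_word a g \<phi>)"
    by (rule literals_bounds[OF _ _ _ 1]) (use Conj.prems in auto)
  have le: "(length (rev l1 @ ls) + length (form_word a g \<psi>)) * (3 * n + 5) \<le> N"
    "(length ls + length (form_word a g \<phi>)) * (3 * n + 5) \<le> N"
    by (rule le_trans[OF mult_le_mono1 Conj.prems(6)]; use bnd in auto)+
  have "tableau_loop N (2 * length (form_word a g \<psi>) + k) Q
      (tableau_state (form_word a g \<psi> @ r) u1 (sign \<sigma>2 # p) s (rev l1 @ ls) zs)"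
    by (rule Conj.IH(2)[OF _ _ _ _ _ le(1) 2]) (use Conj.prems 0 1 2 bnd in auto)
  then have "tableau_loop N (2 * length (form_word a g \<phi>) + (2 * length (form_word a g \<psi>) + k)) Q
      (tableau_state (form_word a g \<phi> @ form_word a g \<psi> @ r) u0 (sign \<sigma>1 # sign \<sigma>2 # p) s ls zs)"
    by (intro Conj.IH(1)[OF _ _ _ _ _ le(2) 1]) (use Conj.prems in auto)
  then show ?case
    by (intro tableau_loop_step[where k = "2 * length (form_word a g \<phi>) + (2 * length (form_word a g \<psi>) + k)"])
      (auto simp: wp_tableau_body(3)[OF 0] simp del: sign.simps)
next
  case (Box \<alpha> \<phi>)
  have \<alpha>: "\<alpha> \<in> {GoUp, GoDown, GoRight, GoLeft}" using Box.prems(1) by simp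
  note code = move_code[OF \<alpha>]
  have opp: "opposite (move_code \<alpha>) \<in> {8..11}" by (auto simp: opposite_def)
  have dir: "nat \<bar>fst (dir \<alpha> s)\<bar> \<le> Suc (nat \<bar>fst s\<bar>)" "nat \<bar>snd (dir \<alpha> s)\<bar> \<le> Suc (nat \<bar>snd s\<bar>)"
    using \<alpha> by (cases s; auto)+
  have "steered (opposite (move_code \<alpha>)) (dir \<alpha> s) = s"
    using steered_opposite[OF code(2)] code(3) by metis
  with Box.prems(8) opp have "tableau_loop N (Suc k) Q
      (tableau_state r u' (opposite (move_code \<alpha>) # p) (dir \<alpha> s) (rev new @ ls) zs)"
    by (intro tableau_loop_step[where k = k]) (auto simp: wp_tableau_body(1))
  then have "tableau_loop N (2 * length (form_word a g \<phi>) + Suc k) Q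
      (tableau_state (form_word a g \<phi> @ r) u (sign \<sigma> # opposite (move_code \<alpha>) # p) (dir \<alpha> s) ls zs)"
    by (intro Box.IH[where new = new and u' = u'])
      (use Box.prems dir code(1) in \<open>auto intro: le_trans[rotated]\<close>)
  then show ?case
    using code by (intro tableau_loop_step[where k = "2 * length (form_word a g \<phi>) + Suc k"])
      (auto simp: wp_tableau_body(4) simp del: sign.simps atLeastAtMost_iff)
qed

definition tableau :: com where
  "tableau = While (\<lambda>t. t ! 2 \<noteq> 0) tableau_body"

theorem wp_tableau:
  assumes "only_moves \<phi>" "w = form_word a g \<phi>" "literals a g \<phi> (Some True) (0, 0) u = (new, u')"
    and "length w * (3 * length w + 5) \<le> N"
  shows "wp N tableau Q (tableau_state w u [1] (0, 0) [] zs) \<longleftrightarrow>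
    Q (tableau_state [] u' [] (0, 0) (rev new) zs)"
proof -
  have "w \<noteq> []" unfolding assms(2) by (cases \<phi>) auto
  then have "length w * 8 \<le> length w * (3 * length w + 5)"
    by (intro mult_le_mono2) (cases w, auto)
  with assms(4) \<open>w \<noteq> []\<close> have N: "Suc (length w) \<le> N" "2 * length w + 1 \<le> Suc N"
    by (cases w; simp)+
  have "tableau_loop N (2 * length (form_word a g \<phi>) + 1) Q
      (tableau_state (form_word a g \<phi> @ []) u (sign (Some True) # []) (0, 0) [] zs)"
    if "Q (tableau_state [] u' [] (0, 0) (rev new @ []) zs)" for Q
    by (rule tableau_loop_form[OF N(1) _ _ _ _ _ _ assms(3)])
      (use assms that in \<open>auto simp: tableau_loop_def loop_Suc tableau_state_def\<close>)
  then have "tableau_loop N (2 * length w + 1) (\<lambda>x. x = tableau_state [] u' [] (0, 0) (rev new) zs)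
      (tableau_state w u [1] (0, 0) [] zs)"
    using assms(2) by simp
  then show ?thesis
    unfolding tableau_loop_def
    by (intro wp_eqI, unfold tableau_def wp_While) (rule loop_mono_fuel[OF _ N(2)])
qed

section \<open>Parsing\<close>

text \<open>
  Stack 0 holds the rest of the input and 5 the part already read, 2 the kinds of the expected
  expressions (1 for formulas, 2 for programs), 3 the state of the automaton reading a number,
  and 4 is set when the input is rejected.
\<close>

lemma binary_snoc:
  assumes "ds \<noteq> []"
  shows "ds @ [d] = binary n \<longleftrightarrow> n \<ge> 2 \<and> ds = binary (n div 2) \<and> d = n mod 2 + 1"
  using assms by (subst binary.simps) auto

text \<open>The set \<open>R\<close> of admissible numbers is an initial segment of the naturals, possibly all of
  them. The class of a digit string is what a finite automaton has to remember about it.\<close>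

definition num_class :: "nat set \<Rightarrow> nat list \<Rightarrow> nat" where
  "num_class R ds = (if ds = [] then 1
     else if \<exists>n \<in> R. ds = binary n
       then (if finite R then 4 + (THE n. ds = binary n) else if ds = binary 0 then 4 else 5)
     else 3)"

text \<open>The transition uses an arbitrary representative of the class;
  \<open>num_class_snoc_cong\<close> makes the choice immaterial. The result is a class for every
  \<open>q\<close>, which keeps the written symbols bounded.\<close>

definition class_step :: "nat set \<Rightarrow> nat \<Rightarrow> nat \<Rightarrow> nat" where
  "class_step R q d = num_class R ((SOME ds. num_class R ds = q) @ [d])"

lemma The_binary [simp]: "(THE m. binary n = binary m) = n"
  by (rule the_equality) (auto dest: binary_eq_imp)

lemma num_class_cases:
  "num_class R ds = 1 \<longleftrightarrow> ds = []" "4 \<le> num_class R ds \<longleftrightarrow> (\<exists>n \<in> R. ds = binary n)"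
  by (auto simp: num_class_def binary_not_Nil binary_not_Nil[symmetric])

definition parse_number :: "nat set \<Rightarrow> com" where
  "parse_number R = (Put 3 (\<lambda>_. 1) ;;
     While (\<lambda>t. t ! 0 = 1 \<or> t ! 0 = 2) (Put 3 (\<lambda>t. class_step R (t ! 3) (t ! 0)) ;; shift 0 5) ;;
     Cond (\<lambda>t. t ! 3 \<ge> 4) Skip (Put 4 (\<lambda>_. 1)))"

context
  fixes R :: "nat set"
  assumes R: "R = UNIV \<or> (\<exists>m. R = {..<m})"
begin

text \<open>For finite \<open>R\<close> the class of an accepted string determines the string. For
  infinite \<open>R\<close>, which means all naturals, only the numeral of 0 must be told apart,
  being the only one that no digit can extend.\<close>

lemma num_class_snoc_cong:
  assumes eq: "num_class R ds = num_class R es"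
  shows "num_class R (ds @ [d]) = num_class R (es @ [d])"
proof (cases "ds = [] \<or> es = []")
  case True
  with eq num_class_cases(1)[of R] show ?thesis by metis
next
  case False
  then have snoc: "ds @ [d] = binary n \<longleftrightarrow> n \<ge> 2 \<and> ds = binary (n div 2) \<and> d = n mod 2 + 1"
    "es @ [d] = binary n \<longleftrightarrow> n \<ge> 2 \<and> es = binary (n div 2) \<and> d = n mod 2 + 1" for n
    by (auto simp: binary_snoc)
  \<comment> \<open>An initial segment is closed under dropping the last digit, so a nonempty
    rejected string cannot grow into an accepted one.\<close>
  have half: "n div 2 \<in> R" if "n \<in> R" for n
    using R that by auto
  show ?thesis
  proof (cases "\<exists>n \<in> R. ds = binary n")
    case True
    then have "\<exists>n \<in> R. es = binary n" using eq num_class_cases(2)[of R] by metis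
    with True obtain n k where n: "n \<in> R" "ds = binary n" "k \<in> R" "es = binary k" by blast
    show ?thesis
    proof (cases "finite R")
      case True
      then have "num_class R (binary j) = 4 + j" if "j \<in> R" for j
        using that by (auto simp: num_class_def binary_not_Nil)
      with n eq have "n = k" by simp
      with n show ?thesis by simp
    next
      case inf: False
      with R have R: "R = UNIV" by auto
      have z: "n = 0 \<longleftrightarrow> k = 0"
        using eq inf n False by (auto simp: num_class_def dest: binary_eq_imp split: if_splits)
      have bin: "(\<exists>m. x @ [d] = binary m) \<longleftrightarrow> j \<noteq> 0 \<and> d \<in> {1, 2}"
        if "x = binary j" for x j
      proof -
        have x: "x \<noteq> []" using that by (simp add: binary_not_Nil)
        show ?thesis
        proof
          assume "\<exists>m. x @ [d] = binary m"
          then obtain m where "x @ [d] = binary m" ..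
          then have "m \<ge> 2 \<and> x = binary (m div 2) \<and> d = m mod 2 + 1"
            by (simp only: binary_snoc[OF x])
          then have m: "m \<ge> 2" "binary j = binary (m div 2)" "d = m mod 2 + 1"
            using that by simp_all
          from binary_eq_imp[OF m(2)] m(1,3) show "j \<noteq> 0 \<and> d \<in> {1, 2}" by auto
        next
          assume d: "j \<noteq> 0 \<and> d \<in> {1, 2}"
          then have "x @ [d] = binary (2 * j + d - 1)"
            unfolding binary_snoc[OF x] using that by auto
          then show "\<exists>m. x @ [d] = binary m" by blast
        qed
      qed
      have "x @ [d] \<noteq> binary 0" if "x \<noteq> []" for x
        using that by (simp add: binary_snoc)
      with bin[OF n(2)] bin[OF n(4)] z False inf R show ?thesis
        by (simp add: num_class_def)
    qed
  next
    case False
    then have "\<not> (\<exists>n \<in> R. es = binary n)" using eq num_class_cases(2)[of R] by metis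
    with False snoc half show ?thesis by (auto simp: num_class_def)
  qed
qed

lemma class_step: "class_step R (num_class R ds) d = num_class R (ds @ [d])"
  unfolding class_step_def
  by (rule num_class_snoc_cong) (rule someI[of "\<lambda>es. num_class R es = num_class R ds"], rule refl)

text \<open>The class is written on stack 3 as a tape symbol, and a machine has only finitely many
  of these.\<close>

lemma ex_num_class_bound: "\<exists>B. \<forall>ds. num_class R ds < B"
proof (cases "finite R")
  case True
  then obtain m where m: "R = {..<m}" using R by auto
  have "num_class R ds < m + 5" for ds
    by (auto simp: num_class_def m)
  then show ?thesis by blast
next
  case False
  then have "num_class R ds < 6" for ds
    by (auto simp: num_class_def)
  then show ?thesis by blast
qed

lemma wp_parse_number:
  assumes "no_digit_first r" "set ds \<subseteq> {1, 2}" "length ds \<le> N" "length A \<le> 1"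
  shows "wp N (parse_number R) Q ((ds @ r) # u # p # A # [] # t # zs) \<longleftrightarrow>
    Q (r # u # p # [num_class R ds] # flag (\<exists>n \<in> R. ds = binary n) # (rev ds @ t) # zs)"
proof -
  let ?c = "Put 3 (\<lambda>t. class_step R (t ! 3) (t ! 0)) ;; shift 0 5"
  have "loop N (Suc m) (\<lambda>t. t ! 0 = 1 \<or> t ! 0 = 2) ?c Q ((ds @ r) # u # p # [num_class R es] # [] # t # zs)"
    if "Q (r # u # p # [num_class R (es @ ds)] # [] # (rev ds @ t) # zs)" "set ds \<subseteq> {1, 2}" "length ds \<le> m"
    for ds es t m Q
    using that
  proof (induction ds arbitrary: es t m)
    case Nil
    then show ?case using no_digit_peek[OF assms(1)] by (simp add: loop_Suc)
  next
    case (Cons c ds)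
    then obtain m' where m: "m = Suc m'" by (cases m) auto
    with Cons show ?case
      by (auto simp: loop_Suc[of _ "Suc m'"] wp_macros class_step)
  qed
  note * = this[of _ "[]", simplified]
  have "tl A = []" using assms(4) by (cases A) auto
  moreover have "num_class R [] = 1" by (simp add: num_class_def)
  ultimately have "wp N (parse_number R) (\<lambda>x. x =
      r # u # p # [num_class R ds] # flag (\<exists>n \<in> R. ds = binary n) # (rev ds @ t) # zs)
      ((ds @ r) # u # p # A # [] # t # zs)"
    unfolding parse_number_def wp.simps(5) wp_While
    using assms *[of _ ds t N] num_class_cases(2)[of R ds]
    by (auto simp: flag_def wp_While)
  then show ?thesis by (rule wp_eqI)
qed

end

section \<open>The grammar behind the parser\<close>

definition language :: "bool \<Rightarrow> 'p set \<Rightarrow> 'i set \<Rightarrow> ('p, 'i) form set" where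
  "language full Atm Agt = {\<phi>. form_over Atm Agt \<phi> \<and> (full \<or> only_moves \<phi>)}"

definition programs :: "bool \<Rightarrow> 'p set \<Rightarrow> 'i set \<Rightarrow> ('p, 'i) prog set" where
  "programs full Atm Agt =
     {\<alpha>. prog_over Atm Agt \<alpha> \<and> (full \<or> \<alpha> \<in> {GoUp, GoDown, GoRight, GoLeft})}"

context
  fixes full :: bool and Atm :: "'p set" and Agt :: "'i set" and a :: "'p \<Rightarrow> nat" and g :: "'i \<Rightarrow> nat"
begin

text \<open>The language expected by the parser when its stack holds these kinds. As long as no
  error is flagged, the rest of the input belongs to it exactly if the whole input is well
  formed.\<close>

primrec words :: "nat list \<Rightarrow> word set" where
  "words [] = {[]}"
| "words (k # ks) =
     (if k = 1 then (\<Union>\<phi> \<in> language full Atm Agt. (@) (form_word a g \<phi>) ` words ks)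
      else (\<Union>\<alpha> \<in> programs full Atm Agt. (@) (prog_word a g \<alpha>) ` words ks))"

lemma words_form_iff: "w \<in> words (1 # ks) \<longleftrightarrow>
    (\<exists>\<phi> r. form_over Atm Agt \<phi> \<and> (full \<or> only_moves \<phi>) \<and> r \<in> words ks \<and> w = form_word a g \<phi> @ r)"
  by (auto simp: language_def)

lemma words_prog_iff: "w \<in> words (2 # ks) \<longleftrightarrow>
    (\<exists>\<alpha> r. prog_over Atm Agt \<alpha> \<and> (full \<or> \<alpha> \<in> {GoUp, GoDown, GoRight, GoLeft}) \<and>
      r \<in> words ks \<and> w = prog_word a g \<alpha> @ r)"
  by (auto simp: programs_def)

declare words.simps(2) [simp del]

lemma words_formI:
  "form_over Atm Agt \<phi> \<Longrightarrow> full \<or> only_moves \<phi> \<Longrightarrow> r \<in> words ks \<Longrightarrow> form_word a g \<phi> @ r \<in> words (1 # ks)"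
  unfolding words_form_iff by blast

lemma words_progI:
  "prog_over Atm Agt \<alpha> \<Longrightarrow> full \<or> \<alpha> \<in> {GoUp, GoDown, GoRight, GoLeft} \<Longrightarrow> r \<in> words ks \<Longrightarrow>
    prog_word a g \<alpha> @ r \<in> words (2 # ks)"
  unfolding words_prog_iff by blast

lemma words_no_digit: "set ks \<subseteq> {1, 2} \<Longrightarrow> w \<in> words ks \<Longrightarrow> no_digit_first w"
proof (cases ks)
  case (Cons k ks')
  assume "set ks \<subseteq> {1, 2}" "w \<in> words ks"
  with Cons consider "w \<in> words (1 # ks')" | "w \<in> words (2 # ks')" by auto
  then show ?thesis
    by cases (unfold words_form_iff words_prog_iff, (elim exE conjE, simp only: no_digit_first_simps)+)
qed simp

text \<open>No formula or program begins with a digit, so the maximal block of digits must be the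
  whole number.\<close>

lemma words_number:
  assumes "set ks \<subseteq> {1, 2}" "no_digit_first r" "set ds \<subseteq> {1, 2}"
  shows "(\<exists>n \<in> R. \<exists>r' \<in> words ks. ds @ r = binary n @ r') \<longleftrightarrow> (\<exists>n \<in> R. ds = binary n) \<and> r \<in> words ks"
proof -
  have tw: "takeWhile (\<lambda>x. x \<in> {1, 2}) (es @ q) = es" if "no_digit_first q" "set es \<subseteq> {1, 2}" for es q
    using that by (cases q) (auto simp: no_digit_first_def takeWhile_append)
  have "ds = binary n \<and> r = r'" if "ds @ r = binary n @ r'" "r' \<in> words ks" for n r'
    using tw[OF assms(2,3)] tw[OF words_no_digit[OF assms(1) that(2)] binary_digits[of n]] that(1)
    by auto
  then show ?thesis by blast
qed

text \<open>In prefix notation the first symbol fixes the constructor, so membership passes to the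
  remaining word with an updated list of expected kinds. Each equation justifies one branch of
  \<open>parse_body\<close>.\<close>

lemma words_form_step:
  "[] \<notin> words (1 # ks)"
  "3 # w \<in> words (1 # ks) \<longleftrightarrow> (\<exists>n \<in> a ` Atm. \<exists>r \<in> words ks. w = binary n @ r)"
  "4 # w \<in> words (1 # ks) \<longleftrightarrow> (\<exists>n \<in> g ` Agt. \<exists>r \<in> words ks. w = binary n @ r)"
  "5 # w \<in> words (1 # ks) \<longleftrightarrow> w \<in> words (1 # ks)"
  "6 # w \<in> words (1 # ks) \<longleftrightarrow> w \<in> words (1 # 1 # ks)"
  "7 # w \<in> words (1 # ks) \<longleftrightarrow> w \<in> words (2 # 1 # ks)"
  "c \<notin> {3..7} \<Longrightarrow> c # w \<notin> words (1 # ks)"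
proof -
  show "[] \<notin> words (1 # ks)"
  proof
    assume "[] \<in> words (1 # ks)"
    then obtain \<phi> where "form_word a g \<phi> = []" unfolding words_form_iff by auto
    then show False by (cases \<phi>) auto
  qed
  have inv: "\<exists>\<phi> r. form_over Atm Agt \<phi> \<and> (full \<or> only_moves \<phi>) \<and> r \<in> words ks \<and> c # w = form_word a g \<phi> @ r"
    if "c # w \<in> words (1 # ks)" for c
    using that unfolding words_form_iff .
  note intro = words_formI[of _ _ ks]
  show "3 # w \<in> words (1 # ks) \<longleftrightarrow> (\<exists>n \<in> a ` Atm. \<exists>r \<in> words ks. w = binary n @ r)"
  proof
    assume "3 # w \<in> words (1 # ks)"
    from inv[OF this] obtain \<phi> r where "form_over Atm Agt \<phi>" "r \<in> words ks" "3 # w = form_word a g \<phi> @ r"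
      by blast
    then show "\<exists>n \<in> a ` Atm. \<exists>r \<in> words ks. w = binary n @ r"
      by (cases \<phi>) auto
  qed (use intro[of "Atom _"] in auto)
  show "4 # w \<in> words (1 # ks) \<longleftrightarrow> (\<exists>n \<in> g ` Agt. \<exists>r \<in> words ks. w = binary n @ r)"
  proof
    assume "4 # w \<in> words (1 # ks)"
    from inv[OF this] obtain \<phi> r where "form_over Atm Agt \<phi>" "r \<in> words ks" "4 # w = form_word a g \<phi> @ r"
      by blast
    then show "\<exists>n \<in> g ` Agt. \<exists>r \<in> words ks. w = binary n @ r"
      by (cases \<phi>) auto
  qed (use intro[of "Here _"] in auto)
  show "5 # w \<in> words (1 # ks) \<longleftrightarrow> w \<in> words (1 # ks)"
  proof
    assume "5 # w \<in> words (1 # ks)"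
    from inv[OF this] obtain \<phi> r where "form_over Atm Agt \<phi>" "full \<or> only_moves \<phi>" "r \<in> words ks"
      "5 # w = form_word a g \<phi> @ r"
      by blast
    then show "w \<in> words (1 # ks)"
      by (cases \<phi>) (auto intro!: words_formI[simplified])
  next
    assume "w \<in> words (1 # ks)"
    then obtain \<phi> r where "form_over Atm Agt \<phi>" "full \<or> only_moves \<phi>" "r \<in> words ks"
      "w = form_word a g \<phi> @ r"
      unfolding words_form_iff by blast
    then show "5 # w \<in> words (1 # ks)"
      using intro[of "Neg \<phi>" r] by auto
  qed
  show "6 # w \<in> words (1 # ks) \<longleftrightarrow> w \<in> words (1 # 1 # ks)"
  proof
    assume "6 # w \<in> words (1 # ks)"
    from inv[OF this] obtain \<phi> r where "form_over Atm Agt \<phi>" "full \<or> only_moves \<phi>" "r \<in> words ks"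
      "6 # w = form_word a g \<phi> @ r"
      by blast
    then show "w \<in> words (1 # 1 # ks)"
      by (cases \<phi>) (auto intro!: words_formI[simplified])
  next
    assume "w \<in> words (1 # 1 # ks)"
    then obtain \<phi> \<psi> r where "form_over Atm Agt \<phi>" "full \<or> only_moves \<phi>"
      "form_over Atm Agt \<psi>" "full \<or> only_moves \<psi>" "r \<in> words ks" "w = form_word a g \<phi> @ form_word a g \<psi> @ r"
      unfolding words_form_iff by blast
    then show "6 # w \<in> words (1 # ks)"
      using intro[of "Conj \<phi> \<psi>" r] by auto
  qed
  show "7 # w \<in> words (1 # ks) \<longleftrightarrow> w \<in> words (2 # 1 # ks)"
  proof
    assume "7 # w \<in> words (1 # ks)"
    from inv[OF this] obtain \<phi> r where "form_over Atm Agt \<phi>" "full \<or> only_moves \<phi>" "r \<in> words ks"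
      "7 # w = form_word a g \<phi> @ r"
      by blast
    then show "w \<in> words (2 # 1 # ks)"
      by (cases \<phi>) (auto intro!: words_formI[simplified] words_progI[simplified])
  next
    assume "w \<in> words (2 # 1 # ks)"
    then obtain \<alpha> \<phi> r where "prog_over Atm Agt \<alpha>" "full \<or> \<alpha> \<in> {GoUp, GoDown, GoRight, GoLeft}"
      "form_over Atm Agt \<phi>" "full \<or> only_moves \<phi>" "r \<in> words ks" "w = prog_word a g \<alpha> @ form_word a g \<phi> @ r"
      unfolding words_prog_iff words_form_iff by blast
    then show "7 # w \<in> words (1 # ks)"
      using intro[of "Box \<alpha> \<phi>" r] by auto
  qed
  show "c # w \<notin> words (1 # ks)" if "c \<notin> {3..7}"
  proof
    assume "c # w \<in> words (1 # ks)"
    from inv[OF this] obtain \<phi> r where "c # w = form_word a g \<phi> @ r"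
      by blast
    with that show False by (cases \<phi>) auto
  qed
qed

lemma words_prog_step:
  "[] \<notin> words (2 # ks)"
  "c \<in> {8..11} \<Longrightarrow> c # w \<in> words (2 # ks) \<longleftrightarrow> w \<in> words ks"
  "c \<in> {12, 13} \<Longrightarrow> c # w \<in> words (2 # ks) \<longleftrightarrow> full \<and> w \<in> words (2 # 2 # ks)"
  "14 # w \<in> words (2 # ks) \<longleftrightarrow> full \<and> w \<in> words (1 # ks)"
  "c \<notin> {8..14} \<Longrightarrow> c # w \<notin> words (2 # ks)"
proof -
  have inv: "\<exists>\<alpha> r. prog_over Atm Agt \<alpha> \<and> (full \<or> \<alpha> \<in> {GoUp, GoDown, GoRight, GoLeft}) \<and>
      r \<in> words ks \<and> w = prog_word a g \<alpha> @ r"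
    if "w \<in> words (2 # ks)" for w
    using that by (simp only: words_prog_iff)
  note intro = words_progI[of _ _ ks]
  show "[] \<notin> words (2 # ks)"
  proof
    assume "[] \<in> words (2 # ks)"
    from inv[OF this] obtain \<alpha> where "prog_word a g \<alpha> = []" by auto
    then show False by (cases \<alpha>) auto
  qed
  show "c # w \<in> words (2 # ks) \<longleftrightarrow> w \<in> words ks" if "c \<in> {8..11}"
  proof
    assume "c # w \<in> words (2 # ks)"
    from inv[OF this] obtain \<alpha> r where "r \<in> words ks" "c # w = prog_word a g \<alpha> @ r"
      by blast
    with that show "w \<in> words ks" by (cases \<alpha>) auto
  next
    assume w: "w \<in> words ks"
    from that have "c = 8 \<or> c = 9 \<or> c = 10 \<or> c = 11" by auto
    then show "c # w \<in> words (2 # ks)"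
      using intro[of GoUp w] intro[of GoDown w] intro[of GoRight w] intro[of GoLeft w] w by auto
  qed
  show "c # w \<in> words (2 # ks) \<longleftrightarrow> full \<and> w \<in> words (2 # 2 # ks)" if "c \<in> {12, 13}"
  proof
    assume "c # w \<in> words (2 # ks)"
    from inv[OF this] obtain \<alpha> r where "prog_over Atm Agt \<alpha>" "full \<or> \<alpha> \<in> {GoUp, GoDown, GoRight, GoLeft}"
      "r \<in> words ks" "c # w = prog_word a g \<alpha> @ r"
      by blast
    moreover from calculation have "prog_word a g \<beta> @ prog_word a g \<gamma> @ r \<in> words (2 # 2 # ks)"
      if "\<alpha> = Seq \<beta> \<gamma> \<or> \<alpha> = Choice \<beta> \<gamma>" for \<beta> \<gamma>
      using that by (intro words_progI) auto
    ultimately show "full \<and> w \<in> words (2 # 2 # ks)"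
      using that by (cases \<alpha>) auto
  next
    assume "full \<and> w \<in> words (2 # 2 # ks)"
    then obtain \<alpha> \<beta> r where "full" "prog_over Atm Agt \<alpha>" "prog_over Atm Agt \<beta>"
      "r \<in> words ks" "w = prog_word a g \<alpha> @ prog_word a g \<beta> @ r"
      unfolding words_prog_iff by blast
    with that show "c # w \<in> words (2 # ks)"
      using intro[of "Seq \<alpha> \<beta>" r] intro[of "Choice \<alpha> \<beta>" r] by auto
  qed
  show "14 # w \<in> words (2 # ks) \<longleftrightarrow> full \<and> w \<in> words (1 # ks)"
  proof
    assume "14 # w \<in> words (2 # ks)"
    from inv[OF this] obtain \<alpha> r where "prog_over Atm Agt \<alpha>" "full \<or> \<alpha> \<in> {GoUp, GoDown, GoRight, GoLeft}"
      "r \<in> words ks" "14 # w = prog_word a g \<alpha> @ r"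
      by blast
    moreover from calculation have "form_word a g \<phi> @ r \<in> words (1 # ks)" if "\<alpha> = Test \<phi>" for \<phi>
      using that by (intro words_formI) auto
    ultimately show "full \<and> w \<in> words (1 # ks)"
      by (cases \<alpha>) auto
  next
    assume "full \<and> w \<in> words (1 # ks)"
    then obtain \<phi> r where "full" "form_over Atm Agt \<phi>" "r \<in> words ks" "w = form_word a g \<phi> @ r"
      unfolding words_form_iff by blast
    then show "14 # w \<in> words (2 # ks)"
      using intro[of "Test \<phi>" r] by auto
  qed
  show "c # w \<notin> words (2 # ks)" if "c \<notin> {8..14}"
  proof
    assume "c # w \<in> words (2 # ks)"
    from inv[OF this] obtain \<alpha> r where "c # w = prog_word a g \<alpha> @ r"
      by blast
    with that show False by (cases \<alpha>) auto
  qed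
qed

end

definition parse_body :: "bool \<Rightarrow> nat set \<Rightarrow> nat set \<Rightarrow> com" where
  "parse_body full RA RG =
     Cond (\<lambda>t. t ! 2 = 1)
       (Cond (\<lambda>t. t ! 0 = 3) (Pop 2 ;; shift 0 5 ;; parse_number RA)
       (Cond (\<lambda>t. t ! 0 = 4) (Pop 2 ;; shift 0 5 ;; parse_number RG)
       (Cond (\<lambda>t. t ! 0 = 5) (shift 0 5)
       (Cond (\<lambda>t. t ! 0 = 6) (shift 0 5 ;; put_sym 2 (\<lambda>_. 1))
       (Cond (\<lambda>t. t ! 0 = 7) (shift 0 5 ;; put_sym 2 (\<lambda>_. 2)) (Put 4 (\<lambda>_. 1)))))))
       (Cond (\<lambda>t. t ! 0 \<in> {8..11}) (shift 0 5 ;; Pop 2)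
       (Cond (\<lambda>t. full \<and> t ! 0 \<in> {12, 13}) (shift 0 5 ;; put_sym 2 (\<lambda>_. 2))
       (Cond (\<lambda>t. full \<and> t ! 0 = 14) (shift 0 5 ;; Put 2 (\<lambda>_. 1)) (Put 4 (\<lambda>_. 1)))))"

definition parse :: "bool \<Rightarrow> nat set \<Rightarrow> nat set \<Rightarrow> com" where
  "parse full RA RG = (put_sym 2 (\<lambda>_. 1) ;;
     While (\<lambda>t. t ! 2 \<noteq> 0 \<and> t ! 4 = 0) (parse_body full RA RG) ;;
     Cond (\<lambda>t. t ! 0 \<noteq> 0) (Put 4 (\<lambda>_. 1)) Skip)"

context
  fixes full :: bool and Atm :: "'p set" and Agt :: "'i set" and a :: "'p \<Rightarrow> nat" and g :: "'i \<Rightarrow> nat"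
  assumes RA: "a ` Atm = UNIV \<or> (\<exists>m. a ` Atm = {..<m})"
    and RG: "g ` Agt = UNIV \<or> (\<exists>m. g ` Agt = {..<m})"
begin

abbreviation "pwords \<equiv> words full Atm Agt a g"

definition parse_post :: "word \<Rightarrow> nat list \<Rightarrow> word \<Rightarrow> word \<Rightarrow> state \<Rightarrow> state \<Rightarrow> bool" where
  "parse_post w p t u zs s \<longleftrightarrow> (\<exists>w' p' A fl t'. s = w' # u # p' # A # fl # t' # zs \<and>
     set p' \<subseteq> {1, 2} \<and> length A \<le> 1 \<and>
     (fl = [] \<and> length w' < length w \<and> (w \<in> pwords p \<longleftrightarrow> w' \<in> pwords p') \<and> rev t' @ w' = rev t @ w \<or>
      fl = [1] \<and> w \<notin> pwords p \<and> length w' \<le> length w))"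

lemma parse_postI:
  assumes "set p' \<subseteq> {1, 2}" "length A \<le> 1"
  shows "length w' < length w \<Longrightarrow> w \<in> pwords p \<longleftrightarrow> w' \<in> pwords p' \<Longrightarrow> rev t' @ w' = rev t @ w \<Longrightarrow>
      parse_post w p t u zs (w' # u # p' # A # [] # t' # zs)"
    and "w \<notin> pwords p \<Longrightarrow> length w' \<le> length w \<Longrightarrow> parse_post w p t u zs (w' # u # p' # A # [1] # t' # zs)"
  using assms unfolding parse_post_def by blast+

lemma wp_parse_number_post:
  assumes R: "R = UNIV \<or> (\<exists>m. R = {..<m})" and p: "set p \<subseteq> {1, 2}"
    and iff: "c # w \<in> pwords (1 # p) \<longleftrightarrow> (\<exists>n \<in> R. \<exists>r \<in> pwords p. w = binary n @ r)"
    and N: "length w \<le> N" and A: "length A \<le> 1"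
  shows "wp N (parse_number R) (parse_post (c # w) (1 # p) t u zs) (w # u # p # A # [] # (c # t) # zs)"
proof -
  define ds where "ds = takeWhile (\<lambda>x. x \<in> {1, 2}) w"
  define r where "r = dropWhile (\<lambda>x. x \<in> {1, 2}) w"
  have w: "w = ds @ r" by (simp add: ds_def r_def)
  have ds: "set ds \<subseteq> {1, 2}" by (auto simp: ds_def dest: set_takeWhileD)
  have r: "no_digit_first r"
    using hd_dropWhile[of "\<lambda>x. x \<in> {1, 2}" w] by (auto simp: no_digit_first_def r_def)
  have mem: "c # w \<in> pwords (1 # p) \<longleftrightarrow> (\<exists>n \<in> R. ds = binary n) \<and> r \<in> pwords p"
    using iff unfolding w words_number[OF p r ds] .
  show ?thesis
    unfolding w wp_parse_number[OF R r ds order.trans[OF _ N, of "length ds", unfolded w, simplified] A]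
  proof (cases "\<exists>n \<in> R. ds = binary n")
    case True
    then show "parse_post (c # ds @ r) (1 # p) t u zs
      (r # u # p # [num_class R ds] # flag (\<exists>n \<in> R. ds = binary n) # (rev ds @ c # t) # zs)"
      using parse_postI(1)[OF p, of "[num_class R ds]" r "c # w" "1 # p"] mem w by (auto simp: flag_def)
  next
    case False
    then show "parse_post (c # ds @ r) (1 # p) t u zs
      (r # u # p # [num_class R ds] # flag (\<exists>n \<in> R. ds = binary n) # (rev ds @ c # t) # zs)"
      using parse_postI(2)[OF p, of "[num_class R ds]" "c # w" "1 # p"] mem w by (auto simp: flag_def)
  qed
qed

lemma wp_parse_body:
  assumes "set (k # p) \<subseteq> {1, 2}" "length A \<le> 1" "length w \<le> N"
  shows "wp N (parse_body full (a ` Atm) (g ` Agt)) (parse_post w (k # p) t u zs)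
    (w # u # (k # p) # A # [] # t # zs)"
proof (cases w)
  case Nil
  have "[] \<notin> pwords (k # p)"
    using assms(1) words_form_step(1)[of full Atm Agt a g p] words_prog_step(1)[of full Atm Agt a g p]
    by auto
  with Nil assms show ?thesis
    by (auto simp: parse_body_def intro!: parse_postI[simplified])
next
  case (Cons c v)
  have fail: "parse_post w (k # p) t u zs (w # u # (k # p) # A # [1] # t # zs)" if "w \<notin> pwords (k # p)"
    using that assms by (intro parse_postI(2)) auto
  have p: "set p \<subseteq> {1, 2}" using assms(1) by simp
  consider "k = 1" | "k = 2" using assms(1) by auto
  then show ?thesis
  proof cases
    case 1
    consider "c = 3" | "c = 4" | "c = 5" | "c = 6" | "c = 7" | "c \<notin> {3..7}" by fastforce
    then show ?thesis
    proof cases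
      case c: 1
      show ?thesis
        using wp_parse_number_post[OF RA p words_form_step(2), of v N A t u zs] assms
        by (simp add: 1 c Cons parse_body_def wp_macros)
    next
      case c: 2
      show ?thesis
        using wp_parse_number_post[OF RG p words_form_step(3), of v N A t u zs] assms
        by (simp add: 1 c Cons parse_body_def wp_macros)
    next
      case c: 3
      show ?thesis
        using parse_postI(1)[of "1 # p" A v "5 # v" "1 # p" "5 # t" t u zs] words_form_step(4)[of v full Atm Agt a g p] assms
        by (simp add: 1 c Cons parse_body_def wp_macros)
    next
      case c: 4
      show ?thesis
        using parse_postI(1)[of "1 # 1 # p" A v "6 # v" "1 # p" "6 # t" t u zs] words_form_step(5)[of v full Atm Agt a g p] assms
        by (simp add: 1 c Cons parse_body_def wp_macros)
    next
      case c: 5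
      show ?thesis
        using parse_postI(1)[of "2 # 1 # p" A v "7 # v" "1 # p" "7 # t" t u zs] words_form_step(6)[of v full Atm Agt a g p] assms
        by (simp add: 1 c Cons parse_body_def wp_macros)
    next
      case c: 6
      then have "w \<notin> pwords (k # p)" using words_form_step(7) 1 Cons by simp
      with fail c 1 Cons show ?thesis
        by (auto simp: parse_body_def)
    qed
  next
    case 2
    consider "c \<in> {8..11}" | "full" "c \<in> {12, 13}" | "full" "c = 14"
      | "c \<notin> {8..14}" | "\<not> full" "c \<notin> {8..11}" by fastforce
    then show ?thesis
    proof cases
      case c: 1
      show ?thesis
        using parse_postI(1)[of p A v "c # v" "2 # p" "c # t" t u zs]
          words_prog_step(2)[OF c, of v full Atm Agt a g p] assms c
        by (simp add: 2 Cons parse_body_def wp_macros)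
    next
      case c: 2
      show ?thesis
        using parse_postI(1)[of "2 # 2 # p" A v "c # v" "2 # p" "c # t" t u zs]
          words_prog_step(3)[OF c(2), of v full Atm Agt a g p] assms c
        by (auto simp: 2 Cons parse_body_def wp_macros)
    next
      case c: 3
      show ?thesis
        using parse_postI(1)[of "1 # p" A v "c # v" "2 # p" "c # t" t u zs]
          words_prog_step(4)[of v full Atm Agt a g p] assms c
        by (auto simp: 2 Cons parse_body_def wp_macros)
    next
      case c: 4
      then have "w \<notin> pwords (k # p)" using words_prog_step(5) 2 Cons by simp
      with fail c 2 Cons show ?thesis
        by (auto simp: parse_body_def)
    next
      case c: 5
      then have "w \<notin> pwords (k # p)"
        using words_prog_step(3)[of c v full Atm Agt a g p] words_prog_step(4)[of v full Atm Agt a g p]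
          words_prog_step(5)[of c v full Atm Agt a g p] 2 Cons by (cases "c \<in> {12, 13, 14}") auto
      with fail c 2 Cons show ?thesis
        by (auto simp: parse_body_def)
    qed
  qed
qed

theorem wp_parse:
  assumes "\<And>A. w \<in> pwords [1] \<Longrightarrow> length A \<le> 1 \<Longrightarrow> Q ([] # u # [] # A # [] # rev w # zs)"
    and "\<And>w' p A t. w \<notin> pwords [1] \<Longrightarrow> Q (w' # u # p # A # [1] # t # zs)"
    and "Suc (length w) \<le> N"
    and "0 \<notin> set w"
  shows "wp N (parse full (a ` Atm) (g ` Agt)) Q (w # u # [] # [] # [] # [] # zs)"
proof -
  let ?b = "\<lambda>t::nat list. t ! 2 \<noteq> 0 \<and> t ! 4 = 0"
  let ?Q = "wp N (Cond (\<lambda>t. t ! 0 \<noteq> 0) (Put 4 (\<lambda>_. 1)) Skip) Q"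
  define I where "I s \<longleftrightarrow> (\<exists>w' p A fl t. s = w' # u # p # A # fl # t # zs \<and>
     set p \<subseteq> {1, 2} \<and> length A \<le> 1 \<and> length w' \<le> length w \<and>
     (fl = [] \<and> (w \<in> pwords [1] \<longleftrightarrow> w' \<in> pwords p) \<and> rev t @ w' = w \<or> fl = [1] \<and> w \<notin> pwords [1]))" for s
  have "loop N (Suc N) ?b (parse_body full (a ` Atm) (g ` Agt)) ?Q (w # u # [1] # [] # [] # [] # zs)"
  \<comment> \<open>The additional 1 makes the measure decrease also in an iteration that sets the
    error flag without reading anything.\<close>
  proof (rule loop_invariant[where I = I and m = "\<lambda>s. length (s ! 0) + (if s ! 4 = [] then 1 else 0)"])
    show "I (w # u # [1] # [] # [] # [] # zs)"
      by (auto simp: I_def)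
    show "length ((w # u # [1] # [] # [] # [] # zs) ! 0) +
        (if (w # u # [1] # [] # [] # [] # zs) ! 4 = [] then 1 else 0) < Suc N"
      using assms(3) by simp
  next
    fix s assume "I s" and b: "?b (map peek s)"
    then obtain w' p A fl t where s: "s = w' # u # p # A # fl # t # zs" "set p \<subseteq> {1, 2}"
      "length A \<le> 1" "length w' \<le> length w"
      "fl = [] \<and> (w \<in> pwords [1] \<longleftrightarrow> w' \<in> pwords p) \<and> rev t @ w' = w \<or> fl = [1] \<and> w \<notin> pwords [1]"
      unfolding I_def by blast
    with b have fl: "fl = []" "w \<in> pwords [1] \<longleftrightarrow> w' \<in> pwords p" "rev t @ w' = w" by auto
    from b s(1) obtain k p' where p: "p = k # p'" by (cases p) auto
    show "wp N (parse_body full (a ` Atm) (g ` Agt))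
        (\<lambda>s'. I s' \<and> length (s' ! 0) + (if s' ! 4 = [] then 1 else 0) < length (s ! 0) + (if s ! 4 = [] then 1 else 0)) s"
      unfolding s(1) fl(1) p
    proof (rule wp_mono[OF wp_parse_body])
      fix s' assume "parse_post w' (k # p') t u zs s'"
      then show "I s' \<and> length (s' ! 0) + (if s' ! 4 = [] then 1 else 0) <
          length ((w' # u # (k # p') # A # [] # t # zs) ! 0) +
          (if (w' # u # (k # p') # A # [] # t # zs) ! 4 = [] then 1 else 0)"
        using s(4) fl p unfolding parse_post_def I_def by auto
    qed (use s p assms(3) in auto)
  next
    fix s assume "I s" and b: "\<not> ?b (map peek s)"
    then obtain w' p A fl t where s: "s = w' # u # p # A # fl # t # zs" "set p \<subseteq> {1, 2}"
      "length A \<le> 1" "length w' \<le> length w"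
      "fl = [] \<and> (w \<in> pwords [1] \<longleftrightarrow> w' \<in> pwords p) \<and> rev t @ w' = w \<or> fl = [1] \<and> w \<notin> pwords [1]"
      unfolding I_def by blast
    show "?Q s"
    proof (cases "fl = []")
      case True
      with b s have p: "p = []" by (cases p) auto
      with True s(5) have *: "w \<in> pwords [1] \<longleftrightarrow> w' = []" "rev t @ w' = w" by auto
      show ?thesis
      proof (cases w')
        case Nil
        then have "t = rev w" using *(2) by auto
        with Nil * s True p assms(1) show ?thesis by simp
      next
        case (Cons c v)
        with * assms(4) have "c \<noteq> 0" by auto
        with Cons * s True assms(2) show ?thesis by simp
      qed
    next
      case False
      with s have "fl = [1]" "w \<notin> pwords [1]" by auto
      with s(1) assms(2) show ?thesis by simp
    qed
  qed
  then show ?thesis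
    by (simp add: parse_def wp_macros wp_While)
qed

end

section \<open>Eliminating composite programs\<close>

text \<open>\<open>elim_prog\<close> is applied to a body from which composite programs have already
  been eliminated. \<open>Choice\<close> duplicates it, so the result can be exponentially long;
  this is harmless since only decidability is claimed for the full language.\<close>

primrec elim_form :: "('p, 'i) form \<Rightarrow> ('p, 'i) form"
  and elim_prog :: "('p, 'i) prog \<Rightarrow> ('p, 'i) form \<Rightarrow> ('p, 'i) form" where
  "elim_form (Atom p) = Atom p"
| "elim_form (Here i) = Here i"
| "elim_form (Neg \<phi>) = Neg (elim_form \<phi>)"
| "elim_form (Conj \<phi> \<psi>) = Conj (elim_form \<phi>) (elim_form \<psi>)"
| "elim_form (Box \<alpha> \<phi>) = elim_prog \<alpha> (elim_form \<phi>)"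
| "elim_prog GoUp \<psi> = Box GoUp \<psi>"
| "elim_prog GoDown \<psi> = Box GoDown \<psi>"
| "elim_prog GoRight \<psi> = Box GoRight \<psi>"
| "elim_prog GoLeft \<psi> = Box GoLeft \<psi>"
| "elim_prog (Seq \<alpha> \<beta>) \<psi> = elim_prog \<alpha> (elim_prog \<beta> \<psi>)"
| "elim_prog (Choice \<alpha> \<beta>) \<psi> = Conj (elim_prog \<alpha> \<psi>) (elim_prog \<beta> \<psi>)"
| "elim_prog (Test \<phi>) \<psi> = Neg (Conj (elim_form \<phi>) (Neg \<psi>))"

lemma only_moves_elim:
  fixes \<phi> :: "('p, 'i) form" and \<alpha> :: "('p, 'i) prog"
  shows "only_moves (elim_form \<phi>)" "only_moves \<psi> \<Longrightarrow> only_moves (elim_prog \<alpha> \<psi>)"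
  by (induction \<phi> and \<alpha> arbitrary: and \<psi>) auto

lemma form_over_elim:
  fixes \<phi> :: "('p, 'i) form" and \<alpha> :: "('p, 'i) prog"
  shows "form_over Atm Agt \<phi> \<Longrightarrow> form_over Atm Agt (elim_form \<phi>)"
  "prog_over Atm Agt \<alpha> \<Longrightarrow> form_over Atm Agt \<psi> \<Longrightarrow> form_over Atm Agt (elim_prog \<alpha> \<psi>)"
  by (induction \<phi> and \<alpha> arbitrary: and \<psi>) auto

lemma sat_elim:
  "sat M (elim_form \<phi>) s \<longleftrightarrow> sat M \<phi> s"
  "sat M (elim_prog \<alpha> \<psi>) s \<longleftrightarrow> (\<forall>t. (s, t) \<in> rel M \<alpha> \<longrightarrow> sat M \<psi> t)"
proof (induction \<phi> and \<alpha> arbitrary: s and s \<psi>)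
  case (Seq \<alpha> \<beta>)
  show ?case unfolding elim_prog.simps rel.simps Seq.IH by blast
qed auto

text \<open>Moves the expression on top of stack 0 to stack \<open>k\<close>; stack 2 counts the missing
  subexpressions in unary.\<close>

definition split_off_body :: "nat \<Rightarrow> com" where
  "split_off_body k =
     (Cond (\<lambda>t. t ! 0 \<in> {6, 7, 12, 13}) (put_sym 2 (\<lambda>_. 1))
      (Cond (\<lambda>t. t ! 0 \<in> {3, 4, 8, 9, 10, 11}) (Pop 2) Skip) ;; shift 0 k)"

text \<open>The count can reach zero at the tag of a number, so the loop also runs while digits
  follow; the symbol behind the expression must not be a digit.\<close>

definition split_off :: "nat \<Rightarrow> com" where
  "split_off k = (put_sym 2 (\<lambda>_. 1) ;;
     While (\<lambda>t. t ! 2 \<noteq> 0 \<or> t ! 0 = 1 \<or> t ! 0 = 2) (split_off_body k))"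

text \<open>Like \<open>upd5\<close>, a normal form for updates at the variable index
  \<open>k\<close>.\<close>

definition upd3 :: "state \<Rightarrow> nat \<Rightarrow> nat list \<Rightarrow> nat list \<Rightarrow> nat list \<Rightarrow> state" where
  "upd3 s k w z c = s[0 := w, 2 := z, k := c]"

definition split_off_loop :: "nat \<Rightarrow> nat \<Rightarrow> nat \<Rightarrow> (state \<Rightarrow> bool) \<Rightarrow> state \<Rightarrow> bool" where
  "split_off_loop N n k = loop N n (\<lambda>t. t ! 2 \<noteq> 0 \<or> t ! 0 = 1 \<or> t ! 0 = 2) (split_off_body k)"

lemma upd3_simps:
  assumes "2 < k" "k < length s"
  shows "length (upd3 s k w z c) = length s" "upd3 s k w z c ! 0 = w" "upd3 s k w z c ! 2 = z"
    "upd3 s k w z c ! k = c" "(upd3 s k w z c)[0 := w'] = upd3 s k w' z c"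
    "(upd3 s k w z c)[2 := z'] = upd3 s k w z' c" "(upd3 s k w z c)[k := c'] = upd3 s k w z c'"
proof -
  have len: "0 < length s" "2 < length s" using assms by auto
  show "upd3 s k w z c ! 0 = w" "upd3 s k w z c ! 2 = z"
    using assms len by (simp_all add: upd3_def)
  show "(upd3 s k w z c)[0 := w'] = upd3 s k w' z c"
    unfolding upd3_def using assms len by (intro nth_equalityI) (auto simp: nth_list_update)
  show "(upd3 s k w z c)[2 := z'] = upd3 s k w z' c"
    unfolding upd3_def using assms len by (intro nth_equalityI) (auto simp: nth_list_update)
qed (use assms in \<open>simp_all add: upd3_def\<close>)

lemma split_off_step:
  assumes k: "2 < k" "k < length s" and c: "z \<noteq> [] \<or> c \<in> {1, 2}" "0 \<notin> set z"
    and "split_off_loop N n k Q (upd3 s k w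
      (if c \<in> {6, 7, 12, 13} then 1 # z else if c \<in> {3, 4, 8, 9, 10, 11} then tl z else z) (c # x))"
  shows "split_off_loop N (Suc n) k Q (upd3 s k (c # w) z x)"
proof -
  have "0 < length s" "2 < length s" "k \<noteq> 0" "0 \<noteq> k" "peek z \<noteq> 0 \<or> c \<in> {1, 2}"
    using k c by (cases z; auto)+
  then show ?thesis
    using assms(5) k unfolding split_off_loop_def
    by (auto simp: loop_Suc split_off_body_def wp_macros upd3_simps[OF k])
qed

lemma split_off_digits:
  assumes k: "2 < k" "k < length s" and z: "0 \<notin> set z"
  shows "set ds \<subseteq> {1, 2} \<Longrightarrow> split_off_loop N n k Q (upd3 s k r z (rev ds @ x)) \<Longrightarrow>
    split_off_loop N (length ds + n) k Q (upd3 s k (ds @ r) z x)"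
proof (induction ds arbitrary: x)
  case (Cons d ds)
  then show ?case
    using split_off_step[OF k _ z, of d N "length ds + n" Q "ds @ r" x] by auto
qed simp

text \<open>A binary constructor adds one missing expression, a leaf removes one and a unary
  constructor changes nothing, so the initial unit is used up by the last leaf of the
  expression.\<close>

lemma split_off_loop_word:
  assumes k: "2 < k" "k < length s"
  shows "0 \<notin> set z \<Longrightarrow> split_off_loop N n k Q (upd3 s k r z (rev (form_word a g \<phi>) @ x)) \<Longrightarrow>
      split_off_loop N (length (form_word a g \<phi>) + n) k Q (upd3 s k (form_word a g \<phi> @ r) (1 # z) x)"
    and "0 \<notin> set z \<Longrightarrow> split_off_loop N n k Q (upd3 s k r z (rev (prog_word a g \<alpha>) @ x)) \<Longrightarrow>
      split_off_loop N (length (prog_word a g \<alpha>) + n) k Q (upd3 s k (prog_word a g \<alpha> @ r) (1 # z) x)"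
proof (induction \<phi> and \<alpha> arbitrary: z n r x and z n r x)
  case (Atom p)
  then show ?case
    using split_off_step[OF k, of "1 # z" 3 N "length (binary (a p)) + n" Q "binary (a p) @ r" x]
      split_off_digits[OF k Atom.prems(1) binary_digits, of N n Q r "a p" "3 # x"]
    by simp
next
  case (Here i)
  then show ?case
    using split_off_step[OF k, of "1 # z" 4 N "length (binary (g i)) + n" Q "binary (g i) @ r" x]
      split_off_digits[OF k Here.prems(1) binary_digits, of N n Q r "g i" "4 # x"]
    by simp
next
  case (Neg \<phi>)
  have "split_off_loop N (length (form_word a g \<phi>) + n) k Q (upd3 s k (form_word a g \<phi> @ r) (1 # z) (5 # x))"
    by (rule Neg.IH) (use Neg.prems in simp_all)
  then show ?case
    using split_off_step[OF k, of "1 # z" 5 N "length (form_word a g \<phi>) + n" Q "form_word a g \<phi> @ r" x] Neg.prems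
    by simp
next
  case (Conj \<phi> \<psi>)
  have "split_off_loop N (length (form_word a g \<psi>) + n) k Q
      (upd3 s k (form_word a g \<psi> @ r) (1 # z) (rev (form_word a g \<phi>) @ 6 # x))"
    by (rule Conj.IH(2)) (use Conj.prems in simp_all)
  then have "split_off_loop N (length (form_word a g \<phi>) + (length (form_word a g \<psi>) + n)) k Q
      (upd3 s k (form_word a g \<phi> @ form_word a g \<psi> @ r) (1 # 1 # z) (6 # x))"
    using Conj.prems by (intro Conj.IH(1)) auto
  then show ?case
    using split_off_step[OF k, of "1 # z" 6 N "length (form_word a g \<phi>) + (length (form_word a g \<psi>) + n)" Q
      "form_word a g \<phi> @ form_word a g \<psi> @ r" x] Conj.prems
    by (simp add: add.assoc)
next
  case (Box \<alpha> \<phi>)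
  have "split_off_loop N (length (form_word a g \<phi>) + n) k Q
      (upd3 s k (form_word a g \<phi> @ r) (1 # z) (rev (prog_word a g \<alpha>) @ 7 # x))"
    by (rule Box.IH(2)) (use Box.prems in simp_all)
  then have "split_off_loop N (length (prog_word a g \<alpha>) + (length (form_word a g \<phi>) + n)) k Q
      (upd3 s k (prog_word a g \<alpha> @ form_word a g \<phi> @ r) (1 # 1 # z) (7 # x))"
    using Box.prems by (intro Box.IH(1)) auto
  then show ?case
    using split_off_step[OF k, of "1 # z" 7 N "length (prog_word a g \<alpha>) + (length (form_word a g \<phi>) + n)" Q
      "prog_word a g \<alpha> @ form_word a g \<phi> @ r" x] Box.prems
    by (simp add: add.assoc)
next
  case (Seq \<alpha> \<beta>)
  have "split_off_loop N (length (prog_word a g \<beta>) + n) k Q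
      (upd3 s k (prog_word a g \<beta> @ r) (1 # z) (rev (prog_word a g \<alpha>) @ 12 # x))"
    by (rule Seq.IH(2)) (use Seq.prems in simp_all)
  then have "split_off_loop N (length (prog_word a g \<alpha>) + (length (prog_word a g \<beta>) + n)) k Q
      (upd3 s k (prog_word a g \<alpha> @ prog_word a g \<beta> @ r) (1 # 1 # z) (12 # x))"
    using Seq.prems by (intro Seq.IH(1)) auto
  then show ?case
    using split_off_step[OF k, of "1 # z" 12 N "length (prog_word a g \<alpha>) + (length (prog_word a g \<beta>) + n)" Q
      "prog_word a g \<alpha> @ prog_word a g \<beta> @ r" x] Seq.prems
    by (simp add: add.assoc)
next
  case (Choice \<alpha> \<beta>)
  have "split_off_loop N (length (prog_word a g \<beta>) + n) k Q
      (upd3 s k (prog_word a g \<beta> @ r) (1 # z) (rev (prog_word a g \<alpha>) @ 13 # x))"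
    by (rule Choice.IH(2)) (use Choice.prems in simp_all)
  then have "split_off_loop N (length (prog_word a g \<alpha>) + (length (prog_word a g \<beta>) + n)) k Q
      (upd3 s k (prog_word a g \<alpha> @ prog_word a g \<beta> @ r) (1 # 1 # z) (13 # x))"
    using Choice.prems by (intro Choice.IH(1)) auto
  then show ?case
    using split_off_step[OF k, of "1 # z" 13 N "length (prog_word a g \<alpha>) + (length (prog_word a g \<beta>) + n)" Q
      "prog_word a g \<alpha> @ prog_word a g \<beta> @ r" x] Choice.prems
    by (simp add: add.assoc)
next
  case (Test \<phi>)
  have "split_off_loop N (length (form_word a g \<phi>) + n) k Q (upd3 s k (form_word a g \<phi> @ r) (1 # z) (14 # x))"
    by (rule Test.IH) (use Test.prems in simp_all)
  then show ?case
    using split_off_step[OF k, of "1 # z" 14 N "length (form_word a g \<phi>) + n" Q "form_word a g \<phi> @ r" x] Test.prems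
    by simp
qed (use split_off_step[OF k] in auto)

lemma wp_split_off:
  assumes k: "2 < k" "k < length s" and s: "s ! 2 = []" "s ! 0 = v @ r" "length v \<le> N" "no_digit_first r"
    and v: "v = form_word a g \<phi> \<or> v = prog_word a g \<alpha>"
  shows "wp N (split_off k) Q s \<longleftrightarrow> Q (s[0 := r, k := rev v @ s ! k])"
proof -
  have len: "0 < length s" "2 < length s" using k by auto
  have s0: "s[2 := [1]] = upd3 s k (v @ r) [1] (s ! k)"
    using k s(2) len by (unfold upd3_def, intro nth_equalityI) (auto simp: nth_list_update)
  have s1: "s[0 := r, k := rev v @ s ! k] = upd3 s k r [] (rev v @ s ! k)"
    using k s(1) len by (unfold upd3_def, intro nth_equalityI) (auto simp: nth_list_update)
  have end_loop: "split_off_loop N 1 k (\<lambda>x. x = upd3 s k r [] (rev v @ s ! k)) (upd3 s k r [] (rev v @ s ! k))"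
    using no_digit_peek[OF s(4)] k len by (simp add: split_off_loop_def loop_Suc upd3_simps[OF k])
  have "split_off_loop N (length v + 1) k (\<lambda>x. x = upd3 s k r [] (rev v @ s ! k)) (upd3 s k (v @ r) [1] (s ! k))"
    using v split_off_loop_word[OF k, of "[]" N 1 _ r a g _ "s ! k"] end_loop by auto
  then have "split_off_loop N (Suc N) k (\<lambda>x. x = upd3 s k r [] (rev v @ s ! k)) (upd3 s k (v @ r) [1] (s ! k))"
    unfolding split_off_loop_def by (rule loop_mono_fuel) (use s(3) in simp)
  then have "wp N (split_off k) (\<lambda>x. x = s[0 := r, k := rev v @ s ! k]) s"
    unfolding split_off_def split_off_loop_def s1 using k s(1) s0
    by (simp add: wp_macros wp_While)
  then show ?thesis by (rule wp_eqI)
qed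

text \<open>Eliminates composite programs by rewriting the prefix of stack 0; finished symbols go to
  stack 1.\<close>

definition elim_body :: com where
  "elim_body = Cond (\<lambda>t. t ! 0 = 7)
     (Pop 0 ;;
      Cond (\<lambda>t. t ! 0 = 12)
        (Pop 0 ;; split_off 3 ;; put_sym 0 (\<lambda>_. 7) ;; move_stack 3 0 ;; put_sym 0 (\<lambda>_. 7))
      (Cond (\<lambda>t. t ! 0 = 13)
        (Pop 0 ;; split_off 3 ;; split_off 4 ;; split_off 5 ;;
         copy_back 5 0 6 ;; move_stack 4 0 ;; put_sym 0 (\<lambda>_. 7) ;;
         move_stack 6 5 ;; move_stack 5 0 ;; move_stack 3 0 ;; put_sym 0 (\<lambda>_. 7) ;; put_sym 0 (\<lambda>_. 6))
      (Cond (\<lambda>t. t ! 0 = 14)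
        (Pop 0 ;; split_off 3 ;; put_sym 0 (\<lambda>_. 5) ;; move_stack 3 0 ;;
         put_sym 0 (\<lambda>_. 6) ;; put_sym 0 (\<lambda>_. 5))
        (put_sym 1 (\<lambda>_. 7) ;; shift 0 1))))
     (shift 0 1)"

definition elim :: com where
  "elim = While (\<lambda>t. t ! 0 \<noteq> 0) elim_body"

definition elim_state :: "word \<Rightarrow> word \<Rightarrow> state \<Rightarrow> state" where
  "elim_state w b zs = w # b # [] # [] # [] # [] # [] # zs"

definition elim_loop :: "nat \<Rightarrow> nat \<Rightarrow> (state \<Rightarrow> bool) \<Rightarrow> state \<Rightarrow> bool" where
  "elim_loop N n = loop N n (\<lambda>t. t ! 0 \<noteq> 0) elim_body"

lemma elim_loop_step:
  "peek w \<noteq> 0 \<Longrightarrow> wp N elim_body (elim_loop N n Q) (elim_state w b zs) \<Longrightarrow>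
    elim_loop N (Suc n) Q (elim_state w b zs)"
  unfolding elim_loop_def by (simp add: loop_Suc elim_state_def)

lemma zero_notin_word [simp]: "0 \<notin> set (form_word a g \<phi>)" "0 \<notin> set (prog_word a g \<alpha>)"
  by (induction \<phi> and \<alpha>) auto

lemma wp_split_off_parts:
  assumes "length v \<le> N" "no_digit_first r" "v = form_word a g \<phi> \<or> v = prog_word a g \<alpha>"
  shows "wp N (split_off 3) Q ((v @ r) # b # [] # c # zs) \<longleftrightarrow> Q (r # b # [] # (rev v @ c) # zs)"
    "wp N (split_off 4) Q ((v @ r) # b # [] # c # d # zs) \<longleftrightarrow> Q (r # b # [] # c # (rev v @ d) # zs)"
    "wp N (split_off 5) Q ((v @ r) # b # [] # c # d # e # zs) \<longleftrightarrow> Q (r # b # [] # c # d # (rev v @ e) # zs)"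
  using assms by (subst wp_split_off[where v = v and r = r]; simp)+

text \<open>A rewritten formula is put back on stack 0 instead of the output, so that the programs
  in it are treated by later iterations.\<close>

lemma wp_elim_body:
  shows "c \<noteq> 7 \<Longrightarrow> wp N elim_body Q (elim_state (c # w) b zs) \<longleftrightarrow> Q (elim_state w (c # b) zs)"
    and "c \<in> {8..11} \<Longrightarrow> wp N elim_body Q (elim_state (7 # c # w) b zs) \<longleftrightarrow> Q (elim_state w (c # 7 # b) zs)"
    and "length (prog_word a g \<alpha>) \<le> N \<Longrightarrow>
      wp N elim_body Q (elim_state (form_word a g (Box (Seq \<alpha> \<beta>) \<phi>) @ r) b zs) \<longleftrightarrow>
      Q (elim_state (form_word a g (Box \<alpha> (Box \<beta> \<phi>)) @ r) b zs)"
    and "length (prog_word a g \<alpha>) \<le> N \<Longrightarrow> length (prog_word a g \<beta>) \<le> N \<Longrightarrow>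
      length (form_word a g \<phi>) \<le> N \<Longrightarrow> no_digit_first r \<Longrightarrow>
      wp N elim_body Q (elim_state (form_word a g (Box (Choice \<alpha> \<beta>) \<phi>) @ r) b zs) \<longleftrightarrow>
      Q (elim_state (form_word a g (Conj (Box \<alpha> \<phi>) (Box \<beta> \<phi>)) @ r) b zs)"
    and "length (form_word a g \<chi>) \<le> N \<Longrightarrow>
      wp N elim_body Q (elim_state (form_word a g (Box (Test \<chi>) \<phi>) @ r) b zs) \<longleftrightarrow>
      Q (elim_state (form_word a g (Neg (Conj \<chi> (Neg \<phi>))) @ r) b zs)"
proof goal_cases
  case 1
  then show ?case by (simp add: elim_body_def elim_state_def wp_macros)
next
  case 2
  then show ?case by (simp add: elim_body_def elim_state_def wp_macros)
next
  case 3
  then show ?case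
    by (simp add: elim_body_def elim_state_def wp_macros
      wp_split_off_parts[where g = g and a = a and v = "prog_word a g \<alpha>" and \<alpha> = \<alpha>])
next
  case 4
  then show ?case
    by (simp add: elim_body_def elim_state_def wp_macros
      wp_split_off_parts[where g = g and a = a and v = "prog_word a g \<alpha>" and \<alpha> = \<alpha>]
      wp_split_off_parts[where g = g and a = a and v = "prog_word a g \<beta>" and \<alpha> = \<beta>]
      wp_split_off_parts[where g = g and a = a and v = "form_word a g \<phi>" and \<phi> = \<phi>])
next
  case 5
  then show ?case
    by (simp add: elim_body_def elim_state_def wp_macros
      wp_split_off_parts[where g = g and a = a and v = "form_word a g \<chi>" and \<phi> = \<chi>])
qed

text \<open>Only the existence of a bound matters, so a single \<open>K\<close> bounds both the
  inner loops and the number of iterations. The quantified rest and output make the property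
  compositional.\<close>

definition eliminates :: "('p \<Rightarrow> nat) \<Rightarrow> ('i \<Rightarrow> nat) \<Rightarrow> ('p, 'i) form \<Rightarrow> ('p, 'i) form \<Rightarrow> bool" where
  "eliminates a g \<phi> \<psi> \<longleftrightarrow> (\<exists>K. \<forall>N \<ge> K. \<forall>n r b zs Q. no_digit_first r \<longrightarrow>
     elim_loop N n Q (elim_state r (rev (form_word a g \<psi>) @ b) zs) \<longrightarrow>
     elim_loop N (K + n) Q (elim_state (form_word a g \<phi> @ r) b zs))"

lemma elim_loop_digits:
  "set ds \<subseteq> {1, 2} \<Longrightarrow> elim_loop N n Q (elim_state r (rev ds @ b) zs) \<Longrightarrow>
    elim_loop N (length ds + n) Q (elim_state (ds @ r) b zs)"
proof (induction ds arbitrary: b)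
  case (Cons d ds)
  then have "elim_loop N (length ds + n) Q (elim_state (ds @ r) (d # b) zs)" by simp
  with Cons.prems show ?case
    by (auto intro!: elim_loop_step simp: wp_elim_body(1))
qed simp

lemma eliminates_leaf:
  assumes "form_word a g \<phi> = c # binary n" "c \<in> {3, 4}"
  shows "eliminates a g \<phi> \<phi>"
  unfolding eliminates_def
proof (intro exI[of _ "Suc (length (binary n))"] allI impI)
  fix N m r b zs Q
  assume "elim_loop N m Q (elim_state r (rev (form_word a g \<phi>) @ b) zs)"
  then have "elim_loop N (length (binary n) + m) Q (elim_state (binary n @ r) (c # b) zs)"
    using assms by (intro elim_loop_digits[OF binary_digits]) auto
  then show "elim_loop N (Suc (length (binary n)) + m) Q (elim_state (form_word a g \<phi> @ r) b zs)"
    using assms by (auto intro!: elim_loop_step simp: wp_elim_body(1))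
qed

lemma eliminates_Neg:
  assumes "eliminates a g \<phi> \<psi>"
  shows "eliminates a g (Neg \<phi>) (Neg \<psi>)"
proof -
  from assms obtain K where K: "\<And>N n r b zs Q. K \<le> N \<Longrightarrow> no_digit_first r \<Longrightarrow>
     elim_loop N n Q (elim_state r (rev (form_word a g \<psi>) @ b) zs) \<Longrightarrow>
     elim_loop N (K + n) Q (elim_state (form_word a g \<phi> @ r) b zs)"
    unfolding eliminates_def by blast
  show ?thesis
    unfolding eliminates_def
  proof (intro exI[of _ "Suc K"] allI impI)
    fix N n r b zs Q
    assume "Suc K \<le> N" "no_digit_first r" "elim_loop N n Q (elim_state r (rev (form_word a g (Neg \<psi>)) @ b) zs)"
    then have "elim_loop N (K + n) Q (elim_state (form_word a g \<phi> @ r) (5 # b) zs)"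
      by (intro K) auto
    then show "elim_loop N (Suc K + n) Q (elim_state (form_word a g (Neg \<phi>) @ r) b zs)"
      by (auto intro!: elim_loop_step simp: wp_elim_body(1))
  qed
qed

lemma eliminates_Conj:
  assumes "eliminates a g \<phi> \<phi>'" "eliminates a g \<psi> \<psi>'"
  shows "eliminates a g (Conj \<phi> \<psi>) (Conj \<phi>' \<psi>')"
proof -
  from assms(1) obtain K where K: "\<And>N n r b zs Q. K \<le> N \<Longrightarrow> no_digit_first r \<Longrightarrow>
     elim_loop N n Q (elim_state r (rev (form_word a g \<phi>') @ b) zs) \<Longrightarrow>
     elim_loop N (K + n) Q (elim_state (form_word a g \<phi> @ r) b zs)"
    unfolding eliminates_def by blast
  from assms(2) obtain L where L: "\<And>N n r b zs Q. L \<le> N \<Longrightarrow> no_digit_first r \<Longrightarrow>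
     elim_loop N n Q (elim_state r (rev (form_word a g \<psi>') @ b) zs) \<Longrightarrow>
     elim_loop N (L + n) Q (elim_state (form_word a g \<psi> @ r) b zs)"
    unfolding eliminates_def by blast
  show ?thesis
    unfolding eliminates_def
  proof (intro exI[of _ "Suc (K + L)"] allI impI)
    fix N n r b zs Q
    assume *: "Suc (K + L) \<le> N" "no_digit_first r"
      "elim_loop N n Q (elim_state r (rev (form_word a g (Conj \<phi>' \<psi>')) @ b) zs)"
    then have "elim_loop N (L + n) Q
        (elim_state (form_word a g \<psi> @ r) (rev (form_word a g \<phi>') @ 6 # b) zs)"
      by (intro L) auto
    then have "elim_loop N (K + (L + n)) Q (elim_state (form_word a g \<phi> @ form_word a g \<psi> @ r) (6 # b) zs)"
      using * by (intro K) auto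
    then show "elim_loop N (Suc (K + L) + n) Q (elim_state (form_word a g (Conj \<phi> \<psi>) @ r) b zs)"
      by (auto intro!: elim_loop_step simp: wp_elim_body(1) add.assoc)
  qed
qed

lemma eliminates_Box_move:
  assumes "eliminates a g \<phi> \<psi>" and \<alpha>: "\<alpha> \<in> {GoUp, GoDown, GoRight, GoLeft}"
  shows "eliminates a g (Box \<alpha> \<phi>) (Box \<alpha> \<psi>)"
proof -
  from assms obtain K where K: "\<And>N n r b zs Q. K \<le> N \<Longrightarrow> no_digit_first r \<Longrightarrow>
     elim_loop N n Q (elim_state r (rev (form_word a g \<psi>) @ b) zs) \<Longrightarrow>
     elim_loop N (K + n) Q (elim_state (form_word a g \<phi> @ r) b zs)"
    unfolding eliminates_def by blast
  note code = move_code(1,2)[OF \<alpha>]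
  show ?thesis
    unfolding eliminates_def
  proof (intro exI[of _ "Suc K"] allI impI)
    fix N n r b zs Q
    assume "Suc K \<le> N" "no_digit_first r" "elim_loop N n Q (elim_state r (rev (form_word a g (Box \<alpha> \<psi>)) @ b) zs)"
    then have "elim_loop N (K + n) Q (elim_state (form_word a g \<phi> @ r) (move_code \<alpha> # 7 # b) zs)"
      by (intro K) (auto simp: code(1))
    then show "elim_loop N (Suc K + n) Q (elim_state (form_word a g (Box \<alpha> \<phi>) @ r) b zs)"
      using code(2) by (auto intro!: elim_loop_step simp: code(1) wp_elim_body(2))
  qed
qed

lemma eliminates_rewrite:
  assumes "eliminates a g \<phi>' \<psi>" "peek (form_word a g \<phi>) \<noteq> 0" "form_word a g \<phi> \<noteq> []"
    and "\<And>N r b zs Q. L \<le> N \<Longrightarrow> no_digit_first r \<Longrightarrow> Q (elim_state (form_word a g \<phi>' @ r) b zs) \<Longrightarrow>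
      wp N elim_body Q (elim_state (form_word a g \<phi> @ r) b zs)"
  shows "eliminates a g \<phi> \<psi>"
proof -
  from assms(1) obtain K where K: "\<And>N n r b zs Q. K \<le> N \<Longrightarrow> no_digit_first r \<Longrightarrow>
     elim_loop N n Q (elim_state r (rev (form_word a g \<psi>) @ b) zs) \<Longrightarrow>
     elim_loop N (K + n) Q (elim_state (form_word a g \<phi>' @ r) b zs)"
    unfolding eliminates_def by blast
  have peek: "peek (form_word a g \<phi> @ r) \<noteq> 0" for r
    using assms(2,3) by (cases "form_word a g \<phi>") auto
  show ?thesis
    unfolding eliminates_def
  proof (intro exI[of _ "Suc (K + L)"] allI impI)
    fix N n r b zs Q
    assume *: "Suc (K + L) \<le> N" "no_digit_first r" "elim_loop N n Q (elim_state r (rev (form_word a g \<psi>) @ b) zs)"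
    then have "elim_loop N (K + n) Q (elim_state (form_word a g \<phi>' @ r) b zs)"
      by (intro K) auto
    with * have "wp N elim_body (elim_loop N (K + n) Q) (elim_state (form_word a g \<phi> @ r) b zs)"
      by (intro assms(4)) auto
    then have "elim_loop N (Suc (K + n)) Q (elim_state (form_word a g \<phi> @ r) b zs)"
      by (rule elim_loop_step[OF peek])
    then show "elim_loop N (Suc (K + L) + n) Q (elim_state (form_word a g \<phi> @ r) b zs)"
      unfolding elim_loop_def by (rule loop_mono_fuel) simp
  qed
qed

text \<open>The claim for programs assumes the elimination of an arbitrary body, because rewriting
  \<open>Seq \<alpha> \<beta>\<close> produces the new body
  \<open>Box \<beta> \<phi>'\<close>.\<close>

lemma eliminates_elim:
  fixes \<phi> :: "('p, 'i) form" and \<alpha> :: "('p, 'i) prog"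
  shows "eliminates a g \<phi> (elim_form \<phi>)"
    and "eliminates a g \<phi>' \<psi> \<Longrightarrow> eliminates a g (Box \<alpha> \<phi>') (elim_prog \<alpha> \<psi>)"
proof (induction \<phi> and \<alpha> arbitrary: and \<phi>' \<psi>)
  case (Seq \<alpha> \<beta>)
  show ?case
    unfolding elim_prog.simps
    by (rule eliminates_rewrite[OF Seq.IH(1)[OF Seq.IH(2)[OF Seq.prems]], where L = "length (prog_word a g \<alpha>)"])
      (simp_all only: wp_elim_body(3), simp_all)
next
  case (Choice \<alpha> \<beta>)
  show ?case
    unfolding elim_prog.simps
    by (rule eliminates_rewrite[OF eliminates_Conj[OF Choice.IH(1)[OF Choice.prems] Choice.IH(2)[OF Choice.prems]],
        where L = "length (prog_word a g \<alpha>) + length (prog_word a g \<beta>) + length (form_word a g \<phi>')"],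
        simp, simp, subst wp_elim_body(4)) auto
next
  case (Test \<chi>)
  show ?case
    unfolding elim_prog.simps
    by (rule eliminates_rewrite[OF eliminates_Neg[OF eliminates_Conj[OF Test.IH eliminates_Neg[OF Test.prems]]],
        where L = "length (form_word a g \<chi>)"])
      (simp_all only: wp_elim_body(5), simp_all)
qed (auto intro: eliminates_leaf eliminates_Neg eliminates_Conj eliminates_Box_move)

theorem wp_elim:
  obtains K where "\<And>N zs Q. K \<le> N \<Longrightarrow>
    wp N elim Q (elim_state (form_word a g \<phi>) [] zs) \<longleftrightarrow>
    Q (elim_state [] (rev (form_word a g (elim_form \<phi>))) zs)"
proof -
  obtain K where K: "\<And>N n r b zs Q. K \<le> N \<Longrightarrow> no_digit_first r \<Longrightarrow>
     elim_loop N n Q (elim_state r (rev (form_word a g (elim_form \<phi>)) @ b) zs) \<Longrightarrow>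
     elim_loop N (K + n) Q (elim_state (form_word a g \<phi> @ r) b zs)"
    using eliminates_elim(1)[of a g \<phi>] unfolding eliminates_def by blast
  show ?thesis
  proof (rule that)
    fix N :: nat and zs Q
    assume N: "K \<le> N"
    let ?s = "elim_state [] (rev (form_word a g (elim_form \<phi>))) zs"
    have "elim_loop N (K + 1) (\<lambda>x. x = ?s) (elim_state (form_word a g \<phi> @ []) [] zs)"
      by (rule K[OF N]) (auto simp: elim_loop_def loop_Suc elim_state_def)
    then have "elim_loop N (Suc N) (\<lambda>x. x = ?s) (elim_state (form_word a g \<phi>) [] zs)"
      unfolding elim_loop_def using N by (auto intro: loop_mono_fuel)
    then show "wp N elim Q (elim_state (form_word a g \<phi>) [] zs) \<longleftrightarrow> Q ?s"
      by (intro wp_eqI) (simp only: elim_def wp_While elim_loop_def)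
  qed
qed

section \<open>Searching all certificates\<close>

text \<open>The letters 1 and 2 act as the binary digits zero and one, so that enumerating the
  certificates of a fixed length amounts to counting.\<close>

fun certificate_value :: "word \<Rightarrow> nat" where
  "certificate_value [] = 0"
| "certificate_value (d # u) = d - 1 + 2 * certificate_value u"

lemma certificate_value_less: "u \<in> lists {1, 2} \<Longrightarrow> certificate_value u < 2 ^ length u"
  by (induction u) auto

lemma certificate_value_inject:
  "u \<in> lists {1, 2} \<Longrightarrow> v \<in> lists {1, 2} \<Longrightarrow> length u = length v \<Longrightarrow>
    certificate_value u = certificate_value v \<Longrightarrow> u = v"
proof (induction u arbitrary: v)
  case (Cons d u)
  then obtain e v' where v: "v = e # v'" by (cases v) auto
  have "d - 1 + 2 * certificate_value u = e - 1 + 2 * certificate_value v'"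
    using Cons.prems v by simp
  moreover have "d \<in> {1, 2}" "e \<in> {1, 2}" using Cons.prems v by auto
  ultimately have "d = e \<and> certificate_value u = certificate_value v'"
    by (elim insertE emptyE) (simp_all, presburger+)
  with Cons v show ?case by auto
qed simp

lemma certificate_value_replicate:
  "certificate_value (replicate k 1 @ u) = 2 ^ k * certificate_value u"
  "Suc (certificate_value (replicate k 2 @ u)) = 2 ^ k * Suc (certificate_value u)"
  by (induction k) auto

lemma leading_twos:
  "u \<in> lists {1, 2} \<Longrightarrow> (\<exists>k v. u = replicate k 2 @ 1 # v) \<or> (\<exists>k. u = replicate k (2::nat))"
proof (induction u)
  case (Cons d u)
  consider "d = 1" | "d = 2" using Cons.prems by auto
  then show ?case
  proof cases
    case 1
    then show ?thesis by (intro disjI1 exI[of _ 0]) auto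
  next
    case 2
    from Cons have "(\<exists>k v. u = replicate k 2 @ 1 # v) \<or> (\<exists>k. u = replicate k 2)" by auto
    then show ?thesis
    proof (elim disjE exE)
      fix k v assume "u = replicate k 2 @ 1 # v"
      with 2 have "d # u = replicate (Suc k) 2 @ 1 # v" by simp
      then show ?thesis by blast
    next
      fix k assume "u = replicate k (2::nat)"
      with 2 have "d # u = replicate (Suc k) 2" by simp
      then show ?thesis by blast
    qed
  qed
qed (auto intro: exI[of _ 0])

text \<open>That the unread part is a suffix bounds the loop by which \<open>trial\<close> clears
  it.\<close>

lemma literals_rest: "\<exists>k. snd (literals a g \<phi> \<sigma> s u) = drop k u"
proof (induction \<phi> arbitrary: \<sigma> s u rule: form_induct)
  case (Conj \<phi> \<psi>)
  obtain \<sigma>1 \<sigma>2 u0 where 0: "conj_signs \<sigma> u = (\<sigma>1, \<sigma>2, u0)"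
    by (cases "conj_signs \<sigma> u") auto
  then have "\<exists>k. u0 = drop k u"
    by (cases "(\<sigma>, u)" rule: conj_signs.cases)
      (auto simp: drop_Suc intro: exI[of _ 0] exI[of _ 1] split: if_splits)
  moreover obtain l1 u1 where 1: "literals a g \<phi> \<sigma>1 s u0 = (l1, u1)" by fastforce
  moreover obtain l2 u2 where 2: "literals a g \<psi> \<sigma>2 s u1 = (l2, u2)" by fastforce
  ultimately obtain i j k where "u0 = drop i u" "u1 = drop j u0" "u2 = drop k u1"
    using Conj.IH(1)[of \<sigma>1 s u0] Conj.IH(2)[of \<sigma>2 s u1] by auto
  then have "u2 = drop (k + (j + i)) u" by (simp add: add.commute)
  with 0 1 2 show ?case by auto
next
  case (Box \<alpha> \<phi>)
  then show ?case by simp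
qed (auto intro: exI[of _ 0])

text \<open>Stack 16 holds the formula, 17 the current certificate (least significant digit first), 18 is set
  when all certificates have been tried and 19 when one has been accepted.\<close>

definition search_state :: "word \<Rightarrow> word \<Rightarrow> word \<Rightarrow> nat list \<Rightarrow> nat list \<Rightarrow> state" where
  "search_state r w u d f = [[], r, [], [], [], [], [], [], [], [], [], [], [], [], [], [], w, u, d, f]"

text \<open>\<open>elim\<close> leaves its output reversed, so popping it restores the formula. Each
  symbol also contributes a 1 to the first certificate, which thereby gets the length of the
  formula.\<close>

definition fill :: com where
  "fill = While (\<lambda>t. t ! 1 \<noteq> 0) (put_sym 16 (\<lambda>t. t ! 1) ;; put_sym 17 (\<lambda>_. 1) ;; Pop 1)"

lemma wp_fill:
  assumes "0 \<notin> set w" "length w \<le> N"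
  shows "wp N fill Q (search_state (rev w) [] [] d f) \<longleftrightarrow>
    Q (search_state [] w (replicate (length w) 1) d f)"
proof -
  let ?c = "put_sym 16 (\<lambda>t. t ! 1) ;; put_sym 17 (\<lambda>_. 1) ;; Pop 1"
  have "loop N (Suc m) (\<lambda>t. t ! 1 \<noteq> 0) ?c Q (search_state r w u d f)"
    if "Q (search_state [] (rev r @ w) (replicate (length r) 1 @ u) d f)" "0 \<notin> set r" "length r \<le> m"
    for r w u m Q
    using that
  proof (induction r arbitrary: w u m)
    case Nil
    then show ?case by (simp add: loop_Suc search_state_def)
  next
    case (Cons c r)
    then obtain m' where m: "m = Suc m'" by (cases m) auto
    have "loop N (Suc m') (\<lambda>t. t ! 1 \<noteq> 0) ?c Q (search_state r (c # w) (1 # u) d f)"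
      by (rule Cons.IH) (use Cons.prems m in \<open>auto simp flip: replicate_append_same\<close>)
    with Cons.prems m show ?case
      by (simp add: loop_Suc[of _ "Suc m'"] wp_macros search_state_def)
  qed
  note * = this
  show ?thesis
    by (rule wp_eqI, unfold fill_def wp_While, rule *) (use assms in simp_all)
qed

definition trial :: com where
  "trial = (put_sym 2 (\<lambda>_. 1) ;; move_stack 16 9 ;; copy_back 9 16 0 ;; move_stack 17 9 ;; copy_back 9 17 1 ;;
     tableau ;;
     Cond (\<lambda>t. t ! 13 = 0) (Put 19 (\<lambda>_. 1)) Skip ;; Pop 13 ;; clear_stack 7 ;; clear_stack 1)"

definition accepted :: "('p \<Rightarrow> nat) \<Rightarrow> ('i \<Rightarrow> nat) \<Rightarrow> ('p, 'i) form \<Rightarrow> word \<Rightarrow> bool" where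
  "accepted a g \<phi> u \<longleftrightarrow> consistent (fst (literals a g \<phi> (Some True) (0, 0) u))"

lemma consistent_rev [simp]: "consistent (rev ls) \<longleftrightarrow> consistent ls"
  by (simp add: consistent_iff)

lemma tableau_state_start: "tableau_state w u [1] (0, 0) [] zs =
    w # u # [1] # [] # [] # [] # [] # [] # [] # [] # [] # [] # [] # [] # [] # zs"
  by (simp add: tableau_state_def unary_def)

lemma wp_trial:
  assumes "only_moves \<phi>" "w = form_word a g \<phi>" "length w * (3 * length w + 5) \<le> N"
    "u \<in> lists {1, 2}" "length u = length w" "length f \<le> 1"
  shows "wp N trial Q (search_state [] w u d f) \<longleftrightarrow>
    Q (search_state [] w u d (if accepted a g \<phi> u then [1] else f))"
proof -
  obtain new u' where lit: "literals a g \<phi> (Some True) (0, 0) u = (new, u')" by fastforce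
  have z: "0 \<notin> set w" "0 \<notin> set u" using assms(2,4) by auto
  have bnd: "(\<forall>l \<in> set new. literal_ok (length w) l) \<and> length new \<le> length w"
    unfolding assms(2) by (rule literals_bounds[OF assms(1) _ _ lit]) auto
  have "length (concat (map literal_word (rev new))) \<le> length (rev new) * (3 * length w + 5)"
    by (rule length_literal_words) (use bnd in auto)
  also have "\<dots> \<le> length w * (3 * length w + 5)"
    using bnd by (intro mult_le_mono1) auto
  finally have L: "length (concat (map literal_word (rev new))) \<le> N" using assms(3) by simp
  have L0: "0 \<notin> set (concat (map literal_word (rev new)))"
    using bnd zero_notin_literal_word by auto
  have "length w \<le> length w * (3 * length w + 5)" by simp
  with assms(3) have len: "length w \<le> N" by linarith
  obtain k where "u' = drop k u" using literals_rest[of a g \<phi> "Some True" "(0, 0)" u] lit by auto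
  then have u': "0 \<notin> set u'" "length u' \<le> N"
    using z(2) assms(5) len by (auto dest: in_set_dropD)
  have ac: "consistent new \<longleftrightarrow> accepted a g \<phi> u" by (simp add: accepted_def lit)
  have f: "tl f = []" using assms(6) by (cases f) auto
  have "wp N trial Q (search_state [] w u d f) \<longleftrightarrow>
      wp N (tableau ;;
       Cond (\<lambda>t. t ! 13 = 0) (Put 19 (\<lambda>_. 1)) Skip ;; Pop 13 ;; clear_stack 7 ;; clear_stack 1) Q
      (tableau_state w u [1] (0, 0) [] [[], w, u, d, f])"
    unfolding trial_def search_state_def tableau_state_start
    using z len assms(5) by (simp add: wp_macros)
  also have "\<dots> \<longleftrightarrow> wp N (Cond (\<lambda>t. t ! 13 = 0) (Put 19 (\<lambda>_. 1)) Skip ;; Pop 13 ;; clear_stack 7 ;; clear_stack 1) Q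
      (tableau_state [] u' [] (0, 0) (rev new) [[], w, u, d, f])"
    unfolding wp.simps(5)[of N tableau] wp_tableau[OF assms(1,2) lit assms(3)] ..
  also have "\<dots> \<longleftrightarrow> Q (search_state [] w u d (if accepted a g \<phi> u then [1] else f))"
    using L L0 u' f by (simp add: tableau_state_def search_state_def wp_macros ac unary_def)
  finally show ?thesis .
qed

text \<open>Leading twos wait on stack 9 while the carry passes, and come back as ones. If no digit
  is left to take the carry, all certificates have been tried.\<close>

definition increment :: com where
  "increment = (While (\<lambda>t. t ! 17 = 2) (shift 17 9) ;;
     Cond (\<lambda>t. t ! 17 = 1) (Put 17 (\<lambda>_. 2)) (Put 18 (\<lambda>_. 1)) ;;
     While (\<lambda>t. t ! 9 \<noteq> 0) (put_sym 17 (\<lambda>_. 1) ;; Pop 9))"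

lemma wp_increment:
  assumes "k \<le> N" "peek v \<noteq> 2"
  shows "wp N increment Q (search_state [] w (replicate k 2 @ v) [] f) \<longleftrightarrow>
    Q (if peek v = 1 then search_state [] w (replicate k 1 @ 2 # tl v) [] f
       else search_state [] w (replicate k 1 @ v) [1] f)"
proof -
  let ?s = "\<lambda>x u d. [[], [], [], [], [], [], [], [], [], x, [], [], [], [], [], [], w, u, d, f]"
  have 1: "loop N (Suc m) (\<lambda>t. t ! 17 = 2) (shift 17 9) Q (?s (replicate j 2) (replicate k 2 @ v) [])"
    if "Q (?s (replicate (k + j) 2) v [])" "k \<le> m" for k j m Q
    using that
  proof (induction k arbitrary: j m)
    case 0
    then show ?case using assms(2) by (simp add: loop_Suc)
  next
    case (Suc k)
    then obtain m' where m: "m = Suc m'" by (cases m) auto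
    have "loop N (Suc m') (\<lambda>t. t ! 17 = 2) (shift 17 9) Q (?s (replicate (Suc j) 2) (replicate k 2 @ v) [])"
      by (rule Suc.IH) (use Suc.prems m in auto)
    then show ?case
      by (simp add: m loop_Suc[of _ "Suc m'"] wp_macros)
  qed
  have 2: "loop N (Suc m) (\<lambda>t. t ! 9 \<noteq> 0) (put_sym 17 (\<lambda>_. 1) ;; Pop 9) Q (?s (replicate k 2) v d)"
    if "Q (?s [] (replicate k 1 @ v) d)" "k \<le> m" for k v d m Q
    using that
  proof (induction k arbitrary: v m)
    case 0
    then show ?case by (simp add: loop_Suc)
  next
    case (Suc k)
    then obtain m' where m: "m = Suc m'" by (cases m) auto
    have "loop N (Suc m') (\<lambda>t. t ! 9 \<noteq> 0) (put_sym 17 (\<lambda>_. 1) ;; Pop 9) Q (?s (replicate k 2) (1 # v) d)"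
      by (rule Suc.IH) (use Suc.prems m in \<open>auto simp: replicate_app_Cons_same\<close>)
    then show ?case
      by (simp add: m loop_Suc[of _ "Suc m'"] wp_macros)
  qed
  have "wp N (While (\<lambda>t. t ! 17 = 2) (shift 17 9)) R (?s [] (replicate k 2 @ v) []) \<longleftrightarrow>
      R (?s (replicate k 2) v [])" for R
    by (rule wp_eqI, unfold wp_While) (use 1[of _ k 0 N] assms(1) in simp)
  moreover have "wp N (While (\<lambda>t. t ! 9 \<noteq> 0) (put_sym 17 (\<lambda>_. 1) ;; Pop 9)) R (?s (replicate k 2) v d) \<longleftrightarrow>
      R (?s [] (replicate k 1 @ v) d)" for R v d
    by (rule wp_eqI, unfold wp_While, rule 2) (use assms(1) in simp_all)
  ultimately show ?thesis
    by (simp add: increment_def search_state_def)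
qed

definition search :: com where
  "search = (fill ;; While (\<lambda>t. t ! 18 = 0) (trial ;; increment))"

definition certificates :: "nat \<Rightarrow> word set" where
  "certificates n = {u \<in> lists {1, 2}. length u = n}"

theorem wp_search:
  assumes \<phi>: "only_moves \<phi>" "w = form_word a g \<phi>" and N: "length w * (3 * length w + 5) \<le> N" "2 ^ length w \<le> N"
    and Q: "\<And>u. Q (search_state [] w u [1] (if \<exists>v \<in> certificates (length w). accepted a g \<phi> v then [1] else []))"
  shows "wp N search Q (search_state (rev w) [] [] [] [])"
proof -
  let ?n = "length w"
  have len: "?n \<le> N" using N(2) less_exp[of ?n] by linarith
  define found where "found V = (if \<exists>v \<in> V. accepted a g \<phi> v then [1::nat] else [])" for V
  \<comment> \<open>These are the certificates already tried when the counter stands at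
    \<open>u\<close>.\<close>
  define below where "below u = {v \<in> certificates ?n. certificate_value v < certificate_value u}" for u
  define I where "I s \<longleftrightarrow> (\<exists>u d f. s = search_state [] w u d f \<and> u \<in> certificates ?n \<and>
     (d = [] \<and> f = found (below u) \<or> d = [1] \<and> f = found (certificates ?n)))" for s
  \<comment> \<open>Setting stack 18 drops the measure to zero, so the overflow counts as progress
    too.\<close>
  define m where "m s = (if s ! 18 = [] then 2 ^ ?n - certificate_value (s ! 17) else 0)" for s :: state
  have "loop N (Suc N) (\<lambda>t. t ! 18 = 0) (trial ;; increment) Q (search_state [] w (replicate ?n 1) [] [])"
  proof (rule loop_invariant[where I = I and m = m])
    have "certificate_value (replicate ?n 1) = 0"
      using certificate_value_replicate(1)[of ?n "[]"] by simp
    then have "found (below (replicate ?n 1)) = []" by (simp add: found_def below_def)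
    then show "I (search_state [] w (replicate ?n 1) [] [])"
      unfolding I_def
      by (intro exI[of _ "replicate ?n 1"] exI[of _ "[]"]) (auto simp: certificates_def in_lists_conv_set)
    show "m (search_state [] w (replicate ?n 1) [] []) < Suc N"
      using N(2) by (simp add: m_def search_state_def)
  next
    fix s assume "I s" and b: "map peek s ! 18 = 0"
    then obtain u d f where s: "s = search_state [] w u d f" "u \<in> certificates ?n"
      "d = [] \<and> f = found (below u) \<or> d = [1] \<and> f = found (certificates ?n)"
      unfolding I_def by blast
    with b have d: "d = []" "f = found (below u)" by (auto simp: search_state_def)
    have u: "u \<in> lists {1, 2}" "length u = ?n" using s(2) by (auto simp: certificates_def)
    define f' where "f' = (if accepted a g \<phi> u then [1] else f)"
    have f': "f' = found (insert u (below u))" by (auto simp: f'_def d found_def)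
    have eq_or: "v = u \<or> certificate_value v \<noteq> certificate_value u" if "v \<in> certificates ?n" for v
      using certificate_value_inject[of v u] that s(2) by (auto simp: certificates_def)
    have "length f \<le> 1" by (auto simp: d found_def)
    have trial: "wp N trial R s \<longleftrightarrow> R (search_state [] w u [] f')" for R
      unfolding s(1) d(1) f'_def by (rule wp_trial[OF \<phi> N(1) u \<open>length f \<le> 1\<close>])
    have ms: "m s = 2 ^ ?n - certificate_value u" "certificate_value u < 2 ^ ?n"
      using certificate_value_less[OF u(1)] u(2) by (auto simp: m_def s(1) d(1) search_state_def)
    from leading_twos[OF u(1)] consider k v where "u = replicate k 2 @ 1 # v" | k where "u = replicate k 2"
      by blast
    then have "wp N increment (\<lambda>s'. I s' \<and> m s' < m s) (search_state [] w u [] f')"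
    proof cases
      case (1 k v)
      let ?u = "replicate k 1 @ 2 # v"
      have val: "certificate_value ?u = Suc (certificate_value u)"
        using certificate_value_replicate(1)[of k "2 # v"] certificate_value_replicate(2)[of k "1 # v"] 1 by simp
      have cert: "?u \<in> certificates ?n"
        using u 1 by (auto simp: certificates_def in_lists_conv_set)
      have "insert u (below u) = below ?u"
        unfolding below_def val using s(2) eq_or by (auto simp: less_Suc_eq)
      then have "I (search_state [] w ?u [] f')"
        unfolding I_def f' using cert by auto
      moreover have "m (search_state [] w ?u [] f') < m s"
        using ms val by (simp add: m_def search_state_def del: certificate_value.simps)
      moreover have "k \<le> N" using u 1 len by auto
      ultimately show ?thesis
        using 1 by (simp add: wp_increment)
    next
      case (2 k)
      have k: "k = ?n" using 2 u(2) by simp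
      have val: "Suc (certificate_value u) = 2 ^ ?n"
        using certificate_value_replicate(2)[of k "[]"] 2 k by simp
      have "certificate_value v < Suc (certificate_value u)" if "v \<in> certificates ?n" for v
        using certificate_value_less[of v] that unfolding val by (auto simp: certificates_def)
      then have "insert u (below u) = certificates ?n"
        unfolding below_def using s(2) eq_or by (auto simp: less_Suc_eq)
      then have "I (search_state [] w (replicate k 1) [1] f')"
        unfolding I_def f' using k
        by (intro exI[of _ "replicate k 1"] exI[of _ "[1]"] exI) (auto simp: certificates_def in_lists_conv_set)
      moreover have "m (search_state [] w (replicate k 1) [1] f') < m s"
        using ms by (simp add: m_def search_state_def)
      ultimately show ?thesis
        using wp_increment[of k N "[]"] 2 k len by simp
    qed
    then show "wp N (trial ;; increment) (\<lambda>s'. I s' \<and> m s' < m s) s"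
      by (simp only: wp.simps trial)
  next
    fix s assume "I s" and b: "map peek s ! 18 \<noteq> 0"
    then obtain u d f where s: "s = search_state [] w u d f"
      "d = [] \<and> f = found (below u) \<or> d = [1] \<and> f = found (certificates ?n)"
      unfolding I_def by blast
    with b have "d = [1]" "f = found (certificates ?n)" by (auto simp: search_state_def)
    with Q s(1) show "Q s" by (simp add: found_def)
  qed
  then show ?thesis
    using len \<phi>(2) by (simp add: search_def wp_fill wp_While)
qed

section \<open>The deciding and the verifying machine\<close>

definition verify :: "nat set \<Rightarrow> nat set \<Rightarrow> com" where
  "verify RA RG = (parse False RA RG ;;
     Cond (\<lambda>t. t ! 4 = 0)
       (Pop 3 ;; move_stack 5 0 ;; put_sym 2 (\<lambda>_. 1) ;; tableau ;;
        Cond (\<lambda>t. t ! 13 = 0) (put_sym 15 (\<lambda>_. 1)) Skip)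
       Skip)"

text \<open>The pushed 5 negates the input, hence success is reported if no certificate was
  accepted. The parameter \<open>full\<close> affects only the parser, so one program serves both
  languages.\<close>

definition decide :: "bool \<Rightarrow> nat set \<Rightarrow> nat set \<Rightarrow> com" where
  "decide full RA RG = (parse full RA RG ;;
     Cond (\<lambda>t. t ! 4 = 0)
       (Pop 3 ;; move_stack 5 0 ;; put_sym 0 (\<lambda>_. 5) ;; elim ;; search ;;
        Cond (\<lambda>t. t ! 19 = 0) (put_sym 15 (\<lambda>_. 1)) Skip)
       Skip)"

text \<open>The verifier works on stacks 0 to 15; the search adds 16 to 19.\<close>

lemma wf_programs:
  assumes "\<And>q d. class_step RA q d < S" "\<And>q d. class_step RG q d < S" "20 \<le> S"
  shows "16 \<le> K \<Longrightarrow> wf_com K S (verify RA RG)"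
    and "20 \<le> K \<Longrightarrow> wf_com K S (decide full RA RG)"
  using assms
  by (simp_all add: verify_def decide_def parse_def parse_body_def parse_number_def tableau_def
      tableau_body_def tableau_leaf_def digits_loop_def add_literal_def check_literals_def
      check_literal_def compare_def compare_body_def steer_def bump_def opposite_def elim_def
      elim_body_def split_off_def split_off_body_def search_def fill_def trial_def increment_def)

lemma wp_restore:
  assumes "0 \<notin> set w" "length w \<le> N" "tl A = []"
  shows "wp N (Cond (\<lambda>t. t ! 4 = 0) (Pop 3 ;; move_stack 5 0 ;; c) d) Q
      ([] # u # [] # A # [] # rev w # zs) \<longleftrightarrow> wp N c Q (w # u # [] # [] # [] # [] # zs)"
  using assms by (simp add: wp_macros)

lemma wp_put_const:
  "wp N (put_sym 2 (\<lambda>_. 1) ;; c) Q (w # u # [] # zs) \<longleftrightarrow> wp N c Q (w # u # [1] # zs)"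
  "wp N (put_sym 0 (\<lambda>_. 5) ;; c) Q (w # zs) \<longleftrightarrow> wp N c Q ((5 # w) # zs)"
  by (simp_all add: wp_macros)

lemma pwords_singleton:
  "words full Atm Agt a g [1] = form_word a g ` language full Atm Agt"
  unfolding set_eq_iff words_form_iff by (simp add: language_def image_iff)

lemma numbering_image:
  "countable B \<Longrightarrow> to_nat_on B ` B = UNIV \<or> (\<exists>m. to_nat_on B ` B = {..<m})"
  using to_nat_on_finite[of B] to_nat_on_infinite[of B] by (auto simp: bij_betw_def)

lemma set_form_word: "set (form_word a g \<phi>) \<subseteq> alphabet" "set (prog_word a g \<alpha>) \<subseteq> alphabet"
  by (induction \<phi> and \<alpha>) (use binary_digits in \<open>force simp: alphabet_def\<close>)+

lemma satisfiable_elim: "satisfiable Atm Agt (elim_form \<phi>) \<longleftrightarrow> satisfiable Atm Agt \<phi>"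
  by (simp add: satisfiable_def valid_def sat_elim)

context
  fixes Atm :: "'p set" and Agt :: "'i set" and a :: "'p \<Rightarrow> nat" and g :: "'i \<Rightarrow> nat"
  assumes inj: "inj_on a Atm" "inj_on g Agt"
    and RA: "a ` Atm = UNIV \<or> (\<exists>m. a ` Atm = {..<m})"
    and RG: "g ` Agt = UNIV \<or> (\<exists>m. g ` Agt = {..<m})"
begin

text \<open>The bound does not involve \<open>u\<close> because no loop of the verifier runs over
  the certificate; the tableau takes at most one letter of it per conjunction.\<close>

lemma wp_verify:
  assumes "w \<in> lists alphabet" "length w * (3 * length w + 5) + length w + 1 \<le> N"
  shows "wp N (verify (a ` Atm) (g ` Agt))
    (\<lambda>s. peek (s ! 15) = 1 \<longleftrightarrow>
      (\<exists>\<phi> \<in> language False Atm Agt. w = form_word a g \<phi> \<and> accepted a g \<phi> u))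
    ([w, u] @ replicate 14 [])"
proof -
  have z: "0 \<notin> set w" using assms(1) by (auto simp: alphabet_def)
  note parse = wp_parse[OF RA RG]
  let ?Q = "\<lambda>s. peek (s ! 15) = 1 \<longleftrightarrow>
      (\<exists>\<phi> \<in> language False Atm Agt. w = form_word a g \<phi> \<and> accepted a g \<phi> u)"
  let ?rest = "Cond (\<lambda>t. t ! 4 = 0)
       (Pop 3 ;; move_stack 5 0 ;; put_sym 2 (\<lambda>_. 1) ;; tableau ;;
        Cond (\<lambda>t. t ! 13 = 0) (put_sym 15 (\<lambda>_. 1)) Skip) Skip"
  have "wp N (verify (a ` Atm) (g ` Agt)) ?Q (w # u # [] # [] # [] # [] # replicate 10 [])"
    unfolding verify_def wp.simps(5)[of N "parse _ _ _"]
  proof (rule parse)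
    fix A :: "nat list"
    assume "w \<in> words False Atm Agt a g [1]" "length A \<le> 1"
    then obtain \<phi> where \<phi>: "\<phi> \<in> language False Atm Agt" "w = form_word a g \<phi>" and A: "tl A = []"
      unfolding pwords_singleton by (cases A) auto
    then have mov: "only_moves \<phi>" by (auto simp: language_def)
    have uniq: "\<psi> = \<phi>" if "\<psi> \<in> language False Atm Agt" "w = form_word a g \<psi>" for \<psi>
      using word_append_eq(1)[OF inj, of \<psi> \<phi> "[]" "[]"] that \<phi> by (auto simp: language_def)
    obtain new u' where lit: "literals a g \<phi> (Some True) (0, 0) u = (new, u')" by fastforce
    have "(\<exists>\<phi> \<in> language False Atm Agt. w = form_word a g \<phi> \<and> accepted a g \<phi> u) \<longleftrightarrow> accepted a g \<phi> u"
      using \<phi> uniq by blast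
    then have acc: "(\<exists>\<phi> \<in> language False Atm Agt. w = form_word a g \<phi> \<and> accepted a g \<phi> u) \<longleftrightarrow> consistent new"
      by (simp add: accepted_def lit)
    have N: "length w * (3 * length w + 5) \<le> N" using assms(2) by simp
    have "wp N (tableau ;; Cond (\<lambda>t. t ! 13 = 0) (put_sym 15 (\<lambda>_. 1)) Skip) ?Q
        (tableau_state w u [1] (0, 0) [] [[]])"
      unfolding wp.simps(5) wp_tableau[OF mov \<phi>(2) lit N] acc
      by (auto simp: tableau_state_def wp_macros flag_def)
    then show "wp N ?rest ?Q
       ([] # u # [] # A # [] # rev w # replicate 10 [])"
    proof -
      have "tableau_state w u [1] (0, 0) [] [[]] = w # u # [1] # [] # [] # [] # replicate 10 []"
        unfolding tableau_state_start by (simp add: numeral_eq_Suc)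
      moreover have "length w \<le> N" using assms(2) by simp
      ultimately show ?thesis
        using \<open>wp N (tableau ;; _) _ _\<close> A by (simp only: wp_restore[OF z] wp_put_const)
    qed
  next
    fix w' p A t
    assume "w \<notin> words False Atm Agt a g [1]"
    then show "wp N ?rest ?Q
       (w' # u # p # A # [1] # t # replicate 10 [])"
      unfolding pwords_singleton by (auto simp: numeral_eq_Suc)
  qed (use z assms(2) in auto)
  then show ?thesis by (simp add: numeral_eq_Suc)
qed

lemma satisfiable_iff_accepted:
  assumes "form_over Atm Agt \<phi>" "only_moves \<phi>" "length (form_word a g \<phi>) \<le> n"
  shows "satisfiable Atm Agt \<phi> \<longleftrightarrow> (\<exists>u \<in> certificates n. accepted a g \<phi> u)"
proof
  assume "satisfiable Atm Agt \<phi>"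
  from satisfiable_iff_literals(2)[OF inj assms(1,2) this] obtain u where
    u: "u \<in> lists {1, 2}" "length u \<le> length (form_word a g \<phi>)" "\<And>r. accepted a g \<phi> (u @ r)"
    unfolding accepted_def by blast
  \<comment> \<open>Letters behind the needed certificate have no influence, so padding reduces the
    search to a single length.\<close>
  from u(1,2) assms(3) have "u @ replicate (n - length u) 1 \<in> certificates n"
    by (auto simp: certificates_def in_lists_conv_set)
  with u(3) show "\<exists>u \<in> certificates n. accepted a g \<phi> u" by blast
next
  assume "\<exists>u \<in> certificates n. accepted a g \<phi> u"
  then show "satisfiable Atm Agt \<phi>"
    using satisfiable_iff_literals(1)[OF inj assms(1,2)] by (auto simp: accepted_def certificates_def)
qed

lemma wp_decide:
  assumes "w \<in> lists alphabet"
  shows "\<exists>N. wp N (decide full (a ` Atm) (g ` Agt))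
    (\<lambda>s. peek (s ! 15) = 1 \<longleftrightarrow> w \<in> form_word a g ` {\<phi> \<in> language full Atm Agt. valid Atm Agt \<phi>})
    ([w] @ replicate 19 [])"
proof -
  have z: "0 \<notin> set w" using assms(1) by (auto simp: alphabet_def)
  note parse = wp_parse[OF RA RG]
  let ?Q = "\<lambda>s. peek (s ! 15) = 1 \<longleftrightarrow> w \<in> form_word a g ` {\<phi> \<in> language full Atm Agt. valid Atm Agt \<phi>}"
  let ?rest = "Cond (\<lambda>t. t ! 4 = 0)
       (Pop 3 ;; move_stack 5 0 ;; put_sym 0 (\<lambda>_. 5) ;; elim ;; search ;;
        Cond (\<lambda>t. t ! 19 = 0) (put_sym 15 (\<lambda>_. 1)) Skip) Skip"
  \<comment> \<open>The bound has to be fixed before the parser runs, but it depends on the formula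
    that the parser recognises; on other inputs the parser's own bound suffices.\<close>
  have "\<exists>N \<ge> Suc (length w). w \<in> words full Atm Agt a g [1] \<longrightarrow> (\<forall>A. length A \<le> 1 \<longrightarrow>
      wp N ?rest ?Q ([] # [] # [] # A # [] # rev w # replicate 14 []))"
  proof (cases "w \<in> words full Atm Agt a g [1]")
    case True
    then obtain \<phi> where \<phi>: "\<phi> \<in> language full Atm Agt" "w = form_word a g \<phi>"
      unfolding pwords_singleton by auto
    then have over: "form_over Atm Agt \<phi>" by (auto simp: language_def)
    have uniq: "\<psi> = \<phi>" if "\<psi> \<in> language full Atm Agt" "w = form_word a g \<psi>" for \<psi>
      using word_append_eq(1)[OF inj, of \<psi> \<phi> "[]" "[]"] that \<phi> by (auto simp: language_def)
    define \<psi> where "\<psi> = elim_form (Neg \<phi>)"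
    define v where "v = form_word a g \<psi>"
    have \<psi>: "form_over Atm Agt \<psi>" "only_moves \<psi>"
      unfolding \<psi>_def by (rule form_over_elim(1), simp add: over) (rule only_moves_elim(1))
    have "w \<in> form_word a g ` {\<phi> \<in> language full Atm Agt. valid Atm Agt \<phi>} \<longleftrightarrow> valid Atm Agt \<phi>"
      using \<phi> uniq by blast
    also have "\<dots> \<longleftrightarrow> \<not> satisfiable Atm Agt (Neg \<phi>)"
      by (simp add: satisfiable_def valid_def)
    also have "\<dots> \<longleftrightarrow> \<not> (\<exists>u \<in> certificates (length v). accepted a g \<psi> u)"
      using satisfiable_iff_accepted[OF \<psi>, of "length v"] satisfiable_elim[of _ _ "Neg \<phi>"]
      by (simp add: v_def \<psi>_def)
    finally have valid: "w \<in> form_word a g ` {\<phi> \<in> language full Atm Agt. valid Atm Agt \<phi>} \<longleftrightarrow>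
        \<not> (\<exists>u \<in> certificates (length v). accepted a g \<psi> u)" .
    obtain K where K: "\<And>N zs Q. K \<le> N \<Longrightarrow>
      wp N elim Q (elim_state (form_word a g (Neg \<phi>)) [] zs) \<longleftrightarrow> Q (elim_state [] (rev v) zs)"
      using wp_elim[of a g "Neg \<phi>"] unfolding v_def \<psi>_def by blast
    define N where "N = Suc (length w) + K + length v * (3 * length v + 5) + 2 ^ length v"
    have N: "K \<le> N" "length v * (3 * length v + 5) \<le> N" "2 ^ length v \<le> N" "Suc (length w) \<le> N"
      by (auto simp: N_def)
    have "wp N (search ;; Cond (\<lambda>t. t ! 19 = 0) (put_sym 15 (\<lambda>_. 1)) Skip) ?Q (search_state (rev v) [] [] [] [])"
      unfolding wp.simps(5)
      by (rule wp_search[OF \<psi>(2) v_def N(2,3)]) (auto simp: search_state_def wp_macros valid)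
    moreover have "elim_state [] (rev v) (replicate 13 []) = search_state (rev v) [] [] [] []"
      by (simp add: elim_state_def search_state_def numeral_eq_Suc)
    ultimately have "wp N (elim ;; search ;; Cond (\<lambda>t. t ! 19 = 0) (put_sym 15 (\<lambda>_. 1)) Skip) ?Q
        (elim_state (5 # w) [] (replicate 13 []))"
      using K[OF N(1)] unfolding \<phi>(2) form_word.simps wp.simps(5)[of N elim] by simp
    then have "wp N ?rest ?Q ([] # [] # [] # A # [] # rev w # replicate 14 [])" if "length A \<le> 1" for A
    proof -
      have "elim_state (5 # w) [] (replicate 13 []) = (5 # w) # [] # [] # [] # [] # [] # replicate 14 []"
        by (simp add: elim_state_def numeral_eq_Suc)
      moreover have "length w \<le> N" using N(4) by simp
      moreover have "tl A = []" using that by (cases A) auto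
      ultimately show ?thesis
        using \<open>wp N (elim ;; _) _ _\<close> by (simp only: wp_restore[OF z] wp_put_const)
    qed
    with N(4) show ?thesis by blast
  qed auto
  then obtain N where N: "Suc (length w) \<le> N"
    "\<And>A. w \<in> words full Atm Agt a g [1] \<Longrightarrow> length A \<le> 1 \<Longrightarrow>
      wp N ?rest ?Q ([] # [] # [] # A # [] # rev w # replicate 14 [])"
    by blast
  have "wp N (decide full (a ` Atm) (g ` Agt)) ?Q (w # [] # [] # [] # [] # [] # replicate 14 [])"
    unfolding decide_def wp.simps(5)[of N "parse _ _ _"]
  proof (rule parse)
    fix w' p A t
    assume "w \<notin> words full Atm Agt a g [1]"
    then show "wp N ?rest ?Q (w' # [] # p # A # [1] # t # replicate 14 [])"
      unfolding pwords_singleton by (auto simp: numeral_eq_Suc)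
  qed (use z N in auto)
  then show ?thesis by (intro exI[of _ N]) (simp add: numeral_eq_Suc)
qed

lemma ex_symbol_bound:
  "\<exists>S \<ge> 20. (\<forall>q d. class_step (a ` Atm) q d < S) \<and> (\<forall>q d. class_step (g ` Agt) q d < S)"
proof -
  obtain B where B: "\<And>ds. num_class (a ` Atm) ds < B"
    using ex_num_class_bound[OF RA] by blast
  obtain C where C: "\<And>ds. num_class (g ` Agt) ds < C"
    using ex_num_class_bound[OF RG] by blast
  have "class_step (a ` Atm) q d < B + C + 20" "class_step (g ` Agt) q d < B + C + 20" for q d
    unfolding class_step_def by (rule less_le_trans[OF B], simp) (rule less_le_trans[OF C], simp)
  then show ?thesis
    by (intro exI[of _ "B + C + 20"]) simp
qed

lemma decidable_language:
  "decidable_lang alphabet (form_word a g ` {\<phi> \<in> language full Atm Agt. valid Atm Agt \<phi>})"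
proof -
  let ?L = "form_word a g ` {\<phi> \<in> language full Atm Agt. valid Atm Agt \<phi>}"
  obtain S where S: "\<And>q d. class_step (a ` Atm) q d < S" "\<And>q d. class_step (g ` Agt) q d < S" "20 \<le> S"
    using ex_symbol_bound by blast
  from compile_com[OF wf_programs(2)[OF S, of 20 full], of 15] S(3) obtain M where
    M: "wf_tm M" "num_tapes M = 20" "num_symbols M = S"
    "\<And>ws N B. length ws \<le> 20 \<Longrightarrow>
       wp N (decide full (a ` Atm) (g ` Agt)) (\<lambda>s. peek (s ! 15) = 1 \<longleftrightarrow> B) (ws @ replicate (20 - length ws) []) \<Longrightarrow>
       \<exists>t. state_after M ws t = (if B then 1 else 2)"
    by fastforce
  have "(\<exists>t. halts_within M [w] t) \<and> (accepts M [w] \<longleftrightarrow> w \<in> ?L)" if w: "w \<in> lists alphabet" for w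
  proof -
    obtain N where "wp N (decide full (a ` Atm) (g ` Agt)) (\<lambda>s. peek (s ! 15) = 1 \<longleftrightarrow> w \<in> ?L)
        ([w] @ replicate 19 [])"
      using wp_decide[OF w] by blast
    then obtain t where t: "state_after M [w] t = (if w \<in> ?L then 1 else 2)"
      using M(4)[of "[w]" N "w \<in> ?L"] by auto
    then have "halts_within M [w] t" by (auto simp: halts_within_def)
    with accepts_iff[OF t] show ?thesis by blast
  qed
  moreover have "?L \<subseteq> lists alphabet" using set_form_word(1) by auto
  moreover have "alphabet \<subseteq> {1..<num_symbols M}" using M(3) S(3) by (auto simp: alphabet_def)
  ultimately show ?thesis
    using M(1) unfolding decidable_lang_def by blast
qed

lemma NP_satisfiable:
  "NP_lang alphabet (form_word a g ` {\<phi> \<in> language False Atm Agt. satisfiable Atm Agt \<phi>})"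
proof -
  let ?L = "form_word a g ` {\<phi> \<in> language False Atm Agt. satisfiable Atm Agt \<phi>}"
  let ?B = "\<lambda>w u. \<exists>\<phi> \<in> language False Atm Agt. w = form_word a g \<phi> \<and> accepted a g \<phi> u"
  let ?c = "verify (a ` Atm) (g ` Agt)"
  obtain S where S: "\<And>q d. class_step (a ` Atm) q d < S" "\<And>q d. class_step (g ` Agt) q d < S" "20 \<le> S"
    using ex_symbol_bound by blast
  from compile_com[OF wf_programs(1)[OF S, of 16], of 15] S(3) obtain M where
    M: "wf_tm M" "num_tapes M = 16" "num_symbols M = S"
    "\<And>ws N B. length ws \<le> 16 \<Longrightarrow>
       wp N ?c (\<lambda>s. peek (s ! 15) = 1 \<longleftrightarrow> B) (ws @ replicate (16 - length ws) []) \<Longrightarrow>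
       \<exists>t \<le> Suc (poly (time_poly ?c) N). state_after M ws t = (if B then 1 else 2)"
    by fastforce
  \<comment> \<open>\<open>q\<close> is the loop bound required by \<open>wp_verify\<close>. In
    \<open>p\<close>, the summand 1 pays for the final halting step and \<open>[:0, 1:]\<close>
    makes room for certificates as long as the input.\<close>
  define q :: "nat poly" where "q = [:1, 6, 3:]"
  define p where "p = 1 + pcompose (time_poly ?c) q + [:0, 1:]"
  have q: "poly q n = n * (3 * n + 5) + n + 1" for n
    by (simp add: q_def algebra_simps)
  have p: "Suc (poly (time_poly ?c) (poly q n)) \<le> poly p n" "n \<le> poly p n" for n
    by (auto simp: p_def poly_pcompose)
  have run: "halts_within M [w, u] (poly p (length w))" "accepts M [w, u] \<longleftrightarrow> ?B w u"
    if w: "w \<in> lists alphabet" for w u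
  proof -
    have "wp (poly q (length w)) ?c (\<lambda>s. peek (s ! 15) = 1 \<longleftrightarrow> ?B w u) ([w, u] @ replicate 14 [])"
      by (rule wp_verify[OF w]) (simp add: q)
    then obtain t where t: "t \<le> Suc (poly (time_poly ?c) (poly q (length w)))"
      "state_after M [w, u] t = (if ?B w u then 1 else 2)"
      using M(4)[of "[w, u]" "poly q (length w)" "?B w u"] by auto
    then have "state_after M [w, u] (poly p (length w)) = state_after M [w, u] t"
      using p(1)[of "length w"] by (intro state_after_stable) auto
    with t(2) show "halts_within M [w, u] (poly p (length w))"
      by (auto simp: halts_within_def)
    show "accepts M [w, u] \<longleftrightarrow> ?B w u" by (rule accepts_iff[OF t(2)])
  qed
  have mem: "w \<in> ?L \<longleftrightarrow> (\<exists>u \<in> lists {1, 2}. length u \<le> poly p (length w) \<and> accepts M [w, u])"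
    if w: "w \<in> lists alphabet" for w
  proof
    assume "w \<in> ?L"
    then obtain \<phi> where \<phi>: "\<phi> \<in> language False Atm Agt" "satisfiable Atm Agt \<phi>" "w = form_word a g \<phi>"
      by blast
    then obtain u where "u \<in> certificates (length w)" "accepted a g \<phi> u"
      using satisfiable_iff_accepted[of \<phi> "length w"] by (auto simp: language_def)
    moreover from this have "?B w u" using \<phi> by blast
    ultimately show "\<exists>u \<in> lists {1, 2}. length u \<le> poly p (length w) \<and> accepts M [w, u]"
      using run(2)[OF w] p(2) by (intro bexI[of _ u]) (auto simp: certificates_def)
  next
    assume "\<exists>u \<in> lists {1, 2}. length u \<le> poly p (length w) \<and> accepts M [w, u]"
    then obtain u \<phi> where "u \<in> lists {1, 2}" "\<phi> \<in> language False Atm Agt" "w = form_word a g \<phi>" "accepted a g \<phi> u"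
      using run(2)[OF w] by blast
    then show "w \<in> ?L"
      using satisfiable_iff_literals(1)[OF inj, of \<phi>] by (auto simp: language_def accepted_def)
  qed
  have alph: "alphabet \<union> {1, 2} \<subseteq> {1..<num_symbols M}" using M(3) S(3) by (auto simp: alphabet_def)
  have L: "?L \<subseteq> lists alphabet" using set_form_word(1) by auto
  have tapes: "2 \<le> num_tapes M" using M(2) by simp
  show ?thesis
    unfolding NP_lang_def
    by (intro conjI exI[of _ M] exI[of _ p] ballI impI) (assumption | rule L M(1) tapes alph run(1) mem)+
qed

end

theorem theorem4:
  fixes Atm :: "'p set" and Agt :: "'i set"
  assumes "countable Atm" and "finite Agt"
  shows "decidable_lang alphabet (encode Atm Agt ` DLS0 Atm Agt) \<and>
         decidable_lang alphabet (encode Atm Agt ` DLS Atm Agt) \<and>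
         NP_lang alphabet (encode Atm Agt ` SAT_DLS0 Atm Agt)"
proof -
  have count: "countable Agt" using assms(2) by (rule countable_finite)
  note inj = inj_on_to_nat_on[OF assms(1)] inj_on_to_nat_on[OF count]
  have "DLS0 Atm Agt = {\<phi> \<in> language False Atm Agt. valid Atm Agt \<phi>}"
    "DLS Atm Agt = {\<phi> \<in> language True Atm Agt. valid Atm Agt \<phi>}"
    "SAT_DLS0 Atm Agt = {\<phi> \<in> language False Atm Agt. satisfiable Atm Agt \<phi>}"
    by (auto simp: DLS0_def DLS_def SAT_DLS0_def language_def lang_DLS0_def lang_DLS_def)
  then show ?thesis
    using decidable_language[OF inj numbering_image[OF assms(1)] numbering_image[OF count]]
      NP_satisfiable[OF inj numbering_image[OF assms(1)] numbering_image[OF count]]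
    by (simp add: encode_def)
qed

end
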